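(* Let $V=(S,T)$ be a pure $p$-isopair of finite bimultiplicity with minimal polynomial $p$, and write $p=p_1p_2\cdots p_s$ as a product of distinct irreducible factors. If $V$ has rank $\alpha=(\alpha_1,\dots,\alpha_s)$ and $\beta=\max\{\alpha_1,\dots,\alpha_s\}$, then (i) there exists a finite codimension invariant subspace $H$ for $V$ such that the restriction of $V$ to $H$ is $\beta$-cyclic; (ii) $V$ is not $k$-cyclic for any $k<\beta$; and (iii) there exist a $\beta$-cyclic pure $p$-isopair $V'$ and an invariant subspace $K$ for $V'$ such that $V$ is the restriction of $V'$ to $K$.
   Context: Let $\mathbb D$, $\mathbb T$, $\mathbb E$ be the open unit disk, the unit circle, and the complement of the closed unit disk in $\mathbb C$. $Z(p)$ is the zero set of a polynomial $p$. A polynomial $p\in\mathbb C[z,w]$ is square free if no $q^2$ with $q$ non-constant divides $p$; it is inner toral if $Z(p)\subset \mathbb D^2\cup\mathbb T^2\cup\mathbb E^2$. An isometry $S$ on a (complex) Hilbert space $H$ is pure if $\bigcap_{j\ge1}S^jH=\{0\}$; its multiplicity is $\operatorname{mult}(S)=\dim\ker(S^* )$. A pure isopair is a pair $V=(S,T)$ of commuting pure isometries on the same Hilbert space. For a nonzero polynomial $q$, $V$ is a pure $q$-isopair if $q(S,T)=0$; $V$ is algebraic if it is a pure $q$-isopair for some nonzero $q$. The bimultiplicity of $V$ is $(\operatorname{mult}(S),\operatorname{mult}(T))$; it is finite if both entries are. An invariant subspace for $V$ is a closed subspace invariant under both $S$ and $T$. Minimal polynomial: for a pure algebraic isopair $V=(S,T)$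 it is known that there is a square free inner toral polynomial $p$ with $p(S,T)=0$ such that $p$ divides every $q$ with $q(S,T)=0$; it is unique up to a nonzero constant factor and is called the minimal polynomial of $V$. Rank: let $V=(S,T)$ have finite bimultiplicity and minimal polynomial $p=p_1\cdots p_s$ with distinct irreducible factors $p_j$ (each is inner toral). Put $\mathfrak V(p_j)=Z(p_j)\cap\mathbb D^2$. A point $(\lambda,\mu)$ is regular for $p$ if $p(\lambda,\mu)=0$ and $\nabla p(\lambda,\mu)\ne0$. For each $j$, $\dim(\ker(S-\lambda)^*\cap\ker(T-\mu)^* )$ takes the same positive integer value $\alpha_j$ at every $(\lambda,\mu)\in\mathfrak V(p_j)$ that is regular for $p$; the rank of $V$ is $\alpha=(\alpha_1,\dots,\alpha_s)$. Cyclicity: an isopair $V=(S,T)$ on $H$ is at most nearly $k$-cyclic if there are distinct $f_1,\dots,f_k\in H$ such that the closure of $\{\sum_{j=1}^k q_j(S,T)f_j: q_j\in\mathbb C[z,w]\}$ has finite codimension in $H$. It is at least nearly $k$-cyclic if for every $l<k$ and all $f_1,\dots,f_l\in H$ the closure of $\{\sum_{j=1}^l q_j(S,T)f_j: q_j\in\mathbb C[z,w]\}$ does not have finite codimension in $H$. It is nearly $k$-cyclic if it is both at most and at least nearly $k$-cyclic. It is $k$-cyclic if it is nearly $k$-cyclic and, for some distinct $f_1,\dots,f_k\in H$, the set $\{\sum_{j=1}^k q_j(S,T)f_j: q_j\in\mathbb C[z,w]\}$ is dense in $H$. *)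

theory Defs
  imports
    "HOL-Analysis.Analysis"
    "HOL-Computational_Algebra.Computational_Algebra"
begin

section \<open>Complex Hilbert spaces\<close>

text \<open>
  The complex inner product is linear in the first argument; the norm, metric and topology
  are those of the underlying real inner product \<open>Re \<langle>x, y\<rangle>\<close>.
\<close>

class chilbert_space = real_inner + banach +
  fixes scaleC :: "complex \<Rightarrow> 'a \<Rightarrow> 'a" (infixr "*\<^sub>C" 75)
    and cinner :: "'a \<Rightarrow> 'a \<Rightarrow> complex"
  assumes scaleC_add_right: "a *\<^sub>C (x + y) = a *\<^sub>C x + a *\<^sub>C y"
    and scaleC_add_left: "(a + b) *\<^sub>C x = a *\<^sub>C x + b *\<^sub>C x"
    and scaleC_scaleC: "a *\<^sub>C b *\<^sub>C x = (a * b) *\<^sub>C x"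
    and scaleC_one: "1 *\<^sub>C x = x"
    and scaleR_eq_scaleC: "r *\<^sub>R x = complex_of_real r *\<^sub>C x"
    and cinner_commute: "cinner x y = cnj (cinner y x)"
    and cinner_add_left: "cinner (x + y) z = cinner x z + cinner y z"
    and cinner_scaleC_left: "cinner (a *\<^sub>C x) y = a * cinner x y"
    and inner_eq_Re_cinner: "inner x y = Re (cinner x y)"

global_interpretation complex_vector:
  vector_space "scaleC :: complex \<Rightarrow> 'a \<Rightarrow> 'a::chilbert_space"
  by unfold_locales
    (simp_all add: scaleC_add_right scaleC_add_left scaleC_scaleC scaleC_one)

text \<open>
  Hilbert spaces occur as closed subspaces \<open>H\<close> of a type of class \<open>chilbert_space\<close>
  (possibly \<open>H = UNIV\<close>), and operators on \<open>H\<close> as functions of which only the values on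
  \<open>H\<close> matter. The restriction of an operator to an invariant subspace is then the same
  function, considered on the smaller space.
\<close>

definition closed_csubspace :: "'a::chilbert_space set \<Rightarrow> bool" where
  "closed_csubspace H \<longleftrightarrow> complex_vector.subspace H \<and> closed H"

definition clinear_on :: "'a::chilbert_space set \<Rightarrow> ('a \<Rightarrow> 'b::chilbert_space) \<Rightarrow> bool" where
  "clinear_on H A \<longleftrightarrow>
     (\<forall>x\<in>H. \<forall>y\<in>H. A (x + y) = A x + A y) \<and> (\<forall>c. \<forall>x\<in>H. A (c *\<^sub>C x) = c *\<^sub>C A x)"

text \<open>For a bounded operator on a Hilbert space the element described is unique and exists.\<close>

definition adjoint_on :: "'a::chilbert_space set \<Rightarrow> ('a \<Rightarrow> 'a) \<Rightarrow> 'a \<Rightarrow> 'a" where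
  "adjoint_on H A y = (THE z. z \<in> H \<and> (\<forall>x\<in>H. cinner (A x) y = cinner x z))"

definition ker_adjoint :: "'a::chilbert_space set \<Rightarrow> ('a \<Rightarrow> 'a) \<Rightarrow> 'a set" where
  "ker_adjoint H A = {y \<in> H. adjoint_on H A y = 0}"

definition finite_dim :: "'a::chilbert_space set \<Rightarrow> bool" where
  "finite_dim M \<longleftrightarrow> (\<exists>F. finite F \<and> M \<subseteq> complex_vector.span F)"

definition finite_codim_in :: "'a::chilbert_space set \<Rightarrow> 'a set \<Rightarrow> bool" where
  "finite_codim_in H M \<longleftrightarrow>
     M \<subseteq> H \<and> (\<exists>F. finite F \<and> F \<subseteq> H \<and> H = complex_vector.span (M \<union> F))"

section \<open>Polynomials in two variables\<close>

text \<open>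
  An element of \<open>\<complex>[z, w]\<close> is a polynomial in \<open>w\<close> whose coefficients are polynomials in \<open>z\<close>:
  \<open>coeff (coeff p i) j\<close> is the coefficient of \<open>z\<^sup>j w\<^sup>i\<close>.
\<close>

type_synonym poly2 = "complex poly poly"

definition eval2 :: "poly2 \<Rightarrow> complex \<Rightarrow> complex \<Rightarrow> complex" where
  "eval2 p z w = poly (poly p [:w:]) z"

definition inner_toral :: "poly2 \<Rightarrow> bool" where
  "inner_toral p \<longleftrightarrow>
     {(z, w). eval2 p z w = 0} \<subseteq>
       ball 0 1 \<times> ball 0 1 \<union> sphere 0 1 \<times> sphere 0 1 \<union> (- cball 0 1) \<times> (- cball 0 1)"

text \<open>
  \<open>map_poly pderiv p\<close> and \<open>pderiv p\<close> are the partial derivatives with respect to \<open>z\<close> and \<open>w\<close>.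
\<close>

definition regular_point :: "poly2 \<Rightarrow> complex \<Rightarrow> complex \<Rightarrow> bool" where
  "regular_point p z w \<longleftrightarrow>
     eval2 p z w = 0 \<and> (eval2 (map_poly pderiv p) z w, eval2 (pderiv p) z w) \<noteq> (0, 0)"

definition op_eval :: "poly2 \<Rightarrow> ('a::chilbert_space \<Rightarrow> 'a) \<Rightarrow> ('a \<Rightarrow> 'a) \<Rightarrow> 'a \<Rightarrow> 'a" where
  "op_eval q S T x =
     (\<Sum>i\<le>degree q. \<Sum>j\<le>degree (coeff q i). coeff (coeff q i) j *\<^sub>C (S ^^ j) ((T ^^ i) x))"

definition annihilates :: "poly2 \<Rightarrow> 'a::chilbert_space set \<Rightarrow> ('a \<Rightarrow> 'a) \<Rightarrow> ('a \<Rightarrow> 'a) \<Rightarrow> bool" where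
  "annihilates q H S T \<longleftrightarrow> (\<forall>x\<in>H. op_eval q S T x = 0)"

section \<open>Isopairs\<close>

definition isometry_on :: "'a::chilbert_space set \<Rightarrow> ('a \<Rightarrow> 'a) \<Rightarrow> bool" where
  "isometry_on H S \<longleftrightarrow> S ` H \<subseteq> H \<and> clinear_on H S \<and> (\<forall>x\<in>H. norm (S x) = norm x)"

definition pure_isometry :: "'a::chilbert_space set \<Rightarrow> ('a \<Rightarrow> 'a) \<Rightarrow> bool" where
  "pure_isometry H S \<longleftrightarrow> isometry_on H S \<and> (\<Inter>j\<in>{1..}. (S ^^ j) ` H) = {0}"

definition pure_isopair :: "'a::chilbert_space set \<Rightarrow> ('a \<Rightarrow> 'a) \<Rightarrow> ('a \<Rightarrow> 'a) \<Rightarrow> bool" where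
  "pure_isopair H S T \<longleftrightarrow>
     closed_csubspace H \<and> pure_isometry H S \<and> pure_isometry H T \<and> (\<forall>x\<in>H. S (T x) = T (S x))"

definition pure_q_isopair ::
    "poly2 \<Rightarrow> 'a::chilbert_space set \<Rightarrow> ('a \<Rightarrow> 'a) \<Rightarrow> ('a \<Rightarrow> 'a) \<Rightarrow> bool" where
  "pure_q_isopair q H S T \<longleftrightarrow> q \<noteq> 0 \<and> pure_isopair H S T \<and> annihilates q H S T"

definition finite_bimultiplicity ::
    "'a::chilbert_space set \<Rightarrow> ('a \<Rightarrow> 'a) \<Rightarrow> ('a \<Rightarrow> 'a) \<Rightarrow> bool" where
  "finite_bimultiplicity H S T \<longleftrightarrow> finite_dim (ker_adjoint H S) \<and> finite_dim (ker_adjoint H T)"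

definition minimal_polynomial ::
    "poly2 \<Rightarrow> 'a::chilbert_space set \<Rightarrow> ('a \<Rightarrow> 'a) \<Rightarrow> ('a \<Rightarrow> 'a) \<Rightarrow> bool" where
  "minimal_polynomial p H S T \<longleftrightarrow>
     squarefree p \<and> inner_toral p \<and> annihilates p H S T \<and>
     (\<forall>q. annihilates q H S T \<longrightarrow> p dvd q)"

text \<open>
  The tuple \<open>\<alpha> 1, \<dots>, \<alpha> s\<close> is the rank of \<open>(S, T)\<close> with respect to the irreducible factors
  \<open>P 1, \<dots>, P s\<close> of its minimal polynomial \<open>p\<close>. As \<open>complex_vector.dim\<close> is \<open>0\<close> on
  infinite-dimensional subspaces, a positive value means a finite dimension.
\<close>

definition has_rank ::
    "'a::chilbert_space set \<Rightarrow> ('a \<Rightarrow> 'a) \<Rightarrow> ('a \<Rightarrow> 'a) \<Rightarrow> poly2 \<Rightarrow> nat \<Rightarrow> (nat \<Rightarrow> poly2) \<Rightarrow>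
     (nat \<Rightarrow> nat) \<Rightarrow> bool" where
  "has_rank H S T p s P \<alpha> \<longleftrightarrow>
     (\<forall>j\<in>{1..s}. 0 < \<alpha> j \<and>
       (\<forall>l\<in>ball 0 1. \<forall>m\<in>ball 0 1. eval2 (P j) l m = 0 \<longrightarrow> regular_point p l m \<longrightarrow>
          complex_vector.dim
            (ker_adjoint H (\<lambda>x. S x - l *\<^sub>C x) \<inter> ker_adjoint H (\<lambda>x. T x - m *\<^sub>C x)) = \<alpha> j))"

definition invariant_subspace ::
    "'a::chilbert_space set \<Rightarrow> ('a \<Rightarrow> 'a) \<Rightarrow> ('a \<Rightarrow> 'a) \<Rightarrow> 'a set \<Rightarrow> bool" where
  "invariant_subspace H S T K \<longleftrightarrow>
     K \<subseteq> H \<and> closed_csubspace K \<and> S ` K \<subseteq> K \<and> T ` K \<subseteq> K"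

section \<open>Cyclicity\<close>

definition poly_combs ::
    "('a::chilbert_space \<Rightarrow> 'a) \<Rightarrow> ('a \<Rightarrow> 'a) \<Rightarrow> nat \<Rightarrow> (nat \<Rightarrow> 'a) \<Rightarrow> 'a set" where
  "poly_combs S T k f = range (\<lambda>q :: nat \<Rightarrow> poly2. \<Sum>j=1..k. op_eval (q j) S T (f j))"

definition at_most_nearly_cyclic ::
    "'a::chilbert_space set \<Rightarrow> ('a \<Rightarrow> 'a) \<Rightarrow> ('a \<Rightarrow> 'a) \<Rightarrow> nat \<Rightarrow> bool" where
  "at_most_nearly_cyclic H S T k \<longleftrightarrow>
     (\<exists>f. f ` {1..k} \<subseteq> H \<and> inj_on f {1..k} \<and> finite_codim_in H (closure (poly_combs S T k f)))"

definition at_least_nearly_cyclic ::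
    "'a::chilbert_space set \<Rightarrow> ('a \<Rightarrow> 'a) \<Rightarrow> ('a \<Rightarrow> 'a) \<Rightarrow> nat \<Rightarrow> bool" where
  "at_least_nearly_cyclic H S T k \<longleftrightarrow>
     (\<forall>l<k. \<forall>f. f ` {1..l} \<subseteq> H \<longrightarrow> \<not> finite_codim_in H (closure (poly_combs S T l f)))"

definition nearly_cyclic ::
    "'a::chilbert_space set \<Rightarrow> ('a \<Rightarrow> 'a) \<Rightarrow> ('a \<Rightarrow> 'a) \<Rightarrow> nat \<Rightarrow> bool" where
  "nearly_cyclic H S T k \<longleftrightarrow> at_most_nearly_cyclic H S T k \<and> at_least_nearly_cyclic H S T k"

definition cyclic ::
    "'a::chilbert_space set \<Rightarrow> ('a \<Rightarrow> 'a) \<Rightarrow> ('a \<Rightarrow> 'a) \<Rightarrow> nat \<Rightarrow> bool" where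
  "cyclic H S T k \<longleftrightarrow>
     nearly_cyclic H S T k \<and>
     (\<exists>f. f ` {1..k} \<subseteq> H \<and> inj_on f {1..k} \<and> closure (poly_combs S T k f) = H)"

text \<open>
  \<open>(S, T)\<close> on \<open>H\<close> is, up to the identification of \<open>H\<close> with \<open>K\<close> by a unitary, the
  restriction of \<open>(S', T')\<close> to \<open>K\<close>.
\<close>

definition is_restriction_to ::
    "'a::chilbert_space set \<Rightarrow> ('a \<Rightarrow> 'a) \<Rightarrow> ('a \<Rightarrow> 'a) \<Rightarrow>
     'b::chilbert_space set \<Rightarrow> ('b \<Rightarrow> 'b) \<Rightarrow> ('b \<Rightarrow> 'b) \<Rightarrow> bool" where
  "is_restriction_to H S T K S' T' \<longleftrightarrow>
     (\<exists>U. clinear_on H U \<and> (\<forall>x\<in>H. norm (U x) = norm x) \<and> U ` H = K \<and>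
          (\<forall>x\<in>H. U (S x) = S' (U x)) \<and> (\<forall>x\<in>H. U (T x) = T' (U x)))"

end

theory Submission
  imports Defs "HOL-Computational_Algebra.Field_as_Ring"
begin

text \<open>
  The pure isometry \<open>S\<close> behaves like multiplication by \<open>z\<close> on a Hardy space of functions on the
  disc with values in a space of dimension \<open>M = dim (ker S\<^sup>*)\<close>. The fibre of \<open>H\<close> over a
  point \<open>l\<close> is the orthogonal complement of \<open>(S - l) H\<close>, that is, the eigenspace of \<open>S\<^sup>*\<close>
  for the conjugate of \<open>l\<close>, and pairing a vector with the fibre evaluates it at \<open>l\<close>. All fibres
  have dimension \<open>M\<close>. The relation \<open>p(S, T) = 0\<close> says that \<open>T\<close> acts on the fibre over \<open>l\<close> by a
  matrix annihilated by \<open>p(l, w)\<close>. As \<open>p\<close> is square free, \<open>p(l, w)\<close> has simple roots for all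
  but finitely many \<open>l\<close> (\<open>generic_slice_rsquarefree\<close>). Over such an \<open>l\<close> the fibre is the sum of
  the joint eigenspaces at the zeros \<open>(l, m)\<close> of \<open>p\<close> (\<open>eigenspace_decomposition\<close>); these zeros
  lie in the bidisc because \<open>p\<close> is inner toral, they are regular points, and the dimensions of the
  joint eigenspaces are the entries of the rank.

  Fewer than \<open>\<beta>\<close> vectors cannot nearly generate \<open>H\<close>: choose a factor of rank \<open>\<beta>\<close>. At
  each of its regular zeros the joint eigenspace contains a nonzero vector orthogonal to the given
  vectors, hence to everything that they generate. Infinitely many eigenvalues occur, so the
  orthogonal complement has infinite dimension (\<open>few_generators_infinite_codimension\<close>).

  Conversely \<open>\<beta>\<close> vectors suffice, and it is enough to look at a single generic point \<open>l\<close>.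
  Since every joint eigenspace over \<open>l\<close> has dimension at most \<open>\<beta>\<close>, there are \<open>\<beta>\<close> constant
  vectors \<open>f\<^sub>i\<close> such that the values at \<open>l\<close> of all \<open>T\<^sup>k f\<^sub>i\<close> span the fibre
  (\<open>separating_vectors\<close>). Finite multiplicity of \<open>T\<close> provides a polynomial \<open>d\<close> without zeros in
  the disc such that \<open>d(S) T\<close> maps polynomial vectors to polynomial vectors and raises degrees by a
  bounded amount (\<open>polynomial_multiple_of_T\<close>): the symbol of \<open>T\<close> is rational. So \<open>M\<close> of the
  polynomial vectors \<open>(d(S) T)\<^sup>k f\<^sub>i\<close> are independent at \<open>l\<close>, and therefore generate a free
  module of rank \<open>M\<close> over the polynomials in \<open>S\<close> (\<open>cindependent_shifts\<close>). Comparing dimensions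
  degree by degree, this module has finite codimension in the space of all polynomial vectors
  (\<open>filtration_codimension\<close>), which is dense in \<open>H\<close>. Hence the closed invariant subspace \<open>K\<close>
  generated by the \<open>f\<^sub>i\<close> has finite codimension (\<open>nearly_generating_vectors\<close>).

  Finally \<open>S\<^sup>*\<close> acts on the orthogonal complement of \<open>K\<close>, a finite-dimensional space, with
  eigenvalues in the disc. The Blaschke product \<open>b\<close> with the conjugate zeros satisfies
  \<open>b(S) H \<subseteq> K\<close>, and \<open>b(S)\<close> is an isometry commuting with \<open>S\<close> and \<open>T\<close>
  (\<open>intertwiner_into_finite_codim\<close>). So the given pair is unitarily equivalent to the restriction
  of the \<open>\<beta>\<close>-cyclic pair on \<open>K\<close> to \<open>b(S) H\<close>.
\<close>

section \<open>Orthogonal projections\<close>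

global_interpretation complex_vector_pair:
  vector_space_pair "scaleC :: complex \<Rightarrow> 'a \<Rightarrow> 'a::chilbert_space"
    "scaleC :: complex \<Rightarrow> 'b \<Rightarrow> 'b::chilbert_space"
  by unfold_locales

abbreviation csubspace :: "'a::chilbert_space set \<Rightarrow> bool" where
  "csubspace \<equiv> complex_vector.subspace"

abbreviation cspan :: "'a::chilbert_space set \<Rightarrow> 'a set" where
  "cspan \<equiv> complex_vector.span"

abbreviation cindependent :: "'a::chilbert_space set \<Rightarrow> bool" where
  "cindependent B \<equiv> \<not> complex_vector.dependent B"

abbreviation clinear :: "('a::chilbert_space \<Rightarrow> 'b::chilbert_space) \<Rightarrow> bool" where
  "clinear \<equiv> Vector_Spaces.linear scaleC scaleC"

lemma clinearI:
  assumes "\<And>x y. f (x + y) = f x + f y" "\<And>c x. f (c *\<^sub>C x) = c *\<^sub>C f x"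
  shows "clinear f"
  using assms by (simp add: Vector_Spaces.linear_iff complex_vector.vector_space_axioms)

lemmas clinear_simps =
  complex_vector_pair.linear_add complex_vector_pair.linear_scale complex_vector_pair.linear_0
  complex_vector_pair.linear_diff complex_vector_pair.linear_sum complex_vector_pair.linear_neg

lemma cinner_add_right: "cinner x (y + z) = cinner x y + cinner x z"
  by (metis cinner_add_left cinner_commute complex_cnj_add)

lemma cinner_scaleC_right: "cinner x (a *\<^sub>C y) = cnj a * cinner x y"
  by (metis cinner_scaleC_left cinner_commute complex_cnj_mult)

lemma cinner_zero_left [simp]: "cinner 0 y = 0"
  using cinner_add_left[of 0 0 y] by simp

lemma cinner_zero_right [simp]: "cinner x 0 = 0"
  using cinner_add_right[of x 0 0] by simp

lemma cinner_minus_left: "cinner (- x) y = - cinner x y"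
  using cinner_add_left[of x "- x" y] by (simp add: eq_neg_iff_add_eq_0 add.commute)

lemma cinner_minus_right: "cinner x (- y) = - cinner x y"
  using cinner_add_right[of x y "- y"] by (simp add: eq_neg_iff_add_eq_0 add.commute)

lemma cinner_diff_left: "cinner (x - y) z = cinner x z - cinner y z"
  using cinner_add_left[of x "- y" z] by (simp add: cinner_minus_left)

lemma cinner_diff_right: "cinner x (y - z) = cinner x y - cinner x z"
  using cinner_add_right[of x y "- z"] by (simp add: cinner_minus_right)

lemma cinner_sum_left: "cinner (\<Sum>i\<in>I. f i) y = (\<Sum>i\<in>I. cinner (f i) y)"
  by (induction I rule: infinite_finite_induct) (auto simp: cinner_add_left)

lemma cinner_sum_right: "cinner x (\<Sum>i\<in>I. f i) = (\<Sum>i\<in>I. cinner x (f i))"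
  by (induction I rule: infinite_finite_induct) (auto simp: cinner_add_right)

lemmas cinner_simps =
  cinner_add_left cinner_add_right cinner_diff_left cinner_diff_right
  cinner_scaleC_left cinner_scaleC_right cinner_sum_left cinner_sum_right

lemma cinner_self: "cinner x x = complex_of_real ((norm x)\<^sup>2)"
proof (rule complex_eqI)
  show "Re (cinner x x) = Re (complex_of_real ((norm x)\<^sup>2))"
    by (simp add: inner_eq_Re_cinner[symmetric] power2_norm_eq_inner)
  have "cnj (cinner x x) = cinner x x" using cinner_commute[of x x] by simp
  then show "Im (cinner x x) = Im (complex_of_real ((norm x)\<^sup>2))"
    by (metis Im_complex_of_real Reals_cnj_iff complex_is_Real_iff)
qed

lemma cinner_self_eq_0 [simp]: "cinner x x = 0 \<longleftrightarrow> x = 0"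
  by (simp add: cinner_self)

lemma cinner_eq_0_commute: "cinner x y = 0 \<longleftrightarrow> cinner y x = 0"
  by (metis cinner_commute complex_cnj_zero_iff)

lemma cinner_eq_inner: "cinner x y = Complex (inner x y) (inner x (\<i> *\<^sub>C y))"
  by (rule complex_eqI) (simp_all add: inner_eq_Re_cinner cinner_scaleC_right)

lemma norm_scaleC: "norm (a *\<^sub>C x) = norm a * norm x"
proof -
  have "complex_of_real ((norm (a *\<^sub>C x))\<^sup>2) = (a * cnj a) * cinner x x"
    by (simp only: cinner_self[symmetric] cinner_scaleC_left cinner_scaleC_right ac_simps)
  also have "\<dots> = complex_of_real ((norm a * norm x)\<^sup>2)"
    by (simp only: complex_norm_square[symmetric] cinner_self of_real_mult[symmetric]
        power_mult_distrib)
  finally show ?thesis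
    by (simp only: of_real_eq_iff) (simp add: power2_eq_iff_nonneg)
qed

lemma continuous_on_cinner_left: "continuous_on A (\<lambda>x. cinner x y)"
  unfolding cinner_eq_inner Complex_eq by (intro continuous_intros)

lemma cinner_eq_0_closure:
  assumes "x \<in> closure X" "\<And>x. x \<in> X \<Longrightarrow> cinner x y = 0"
  shows "cinner x y = 0"
proof -
  have "closed {x. cinner x y = 0}"
    using continuous_on_cinner_left by (intro closed_Collect_eq) auto
  then have "closure X \<subseteq> {x. cinner x y = 0}"
    by (intro closure_minimal) (use assms(2) in auto)
  then show ?thesis using assms(1) by auto
qed

lemma cinner_eq_0_cspan:
  assumes "x \<in> cspan X" "\<And>x. x \<in> X \<Longrightarrow> cinner x y = 0"
  shows "cinner x y = 0"
  using assms(1)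
  by (induction rule: complex_vector.span_induct_alt) (auto simp: cinner_simps assms(2))

lemma continuous_on_scaleC_right: "continuous_on A (\<lambda>x. a *\<^sub>C x)"
proof -
  have "dist (a *\<^sub>C x) (a *\<^sub>C y) \<le> norm a * dist x y" for x y
    by (simp add: dist_norm complex_vector.scale_right_diff_distrib[symmetric] norm_scaleC)
  then show ?thesis
    by (intro lipschitz_on_continuous_on[of "norm a"] lipschitz_onI) auto
qed

lemma csubspace_closure:
  assumes "csubspace X" shows "csubspace (closure X)"
proof (rule complex_vector.subspaceI)
  show "0 \<in> closure X"
    using complex_vector.subspace_0[OF assms] closure_subset by auto
next
  fix x y assume "x \<in> closure X" "y \<in> closure X"
  then obtain f g where "\<And>n. f n \<in> X" "f \<longlonglongrightarrow> x" "\<And>n. g n \<in> X" "g \<longlonglongrightarrow> y"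
    unfolding closure_sequential by metis
  then have "\<And>n. f n + g n \<in> X" "(\<lambda>n. f n + g n) \<longlonglongrightarrow> x + y"
    using complex_vector.subspace_add[OF assms] by (auto intro: tendsto_add)
  then show "x + y \<in> closure X"
    unfolding closure_sequential by (intro exI[of _ "\<lambda>n. f n + g n"]) blast
next
  fix c x assume "x \<in> closure X"
  have "(\<lambda>x. c *\<^sub>C x) ` closure X \<subseteq> closure X"
    by (rule image_closure_subset[OF continuous_on_scaleC_right])
      (use complex_vector.subspace_scale[OF assms] closure_subset in auto)
  then show "c *\<^sub>C x \<in> closure X" using \<open>x \<in> closure X\<close> by auto
qed

text \<open>
  A minimizing sequence for the distance to \<open>K\<close> is Cauchy by the parallelogram law, and the
  error of its limit is orthogonal to \<open>K\<close> because the distance cannot be decreased further.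
\<close>

lemma projection_exists:
  fixes K :: "'a::chilbert_space set"
  assumes "closed_csubspace K"
  shows "\<exists>k\<in>K. \<forall>y\<in>K. cinner (x - k) y = 0"
proof -
  have sub: "csubspace K" and "closed K" using assms by (auto simp: closed_csubspace_def)
  have "K \<noteq> {}" using complex_vector.subspace_0[OF sub] by auto
  define d where "d = infdist x K"
  have d_le: "d \<le> norm (x - y)" if "y \<in> K" for y
    using infdist_le[OF that, of x] by (simp add: d_def dist_norm)
  have d_nonneg: "0 \<le> d" by (simp add: d_def infdist_nonneg)
  have "\<exists>y\<in>K. (norm (x - y))\<^sup>2 < d\<^sup>2 + 1 / real (Suc n)" for n
  proof -
    have "d < sqrt (d\<^sup>2 + 1 / real (Suc n))"
      by (rule real_less_rsqrt) simp
    then have "(INF y\<in>K. dist x y) < sqrt (d\<^sup>2 + 1 / real (Suc n))"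
      using \<open>K \<noteq> {}\<close> by (simp add: d_def infdist_def)
    then obtain y where "y \<in> K" "dist x y < sqrt (d\<^sup>2 + 1 / real (Suc n))"
      using cINF_less_iff[of K "dist x"] \<open>K \<noteq> {}\<close> by (auto intro: bdd_belowI2[where m = 0])
    then have "(dist x y)\<^sup>2 < (sqrt (d\<^sup>2 + 1 / real (Suc n)))\<^sup>2"
      by (intro power_strict_mono) auto
    then show ?thesis using \<open>y \<in> K\<close> by (auto simp: dist_norm add_nonneg_nonneg)
  qed
  then obtain f where f: "\<And>n. f n \<in> K" "\<And>n. (norm (x - f n))\<^sup>2 < d\<^sup>2 + 1 / real (Suc n)"
    by metis
  have half: "(1/2) *\<^sub>R (a + b) \<in> K" if "a \<in> K" "b \<in> K" for a b
    using that sub unfolding scaleR_eq_scaleC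
    by (intro complex_vector.subspace_scale complex_vector.subspace_add)
  have close: "(norm (f m - f n))\<^sup>2 \<le> 4 / real (Suc N)" if "N \<le> m" "N \<le> n" for m n N
  proof -
    have "d\<^sup>2 \<le> (norm (x - (1/2) *\<^sub>R (f m + f n)))\<^sup>2"
      using d_le[OF half[OF f(1) f(1)]] d_nonneg by (intro power_mono) auto
    moreover have "(norm (f m - f n))\<^sup>2 = 2 * (norm (x - f m))\<^sup>2 + 2 * (norm (x - f n))\<^sup>2
        - 4 * (norm (x - (1/2) *\<^sub>R (f m + f n)))\<^sup>2"
      unfolding power2_norm_eq_inner
      by (simp add: inner_diff_left inner_diff_right inner_add_left inner_add_right inner_commute
          algebra_simps)
    moreover have "1 / real (Suc m) \<le> 1 / real (Suc N)" "1 / real (Suc n) \<le> 1 / real (Suc N)"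
      using that by (auto intro!: divide_left_mono)
    ultimately have "(norm (f m - f n))\<^sup>2 \<le> 4 * (1 / real (Suc N))"
      using f(2)[of m] f(2)[of n] by linarith
    then show ?thesis by simp
  qed
  have "Cauchy f"
  proof (rule CauchyI)
    fix e :: real assume "0 < e"
    obtain N where N: "4 / e\<^sup>2 < real N" using reals_Archimedean2 by blast
    have "norm (f m - f n) < e" if "N \<le> m" "N \<le> n" for m n
    proof -
      have "4 < e\<^sup>2 * real (Suc N)"
        using N \<open>0 < e\<close> by (simp add: field_simps) (smt (verit) zero_less_power)
      then have "4 / real (Suc N) < e\<^sup>2" by (simp add: divide_less_eq)
      then have "(norm (f m - f n))\<^sup>2 < e\<^sup>2" using close[OF that] by linarith
      then show ?thesis using \<open>0 < e\<close> by (meson less_eq_real_def power_less_imp_less_base)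
    qed
    then show "\<exists>M. \<forall>m\<ge>M. \<forall>n\<ge>M. norm (f m - f n) < e" by blast
  qed
  then obtain k where k: "f \<longlonglongrightarrow> k" using Cauchy_convergent convergent_def by blast
  have "k \<in> K" using closed_sequentially[OF \<open>closed K\<close>] f(1) k by auto
  have "(norm (x - k))\<^sup>2 \<le> d\<^sup>2"
  proof (rule LIMSEQ_le)
    show "(\<lambda>n. (norm (x - f n))\<^sup>2) \<longlonglongrightarrow> (norm (x - k))\<^sup>2" by (intro tendsto_intros k)
    have "(\<lambda>n. 1 / real (Suc n)) \<longlonglongrightarrow> 0" by (rule LIMSEQ_Suc, rule lim_1_over_n)
    then show "(\<lambda>n. d\<^sup>2 + 1 / real (Suc n)) \<longlonglongrightarrow> d\<^sup>2"
      using tendsto_add[OF tendsto_const, of _ 0 sequentially "d\<^sup>2"] by simp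
    show "\<exists>N. \<forall>n\<ge>N. (norm (x - f n))\<^sup>2 \<le> d\<^sup>2 + 1 / real (Suc n)" using f(2) less_imp_le by blast
  qed
  then have min: "(norm (x - k))\<^sup>2 \<le> (norm (x - k - y))\<^sup>2" if "y \<in> K" for y
    using power_mono[OF d_le[OF complex_vector.subspace_add[OF sub \<open>k \<in> K\<close> that]] d_nonneg, of 2]
    unfolding diff_diff_add by (rule order_trans)
  have "cinner (x - k) y = 0" if "y \<in> K" for y
  proof (cases "y = 0")
    case False
    define c where "c = cinner (x - k) y / cinner y y"
    have ny: "cinner y y \<noteq> 0" using False by simp
    have cy: "c *\<^sub>C y \<in> K" using that sub by (rule complex_vector.subspace_scale[rotated])
    have "cinner (x - k - c *\<^sub>C y) y = 0"
      using ny by (simp add: cinner_diff_left cinner_scaleC_left c_def)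
    then have orth: "cinner (x - k - c *\<^sub>C y) (c *\<^sub>C y) = 0" by (simp add: cinner_scaleC_right)
    have "cinner (x - k) (x - k) =
        cinner ((x - k - c *\<^sub>C y) + c *\<^sub>C y) ((x - k - c *\<^sub>C y) + c *\<^sub>C y)" by simp
    also have "\<dots> = cinner (x - k - c *\<^sub>C y) (x - k - c *\<^sub>C y) + cinner (c *\<^sub>C y) (c *\<^sub>C y)"
      unfolding cinner_add_left cinner_add_right
      using orth cinner_eq_0_commute[of "x - k - c *\<^sub>C y" "c *\<^sub>C y"] by simp
    finally have "(norm (x - k))\<^sup>2 = (norm (x - k - c *\<^sub>C y))\<^sup>2 + (norm (c *\<^sub>C y))\<^sup>2"
      unfolding cinner_self by (metis of_real_add of_real_eq_iff)
    then have "norm (c *\<^sub>C y) = 0" using min[OF cy] by simp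
    then have "c = 0" using False by (simp add: norm_scaleC)
    then show ?thesis using ny by (simp add: c_def)
  qed simp
  then show ?thesis using \<open>k \<in> K\<close> by blast
qed

definition proj :: "'a::chilbert_space set \<Rightarrow> 'a \<Rightarrow> 'a" where
  "proj K x = (SOME k. k \<in> K \<and> (\<forall>y\<in>K. cinner (x - k) y = 0))"

lemma
  assumes "closed_csubspace K"
  shows proj_in [simp]: "proj K x \<in> K"
    and proj_orthogonal: "\<And>y. y \<in> K \<Longrightarrow> cinner (x - proj K x) y = 0"
proof -
  have "\<exists>k. k \<in> K \<and> (\<forall>y\<in>K. cinner (x - k) y = 0)" using projection_exists[OF assms] by auto
  from someI_ex[OF this] show "proj K x \<in> K" "\<And>y. y \<in> K \<Longrightarrow> cinner (x - proj K x) y = 0"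
    by (auto simp: proj_def)
qed

lemma proj_eqI:
  assumes K: "closed_csubspace K" and "k \<in> K" "\<And>y. y \<in> K \<Longrightarrow> cinner (x - k) y = 0"
  shows "proj K x = k"
proof -
  have sub: "csubspace K" using K by (simp add: closed_csubspace_def)
  have diff: "proj K x - k \<in> K"
    using complex_vector.subspace_diff[OF sub proj_in[OF K] \<open>k \<in> K\<close>] .
  have "cinner (x - k - (x - proj K x)) (proj K x - k) = 0"
    using assms(3)[OF diff] proj_orthogonal[OF K diff, of x]
    by (simp only: cinner_diff_left[of "x - k"]) simp
  then show ?thesis by simp
qed

lemma clinear_proj: assumes K: "closed_csubspace K" shows "clinear (proj K)"
proof (rule clinearI)
  have sub: "csubspace K" using K by (simp add: closed_csubspace_def)
  show "proj K (x + y) = proj K x + proj K y" for x y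
    by (rule proj_eqI[OF K complex_vector.subspace_add[OF sub proj_in[OF K] proj_in[OF K]]])
      (use proj_orthogonal[OF K, of _ x] proj_orthogonal[OF K, of _ y] in
        \<open>simp add: cinner_add_left cinner_diff_left\<close>)
  show "proj K (c *\<^sub>C x) = c *\<^sub>C proj K x" for c x
    by (rule proj_eqI[OF K complex_vector.subspace_scale[OF sub proj_in[OF K]]])
      (use proj_orthogonal[OF K, of _ x] in
        \<open>auto simp: cinner_scaleC_left cinner_diff_left\<close>)
qed

lemma proj_id: assumes "closed_csubspace K" "x \<in> K" shows "proj K x = x"
  using assms by (intro proj_eqI) auto

lemma cinner_proj:
  assumes "closed_csubspace K" "y \<in> K" shows "cinner (proj K x) y = cinner x y"
  using proj_orthogonal[OF assms, of x] by (simp add: cinner_diff_left)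

text \<open>
  A finite-dimensional extension of a closed subspace is closed: one further vector may be taken
  orthogonal to \<open>K\<close>, and then the coefficient in its direction is a continuous functional.
\<close>

lemma closed_csubspace_insert:
  assumes K: "closed_csubspace K"
  shows "closed_csubspace (cspan (insert x K))"
proof -
  have sub: "csubspace K" and "closed K" using K by (auto simp: closed_csubspace_def)
  define u where "u = x - proj K x"
  have uK: "cinner u y = 0" if "y \<in> K" for y unfolding u_def by (rule proj_orthogonal[OF K that])
  have mem: "z \<in> cspan (insert x K) \<longleftrightarrow> (\<exists>c. z - c *\<^sub>C u \<in> K)" for z
  proof -
    have "z - c *\<^sub>C u \<in> K \<longleftrightarrow> z - c *\<^sub>C x \<in> K" for c
    proof -
      have "z - c *\<^sub>C u = (z - c *\<^sub>C x) + c *\<^sub>C proj K x"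
        by (simp add: u_def complex_vector.scale_right_diff_distrib)
      moreover have "c *\<^sub>C proj K x \<in> K"
        by (rule complex_vector.subspace_scale[OF sub proj_in[OF K]])
      ultimately show ?thesis
        by (metis add_diff_cancel_right' complex_vector.subspace_add complex_vector.subspace_diff sub)
    qed
    moreover have "cspan K = K" using sub by (simp add: complex_vector.span_eq_iff)
    ultimately show ?thesis by (simp only: complex_vector.span_breakdown_eq)
  qed
  have "closed (cspan (insert x K))"
  proof (cases "u = 0")
    case True
    then have "cspan (insert x K) = K" using mem by auto
    then show ?thesis using \<open>closed K\<close> by simp
  next
    case False
    then have nu: "cinner u u \<noteq> 0" by simp
    define c where "c z = cinner z u / cinner u u" for z
    have "z \<in> cspan (insert x K) \<longleftrightarrow> z - c z *\<^sub>C u \<in> K" for z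
    proof
      assume "z \<in> cspan (insert x K)"
      then obtain b where b: "z - b *\<^sub>C u \<in> K" using mem by auto
      have "cinner (z - b *\<^sub>C u) u = 0" using uK[OF b] cinner_eq_0_commute by blast
      then have "c z = b" using nu by (simp add: c_def cinner_diff_left cinner_scaleC_left)
      then show "z - c z *\<^sub>C u \<in> K" using b by simp
    qed (use mem in auto)
    then have eq: "cspan (insert x K) = (\<lambda>z. z - c z *\<^sub>C u) -` K" by auto
    have "dist (a *\<^sub>C u) (b *\<^sub>C u) \<le> norm u * dist a b" for a b
      by (simp add: dist_norm complex_vector.scale_left_diff_distrib[symmetric] norm_scaleC
          mult.commute)
    then have "continuous_on UNIV (\<lambda>a. a *\<^sub>C u)"
      by (rule lipschitz_on_continuous_on[OF lipschitz_onI[of _ _ "norm u"]]) (rule norm_ge_zero)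
    then have "continuous_on UNIV (\<lambda>z. c z *\<^sub>C u)"
      by (rule continuous_on_compose2)
        (auto simp: c_def False intro!: continuous_intros continuous_on_cinner_left)
    then have "continuous_on UNIV (\<lambda>z. z - c z *\<^sub>C u)" by (intro continuous_intros)
    then show ?thesis unfolding eq using \<open>closed K\<close> by (intro closed_vimage) auto
  qed
  then show ?thesis by (simp add: closed_csubspace_def)
qed

lemma closed_csubspace_Un_finite:
  assumes "closed_csubspace K" "finite F"
  shows "closed_csubspace (cspan (K \<union> F))"
  using assms(2)
proof (induction F rule: finite_induct)
  case empty
  have "cspan K = K" using assms(1) by (simp add: closed_csubspace_def)
  then show ?case using assms(1) by (simp only: Un_empty_right)
next
  case (insert x F)
  have "cspan (insert x (cspan (K \<union> F))) = cspan (insert x (K \<union> F))"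
    by (simp add: complex_vector.span_insert complex_vector.span_span)
  then show ?case using closed_csubspace_insert[OF insert.IH, of x] by simp
qed

lemma closed_csubspace_cspan_finite:
  assumes "finite F" shows "closed_csubspace (cspan F)"
proof -
  have "closed_csubspace {0}" by (simp add: closed_csubspace_def)
  from closed_csubspace_Un_finite[OF this assms] show ?thesis by simp
qed

text \<open>
  The projection onto the span of \<open>F\<close> cannot be injective on a span of larger dimension, and its
  kernel is the orthogonal complement of \<open>F\<close>.
\<close>

lemma nonzero_orthogonal_to_few:
  assumes "cindependent B" "finite F" "card F < card B"
  shows "\<exists>y\<in>cspan B. y \<noteq> 0 \<and> (\<forall>x\<in>F. cinner x y = 0)"
proof -
  note K = closed_csubspace_cspan_finite[OF \<open>finite F\<close>]
  have "\<not> inj_on (proj (cspan F)) (cspan B)"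
  proof
    assume inj: "inj_on (proj (cspan F)) (cspan B)"
    have "cindependent (proj (cspan F) ` B)"
      by (rule complex_vector_pair.linear_independent_injective_image[OF clinear_proj[OF K] assms(1) inj])
    moreover have "proj (cspan F) ` B \<subseteq> cspan F" using proj_in[OF K] by auto
    ultimately have "card (proj (cspan F) ` B) \<le> card F"
      using complex_vector.independent_span_bound[OF \<open>finite F\<close>] by blast
    moreover have "card (proj (cspan F) ` B) = card B"
      by (rule card_image, rule inj_on_subset[OF inj complex_vector.span_superset])
    ultimately show False using assms(3) by simp
  qed
  then obtain y where y: "y \<in> cspan B" "y \<noteq> 0" "proj (cspan F) y = 0"
    using complex_vector_pair.linear_inj_on_iff_eq_0[OF clinear_proj[OF K] complex_vector.subspace_span]
    by blast
  have "cinner x y = 0" if "x \<in> F" for x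
    using cinner_proj[OF K complex_vector.span_base[OF that], of y] y(3) cinner_eq_0_commute by auto
  then show ?thesis using y by auto
qed

text \<open>
  By induction on \<open>B\<close>: the value at a new vector \<open>x\<close> is corrected by a multiple of the component
  of \<open>x\<close> orthogonal to the earlier vectors, which leaves their values unchanged.
\<close>

lemma interpolating_vector:
  assumes "finite B" "cindependent B"
  shows "\<exists>f\<in>cspan B. \<forall>b\<in>B. cinner f b = c b"
  using assms
proof (induction B rule: finite_induct)
  case empty
  then show ?case by auto
next
  case (insert x B)
  note K = closed_csubspace_cspan_finite[OF \<open>finite B\<close>]
  have ind: "cindependent B" "x \<notin> cspan B"
    using insert.prems insert.hyps complex_vector.independent_insert[of x B] by (auto split: if_splits)
  obtain f where f: "f \<in> cspan B" "\<And>b. b \<in> B \<Longrightarrow> cinner f b = c b" using insert.IH ind by auto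
  define u where "u = x - proj (cspan B) x"
  have uB: "cinner u y = 0" if "y \<in> cspan B" for y
    unfolding u_def by (rule proj_orthogonal[OF K that])
  have "u \<noteq> 0" using ind(2) proj_in[OF K, of x] by (auto simp: u_def)
  have "cinner u x = cinner u u"
    using uB[OF proj_in[OF K, of x]] cinner_diff_right[of u x "proj (cspan B) x"]
    by (simp flip: u_def)
  then have ux: "cinner u x \<noteq> 0" using \<open>u \<noteq> 0\<close> by simp
  have "u \<in> cspan (insert x B)"
    unfolding u_def
    using subsetD[OF complex_vector.span_mono[OF subset_insertI[of B x]] proj_in[OF K, of x]]
      complex_vector.span_base[of x "insert x B"]
    by (intro complex_vector.span_diff) auto
  moreover have "f \<in> cspan (insert x B)"
    using f(1) complex_vector.span_mono[of B "insert x B"] by auto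
  moreover define g where "g = f + ((c x - cinner f x) / cinner u x) *\<^sub>C u"
  ultimately have "g \<in> cspan (insert x B)"
    by (simp add: complex_vector.span_add complex_vector.span_scale)
  moreover have "cinner g b = c b" if "b \<in> insert x B" for b
    using that ux f(2) uB[OF complex_vector.span_base]
    by (auto simp: g_def cinner_add_left cinner_scaleC_left)
  ultimately show ?case by blast
qed

section \<open>Square free polynomials have simple roots over almost every point\<close>

text \<open>
  Some prime factor has positive degree because degrees add up in the prime factorization.
\<close>

lemma prime_factor_of_positive_degree:
  fixes h :: poly2
  assumes "h \<noteq> 0" "0 < degree h"
  shows "\<exists>g. prime_elem g \<and> g dvd h \<and> 0 < degree g"
proof (rule ccontr)
  assume none: "\<not> ?thesis"
  obtain A where A: "\<And>x. x \<in># A \<Longrightarrow> prime_elem x" "normalize (prod_mset A) = normalize h"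
    using prime_factorization_exists[OF \<open>h \<noteq> 0\<close>] by blast
  have "degree x = 0" if "x \<in># A" for x
  proof -
    have "x dvd prod_mset A" using that by (rule dvd_prod_mset)
    then have "x dvd h" using A(2) by (metis dvd_normalize_iff)
    then show ?thesis using none A(1)[OF that] by auto
  qed
  then have "degree (prod_mset A) = 0"
  proof (induction A)
    case (add x A)
    then show ?case using degree_mult_le[of x "prod_mset A"] by simp
  qed simp
  moreover have "h dvd prod_mset A" using A(2) by (metis dvd_normalize_iff dvd_refl)
  moreover have "prod_mset A \<noteq> 0" using A(2) \<open>h \<noteq> 0\<close> by (metis normalize_eq_0_iff)
  ultimately show False using \<open>0 < degree h\<close> dvd_imp_degree_le[of h "prod_mset A"] by simp
qed

text \<open>
  Pseudo-division replaces Bezout's identity over the field of fractions: an element of least degree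
  in the ideal divides every other one up to a factor free of \<open>w\<close>.
\<close>

lemma ideal_contains_constant_or_common_factor:
  fixes f g :: poly2
  assumes "f \<noteq> 0"
  shows "(\<exists>a b r. r \<noteq> 0 \<and> a * f + b * g = [:r:]) \<or>
    (\<exists>q. prime_elem q \<and> 0 < degree q \<and> q dvd f \<and> q dvd g)"
proof -
  define I where "I = {a * f + b * g | a b. True}"
  have I_add: "x - y \<in> I" if x: "x \<in> I" and y: "y \<in> I" for x y
  proof -
    obtain a b where "x = a * f + b * g" using x by (auto simp: I_def)
    moreover obtain a' b' where "y = a' * f + b' * g" using y by (auto simp: I_def)
    ultimately have "x - y = (a - a') * f + (b - b') * g" by (simp add: algebra_simps)
    then show ?thesis by (auto simp: I_def)
  qed
  have I_mult: "c * x \<in> I" if x: "x \<in> I" for c x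
  proof -
    obtain a b where "x = a * f + b * g" using x by (auto simp: I_def)
    then have "c * x = (c * a) * f + (c * b) * g" by (simp add: algebra_simps)
    then show ?thesis by (auto simp: I_def)
  qed
  have "f = 1 * f + 0 * g" "g = 0 * f + 1 * g" by simp_all
  then have "f \<in> I" "g \<in> I" unfolding I_def by blast+
  define h where "h = arg_min degree (\<lambda>x. x \<in> I \<and> x \<noteq> 0)"
  have "\<exists>x. x \<in> I \<and> x \<noteq> 0" using \<open>f \<in> I\<close> assms by auto
  then have h: "h \<in> I" "h \<noteq> 0" and min: "\<And>x. x \<in> I \<Longrightarrow> x \<noteq> 0 \<Longrightarrow> degree h \<le> degree x"
    unfolding h_def using arg_min_natI[of "\<lambda>x. x \<in> I \<and> x \<noteq> 0" _ degree]
      arg_min_nat_le[of "\<lambda>x. x \<in> I \<and> x \<noteq> 0" _ degree] by auto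
  have div: "\<exists>c. c \<noteq> 0 \<and> h dvd smult c x" if x: "x \<in> I" for x
  proof -
    obtain a q where aq: "a \<noteq> 0" "smult a x = h * q + pseudo_mod x h"
      using pseudo_mod(1)[OF \<open>h \<noteq> 0\<close>] by blast
    have "pseudo_mod x h = [:a:] * x - q * h" using aq(2) by (simp add: algebra_simps)
    also have "\<dots> \<in> I" by (intro I_add I_mult x h)
    finally have "pseudo_mod x h = 0"
      using pseudo_mod(2)[OF \<open>h \<noteq> 0\<close>, of x] min by (meson not_le)
    then show ?thesis using aq by auto
  qed
  show ?thesis
  proof (cases "degree h = 0")
    case True
    then obtain r where "h = [:r:]" by (metis degree_eq_zeroE)
    then show ?thesis using h unfolding I_def by (intro disjI1) (auto, metis)
  next
    case False
    then obtain q where q: "prime_elem q" "q dvd h" "0 < degree q"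
      using prime_factor_of_positive_degree[OF h(2)] by auto
    have "q dvd x" if x: "x \<in> I" for x
    proof -
      obtain c where c: "c \<noteq> 0" "h dvd smult c x" using div[OF x] by auto
      then have "q dvd [:c:] * x" using q(2) by (auto intro: dvd_trans)
      then have "q dvd [:c:] \<or> q dvd x" using prime_elem_dvd_mult_iff[OF q(1)] by blast
      moreover have "\<not> q dvd [:c:]"
        using dvd_imp_degree_le[of q "[:c:]"] c(1) q(3) by auto
      ultimately show ?thesis by auto
    qed
    then show ?thesis using q \<open>f \<in> I\<close> \<open>g \<in> I\<close> by auto
  qed
qed

text \<open>
  If \<open>p = q h\<close> and \<open>q\<close> divides \<open>p'\<close>, then \<open>q\<close> divides \<open>q' h\<close>; by degree it does not divide
  \<open>q'\<close>, so it divides \<open>h\<close> and \<open>q\<^sup>2\<close> divides \<open>p\<close>.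
\<close>

lemma squarefree_coprime_pderiv:
  fixes p q :: poly2
  assumes "squarefree p" "prime_elem q" "0 < degree q" "q dvd p"
  shows "\<not> q dvd pderiv p"
proof
  assume "q dvd pderiv p"
  obtain h where h: "p = q * h" using assms(4) by (elim dvdE)
  have "q dvd q * pderiv h + h * pderiv q"
    using \<open>q dvd pderiv p\<close> by (simp add: h pderiv_mult)
  then have "q dvd h * pderiv q" using dvd_add_right_iff[of q "q * pderiv h"] by simp
  moreover have "\<not> q dvd pderiv q"
  proof
    assume *: "q dvd pderiv q"
    have "pderiv q \<noteq> 0" using assms(3) by (simp add: pderiv_eq_0_iff)
    from dvd_imp_degree_le[OF * this] show False using assms(3) by (simp add: degree_pderiv)
  qed
  ultimately have "q dvd h" using assms(2) by (simp add: prime_elem_dvd_mult_iff)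
  then have "q\<^sup>2 dvd p" by (simp add: h power2_eq_square)
  then have "q dvd 1" using assms(1) by (simp add: squarefree_def)
  then show False using assms(2) by (simp add: prime_elem_def)
qed

text \<open>
  The fibre polynomial \<open>p(z, w)\<close> in \<open>w\<close> over a fixed \<open>z\<close>.
\<close>

definition slice :: "poly2 \<Rightarrow> complex \<Rightarrow> complex poly" where
  "slice p z = map_poly (\<lambda>c. poly c z) p"

lemma coeff_slice: "coeff (slice p z) i = poly (coeff p i) z"
  by (simp add: slice_def coeff_map_poly)

lemma slice_0 [simp]: "slice 0 z = 0"
  by (simp add: slice_def)

lemma slice_pCons: "slice (pCons c p) z = pCons (poly c z) (slice p z)"
  by (rule poly_eqI) (simp add: coeff_slice coeff_pCons split: nat.split)

lemma poly_slice: "poly (slice p z) w = eval2 p z w"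
  unfolding eval2_def by (induction p) (simp_all add: slice_pCons)

lemma pderiv_slice: "pderiv (slice p z) = slice (pderiv p) z"
  by (rule poly_eqI) (simp add: coeff_slice coeff_pderiv)

lemma eval2_add: "eval2 (p + q) z w = eval2 p z w + eval2 q z w"
  and eval2_mult: "eval2 (p * q) z w = eval2 p z w * eval2 q z w"
  by (simp_all add: eval2_def)

text \<open>
  The exceptional points are the zeros of an element \<open>r(z)\<close> of the ideal generated by \<open>p\<close> and its
  derivative in \<open>w\<close>: a multiple root over \<open>z\<close> is a common zero of both, so \<open>r\<close> vanishes at
  \<open>z\<close>.
\<close>

lemma generic_slice_rsquarefree:
  assumes "squarefree p" "p \<noteq> 0"
  shows "\<exists>r. r \<noteq> 0 \<and> (\<forall>z. poly r z \<noteq> 0 \<longrightarrow> rsquarefree (slice p z))"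
proof -
  obtain a b r where r: "r \<noteq> 0" "a * p + b * pderiv p = [:r:]"
    using ideal_contains_constant_or_common_factor[OF assms(2), of "pderiv p"]
      squarefree_coprime_pderiv[OF assms(1)] by blast
  have "rsquarefree (slice p z)" if "poly r z \<noteq> 0" for z
    unfolding rsquarefree_roots pderiv_slice poly_slice
  proof (intro allI notI)
    fix w assume *: "eval2 p z w = 0 \<and> eval2 (pderiv p) z w = 0"
    have "eval2 (a * p + b * pderiv p) z w = 0"
      unfolding eval2_add eval2_mult using * by simp
    then show False using that by (simp add: r(2) eval2_def)
  qed
  then show ?thesis using r by blast
qed

lemma infinite_disc_off_roots:
  fixes r :: "complex poly"
  assumes "r \<noteq> 0"
  shows "infinite {z. norm z < 1 \<and> poly r z \<noteq> 0}"
proof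
  assume "finite {z. norm z < 1 \<and> poly r z \<noteq> 0}"
  then have "finite ({z. norm z < 1 \<and> poly r z \<noteq> 0} \<union> {z. poly r z = 0})"
    using poly_roots_finite[OF assms] by blast
  then have "finite (ball (0::complex) 1)" by (rule finite_subset[rotated]) auto
  then show False using uncountable_ball[of 1 "0::complex"] countable_finite by auto
qed

lemma inner_toral_disc:
  assumes "inner_toral p" "eval2 p z w = 0" "norm z < 1"
  shows "norm w < 1"
  using assms unfolding inner_toral_def by fastforce

text \<open>
  A factor depending on \<open>z\<close> alone would vanish on a whole line \<open>z = c\<close>, but the points of such a
  line with \<open>w = 0\<close> and \<open>w = 2\<close> lie in different parts of the admissible region.
\<close>

lemma inner_toral_factor_degree:
  assumes "inner_toral p" "q dvd p" "\<not> is_unit q" "p \<noteq> 0"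
  shows "0 < degree q"
proof (rule ccontr)
  assume "\<not> 0 < degree q"
  then obtain c where c: "q = [:c:]" by (metis degree_eq_zeroE not_gr_zero)
  have "c \<noteq> 0" using c assms(2,4) by auto
  have "degree c \<noteq> 0"
  proof
    assume "degree c = 0"
    then obtain a where "c = [:a:]" by (metis degree_eq_zeroE)
    then have "is_unit c" using \<open>c \<noteq> 0\<close> by (simp add: is_unit_pCons_iff)
    then show False using assms(3) by (simp add: c is_unit_const_poly_iff)
  qed
  then obtain z where z: "poly c z = 0"
    using fundamental_theorem_of_algebra[of c] constant_degree[of c] by auto
  have zero: "eval2 p z w = 0" for w :: complex
    using assms(2) z by (auto simp: c eval2_def elim!: dvdE)
  have "norm z < 1 \<and> norm w < 1 \<or> norm z = 1 \<and> norm w = 1 \<or> norm z > 1 \<and> norm w > 1" for w :: complex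
    using assms(1) zero[of w] unfolding inner_toral_def by (auto simp: subset_eq not_le)
  from this[of 0] this[of 2] show False by auto
qed

section \<open>Polynomials in operators\<close>

lemma clinear_funpow:
  fixes A :: "'a::chilbert_space \<Rightarrow> 'a"
  shows "clinear A \<Longrightarrow> clinear (A ^^ n)"
  by (induction n) (auto intro!: clinearI simp: clinear_simps)

definition poly_op :: "complex poly \<Rightarrow> ('a::chilbert_space \<Rightarrow> 'a) \<Rightarrow> 'a \<Rightarrow> 'a" where
  "poly_op q A x = (\<Sum>i\<le>degree q. coeff q i *\<^sub>C (A ^^ i) x)"

lemma poly_op_eq:
  assumes "degree q \<le> n" shows "poly_op q A x = (\<Sum>i\<le>n. coeff q i *\<^sub>C (A ^^ i) x)"
  unfolding poly_op_def using assms
  by (intro sum.mono_neutral_left) (auto simp: coeff_eq_0)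

lemma poly_op_0 [simp]: "poly_op 0 A x = 0"
  by (simp add: poly_op_def)

lemma poly_op_add: "poly_op (p + q) A x = poly_op p A x + poly_op q A x"
  by (simp add: poly_op_eq[of _ "max (degree p) (degree q)"] degree_add_le_max
      scaleC_add_left sum.distrib)

lemma poly_op_smult: "poly_op (smult c q) A x = c *\<^sub>C poly_op q A x"
  by (simp add: poly_op_eq[of _ "degree q"] degree_smult_le scaleC_scaleC
      complex_vector.scale_sum_right)

lemma poly_op_pCons:
  assumes "clinear A" shows "poly_op (pCons c q) A x = c *\<^sub>C x + A (poly_op q A x)"
proof -
  have "poly_op (pCons c q) A x = (\<Sum>i\<le>Suc (degree q). coeff (pCons c q) i *\<^sub>C (A ^^ i) x)"
    by (intro poly_op_eq degree_pCons_le)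
  also have "\<dots> = c *\<^sub>C x + (\<Sum>i\<le>degree q. coeff q i *\<^sub>C A ((A ^^ i) x))"
    by (subst sum.atMost_Suc_shift) simp
  also have "(\<Sum>i\<le>degree q. coeff q i *\<^sub>C A ((A ^^ i) x)) = A (poly_op q A x)"
    by (simp add: poly_op_def clinear_simps[OF assms])
  finally show ?thesis .
qed

lemma poly_op_linear_factor:
  assumes "clinear A"
  shows "poly_op ([:- r, 1:] * q) A x = A (poly_op q A x) - r *\<^sub>C poly_op q A x"
proof -
  have "[:- r, 1:] * q = smult (- r) q + pCons 0 q" by simp
  then show ?thesis
    by (simp only: poly_op_add poly_op_smult poly_op_pCons[OF assms]) simp
qed

lemma poly_op_mult:
  assumes "clinear A" shows "poly_op (p * q) A x = poly_op p A (poly_op q A x)"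
  by (induction p) (simp_all add: poly_op_add poly_op_smult poly_op_pCons assms)

lemma clinear_poly_op:
  fixes A :: "'a::chilbert_space \<Rightarrow> 'a"
  assumes "clinear A" shows "clinear (poly_op q A)"
proof (rule clinearI)
  note lin = clinear_simps[OF clinear_funpow[OF assms]]
  show "poly_op q A (x + y) = poly_op q A x + poly_op q A y" for x y
    by (simp add: poly_op_def lin complex_vector.scale_right_distrib sum.distrib)
  show "poly_op q A (c *\<^sub>C x) = c *\<^sub>C poly_op q A x" for c x
    by (simp add: poly_op_def lin complex_vector.scale_sum_right scaleC_scaleC mult.commute)
qed

definition shift_prod :: "('a::chilbert_space \<Rightarrow> 'a) \<Rightarrow> complex list \<Rightarrow> 'a \<Rightarrow> 'a" where
  "shift_prod A rs = foldr (\<lambda>r f x. A (f x) - r *\<^sub>C f x) rs (\<lambda>x. x)"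

lemma shift_prod_Nil [simp]: "shift_prod A [] x = x"
  and shift_prod_Cons: "shift_prod A (r # rs) x = A (shift_prod A rs x) - r *\<^sub>C shift_prod A rs x"
  by (simp_all add: shift_prod_def)

lemma poly_op_prod_list:
  assumes "clinear A"
  shows "poly_op (\<Prod>r\<leftarrow>rs. [:- r, 1:]) A x = shift_prod A rs x"
proof (induction rs)
  case Nil
  show ?case by (simp add: poly_op_def scaleC_one)
next
  case (Cons r rs)
  show ?case
    by (simp only: list.map prod_list.Cons poly_op_linear_factor[OF assms] Cons.IH shift_prod_Cons)
qed

lemma clinear_shift_prod: "clinear A \<Longrightarrow> clinear (shift_prod A rs)"
proof (induction rs)
  case Nil
  then show ?case by (auto intro: clinearI)
next
  case (Cons r rs)
  note lin = clinear_simps[OF Cons.prems] clinear_simps[OF Cons.IH[OF Cons.prems]]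
  show ?case
    by (rule clinearI)
      (simp_all add: shift_prod_Cons lin complex_vector.scale_right_distrib scaleC_scaleC
        complex_vector.scale_right_diff_distrib mult.commute)
qed

lemma shift_prod_in:
  assumes "csubspace V" "\<And>x. x \<in> V \<Longrightarrow> A x \<in> V" "x \<in> V"
  shows "shift_prod A rs x \<in> V"
  by (induction rs)
    (auto simp: shift_prod_Cons assms complex_vector.subspace_diff complex_vector.subspace_scale)

text \<open>
  The commutation hypothesis is relative to an invariant subspace \<open>V\<close>, because operators on \<open>H\<close>
  are known to commute on \<open>H\<close> only.
\<close>

lemma shift_prod_commute:
  assumes "csubspace V" "\<And>x. x \<in> V \<Longrightarrow> A x \<in> V" "clinear B" "\<And>x. x \<in> V \<Longrightarrow> A (B x) = B (A x)"
    and "x \<in> V"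
  shows "shift_prod A rs (B x) = B (shift_prod A rs x)"
  by (induction rs)
    (simp_all add: shift_prod_Cons assms(4) shift_prod_in[OF assms(1,2,5)] clinear_simps[OF assms(3)])

lemma shift_prod_Cons':
  assumes "clinear A"
  shows "shift_prod A (r # rs) x = shift_prod A rs (A x - r *\<^sub>C x)"
proof -
  have "shift_prod A rs (A x - r *\<^sub>C x) = shift_prod A rs (A x) - r *\<^sub>C shift_prod A rs x"
    by (simp add: clinear_simps[OF clinear_shift_prod[OF assms]])
  also have "shift_prod A rs (A x) = A (shift_prod A rs x)"
    by (rule shift_prod_commute[of UNIV]) (auto simp: assms)
  finally show ?thesis by (simp add: shift_prod_Cons)
qed

lemma shift_prod_eigenvector:
  assumes "clinear A" "A y = c *\<^sub>C y"
  shows "shift_prod A rs y = (\<Prod>r\<leftarrow>rs. c - r) *\<^sub>C y"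
  by (induction rs)
    (simp_all add: shift_prod_Cons clinear_simps[OF assms(1)] assms(2) scaleC_one scaleC_scaleC
      complex_vector.scale_left_diff_distrib[symmetric] left_diff_distrib mult.commute)

lemma complex_poly_split:
  fixes q :: "complex poly"
  assumes "q \<noteq> 0"
  shows "\<exists>rs. q = smult (lead_coeff q) (\<Prod>r\<leftarrow>rs. [:- r, 1:])"
proof -
  obtain A where A: "q = smult (lead_coeff q) (\<Prod>x\<in>#A. [:- x, 1:])"
    using complex_poly_decompose_multiset[of q] by metis
  obtain rs where "A = mset rs" using ex_mset by metis
  then have "(\<Prod>x\<in>#A. [:- x, 1:]) = (\<Prod>r\<leftarrow>rs. [:- r, 1:])"
    by (metis mset_map prod_mset_prod_list)
  then show ?thesis using A by metis
qed

lemma complex_poly_split_rsquarefree: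
  fixes q :: "complex poly"
  assumes "rsquarefree q"
  shows "\<exists>rs. distinct rs \<and> set rs = {w. poly q w = 0} \<and>
    q = smult (lead_coeff q) (\<Prod>r\<leftarrow>rs. [:- r, 1:])"
proof -
  have "finite {w. poly q w = 0}" using assms by (intro poly_roots_finite) (auto simp: rsquarefree_def)
  then obtain rs where rs: "distinct rs" "set rs = {w. poly q w = 0}"
    using finite_distinct_list by blast
  have "(\<Prod>r\<leftarrow>rs. [:- r, 1:]) = (\<Prod>z\<in>set rs. [:- z, 1:])"
    using rs(1) by (simp add: prod.distinct_set_conv_list)
  then show ?thesis using complex_poly_decompose_rsquarefree[OF assms] rs by auto
qed

text \<open>
  Diagonalizability from a polynomial with simple roots: dividing the product of the remaining factors
  by its nonzero value at the root \<open>r\<close> gives the projection of \<open>y\<close> to the eigenspace of \<open>r\<close>, and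
  the difference is annihilated by the remaining factors.
\<close>

lemma shift_prod_eigenspaces:
  fixes A :: "'a::chilbert_space \<Rightarrow> 'a"
  assumes "clinear A" "csubspace V" "\<And>x. x \<in> V \<Longrightarrow> A x \<in> V" "distinct rs"
    and "y \<in> V" "shift_prod A rs y = 0"
  shows "y \<in> cspan (\<Union>r\<in>set rs. {x \<in> V. A x = r *\<^sub>C x})"
  using assms(4-6)
proof (induction rs arbitrary: y)
  case Nil
  then show ?case by (simp add: complex_vector.span_zero)
next
  case (Cons r rs)
  define U where "U = (\<Union>r\<in>set (r # rs). {x \<in> V. A x = r *\<^sub>C x})"
  define z where "z = shift_prod A rs y"
  define c where "c = (\<Prod>t\<leftarrow>rs. r - t)"
  have "c \<noteq> 0" using Cons.prems(1) by (auto simp: c_def prod_list_zero_iff)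
  have z: "z \<in> V" "A z = r *\<^sub>C z"
    using Cons.prems(3) shift_prod_in[OF assms(2,3) Cons.prems(2)]
    by (auto simp: z_def shift_prod_Cons)
  have "shift_prod A rs z = c *\<^sub>C z"
    unfolding c_def by (rule shift_prod_eigenvector[OF assms(1) z(2)])
  then have "shift_prod A rs (y - inverse c *\<^sub>C z) = 0"
    using \<open>c \<noteq> 0\<close>
    by (simp add: clinear_simps[OF clinear_shift_prod[OF assms(1)]] scaleC_scaleC scaleC_one
        flip: z_def)
  moreover have "y - inverse c *\<^sub>C z \<in> V"
    using Cons.prems(2) z(1) assms(2)
    by (simp add: complex_vector.subspace_diff complex_vector.subspace_scale)
  ultimately have "y - inverse c *\<^sub>C z \<in> cspan (\<Union>r\<in>set rs. {x \<in> V. A x = r *\<^sub>C x})"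
    using Cons.IH Cons.prems(1) by simp
  also have "\<dots> \<subseteq> cspan U" by (rule complex_vector.span_mono) (auto simp: U_def)
  finally have "y - inverse c *\<^sub>C z \<in> cspan U" .
  moreover have "inverse c *\<^sub>C z \<in> cspan U"
    using z by (intro complex_vector.span_scale complex_vector.span_base) (auto simp: U_def)
  ultimately have "y - inverse c *\<^sub>C z + inverse c *\<^sub>C z \<in> cspan U" by (rule complex_vector.span_add)
  then show ?case by (simp add: U_def)
qed

lemma cindependent_Un:
  assumes "cindependent B" "cindependent C" "cspan B \<inter> cspan C \<subseteq> {0}" "finite B"
  shows "cindependent (B \<union> C)"
  using assms(4,1,3)
proof (induction B rule: finite_induct)
  case empty
  then show ?case using assms(2) by simp
next
  case (insert x B)
  have x: "cindependent B" "x \<notin> cspan B"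
    using insert.prems(1) insert.hyps complex_vector.independent_insert[of x B]
    by (auto split: if_splits)
  have mono: "cspan B \<subseteq> cspan (insert x B)" by (rule complex_vector.span_mono) auto
  then have "cspan B \<inter> cspan C \<subseteq> {0}" using insert.prems(2) by (meson Int_mono order_refl order_trans)
  then have IH: "cindependent (B \<union> C)" by (rule insert.IH[OF x(1)])
  have "x \<notin> cspan (B \<union> C)"
  proof
    assume "x \<in> cspan (B \<union> C)"
    then obtain u v where uv: "x = u + v" "u \<in> cspan B" "v \<in> cspan C"
      unfolding complex_vector.span_Un by blast
    have "v = x - u" using uv(1) by simp
    also have "\<dots> \<in> cspan (insert x B)"
      by (rule complex_vector.span_diff[OF complex_vector.span_base[OF insertI1] subsetD[OF mono uv(2)]])
    finally have "v \<in> {0}" using uv(3) insert.prems(2) by (meson IntI subsetD)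
    then show False using uv x(2) by simp
  qed
  then have "cindependent (insert x (B \<union> C))" using IH by (rule complex_vector.independent_insertI)
  then show ?case unfolding Un_insert_left .
qed

text \<open>
  The product of the factors \<open>A - r\<close> over the earlier eigenvalues annihilates the earlier
  eigenspaces, while it acts on the eigenspace of a new eigenvalue as a nonzero scalar.
\<close>

lemma cindependent_eigenvectors:
  fixes A :: "'a::chilbert_space \<Rightarrow> 'a"
  assumes "clinear A" "finite R"
    and "\<And>r. r \<in> R \<Longrightarrow> finite (B r) \<and> cindependent (B r) \<and> (\<forall>b\<in>B r. A b = r *\<^sub>C b)"
  shows "cindependent (\<Union>r\<in>R. B r)"
  using assms(2,3)
proof (induction R rule: finite_induct)
  case empty
  show ?case by (simp add: complex_vector.independent_empty)
next
  case (insert t R)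
  obtain rs where rs: "set rs = R" using finite_list[OF insert.hyps(1)] by auto
  have "cspan (B t) \<inter> cspan (\<Union>r\<in>R. B r) \<subseteq> {0}"
  proof
    fix y assume y: "y \<in> cspan (B t) \<inter> cspan (\<Union>r\<in>R. B r)"
    have "csubspace {x. A x = t *\<^sub>C x}"
      by (auto intro!: complex_vector.subspaceI
          simp: clinear_simps[OF assms(1)] complex_vector.scale_right_distrib scaleC_scaleC mult.commute)
    then have "cspan (B t) \<subseteq> {x. A x = t *\<^sub>C x}"
      by (rule complex_vector.span_minimal[rotated]) (use insert.prems in auto)
    then have "A y = t *\<^sub>C y" using y by auto
    then have 1: "shift_prod A rs y = (\<Prod>r\<leftarrow>rs. t - r) *\<^sub>C y"
      by (rule shift_prod_eigenvector[OF assms(1)])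
    have "shift_prod A rs b = 0" if "b \<in> (\<Union>r\<in>R. B r)" for b
    proof -
      obtain r where r: "r \<in> R" "b \<in> B r" using \<open>b \<in> (\<Union>r\<in>R. B r)\<close> by auto
      then have "A b = r *\<^sub>C b" using insert.prems by auto
      then have "shift_prod A rs b = (\<Prod>r'\<leftarrow>rs. r - r') *\<^sub>C b"
        by (rule shift_prod_eigenvector[OF assms(1)])
      moreover have "(\<Prod>r'\<leftarrow>rs. r - r') = 0" using r(1) rs by (auto simp: prod_list_zero_iff)
      ultimately show ?thesis by simp
    qed
    then have "shift_prod A rs y = 0"
      using y complex_vector_pair.linear_eq_0_on_span[OF clinear_shift_prod[OF assms(1)]] by blast
    moreover have "(\<Prod>r\<leftarrow>rs. t - r) \<noteq> 0" using insert.hyps(2) rs by (auto simp: prod_list_zero_iff)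
    ultimately show "y \<in> {0}" using 1 by simp
  qed
  then have "cindependent (B t \<union> (\<Union>r\<in>R. B r))"
    using insert by (intro cindependent_Un) auto
  then show ?case by simp
qed

lemma nontrivial_relation:
  fixes v :: "nat \<Rightarrow> 'a::chilbert_space"
  assumes "finite F" "\<And>i. v i \<in> cspan F"
  shows "\<exists>c. (\<exists>i\<le>card F. c i \<noteq> 0) \<and> (\<Sum>i\<le>card F. c i *\<^sub>C v i) = 0"
proof (cases "inj_on v {..card F}")
  case False
  then obtain i j where ij: "i \<le> card F" "j \<le> card F" "i \<noteq> j" "v i = v j"
    by (auto simp: inj_on_def)
  define c :: "nat \<Rightarrow> complex" where "c k = (if k = i then 1 else if k = j then - 1 else 0)" for k
  have "(\<Sum>k\<le>card F. c k *\<^sub>C v k) = (\<Sum>k\<in>{i, j}. c k *\<^sub>C v k)"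
    using ij by (intro sum.mono_neutral_right) (auto simp: c_def)
  also have "\<dots> = 0" using ij by (simp add: c_def)
  finally show ?thesis using ij by (intro exI[of _ c]) (auto simp: c_def)
next
  case True
  have "complex_vector.dependent (v ` {..card F})"
  proof (rule ccontr)
    assume "\<not> ?thesis"
    then have "card (v ` {..card F}) \<le> card F"
      using complex_vector.independent_span_bound[OF assms(1)] assms(2) by blast
    then show False using card_image[OF True] by simp
  qed
  then obtain u where u: "\<exists>x\<in>v ` {..card F}. u x \<noteq> 0" "(\<Sum>x\<in>v ` {..card F}. u x *\<^sub>C x) = 0"
    using complex_vector.dependent_finite[of "v ` {..card F}"] by auto
  then have "(\<Sum>i\<le>card F. u (v i) *\<^sub>C v i) = 0" by (simp add: sum.reindex[OF True])
  then show ?thesis using u(1) by (intro exI[of _ "u \<circ> v"]) auto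
qed

text \<open>
  The orbit of a single vector is linearly dependent, which gives a polynomial annihilating this
  vector; the product of these polynomials over a basis annihilates \<open>G\<close>.
\<close>

lemma annihilating_polynomial:
  fixes A :: "'a::chilbert_space \<Rightarrow> 'a"
  assumes "clinear A" "csubspace G" "\<And>x. x \<in> G \<Longrightarrow> A x \<in> G" "finite_dim G"
  shows "\<exists>q. q \<noteq> 0 \<and> (\<forall>y\<in>G. poly_op q A y = 0)"
proof -
  obtain F where F: "finite F" "G \<subseteq> cspan F" using assms(4) by (auto simp: finite_dim_def)
  obtain B where B: "B \<subseteq> G" "cindependent B" "G \<subseteq> cspan B"
    by (rule complex_vector.basis_exists)
  have "finite B" using complex_vector.independent_span_bound[OF F(1) B(2)] B(1) F(2) by blast
  have one: "\<exists>q. q \<noteq> 0 \<and> poly_op q A y = 0" if "y \<in> G" for y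
  proof -
    have "(A ^^ i) y \<in> G" for i by (induction i) (auto simp: that assms(3))
    then have "(A ^^ i) y \<in> cspan F" for i using F(2) by blast
    then obtain c where c: "\<exists>i\<le>card F. c i \<noteq> 0" "(\<Sum>i\<le>card F. c i *\<^sub>C (A ^^ i) y) = 0"
      using nontrivial_relation[OF F(1), of "\<lambda>i. (A ^^ i) y"] by blast
    define q where "q = (\<Sum>i\<le>card F. monom (c i) i)"
    have coeff: "coeff q i = (if i \<le> card F then c i else 0)" for i
      by (simp add: q_def coeff_sum)
    have "q \<noteq> 0" using c(1) coeff by (metis coeff_0)
    moreover have "degree q \<le> card F" by (rule degree_le) (simp add: coeff)
    then have "poly_op q A y = 0" using c(2) by (simp add: poly_op_eq[of q "card F"] coeff)
    ultimately show ?thesis by blast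
  qed
  have all: "\<exists>q. q \<noteq> 0 \<and> (\<forall>y\<in>C. poly_op q A y = 0)" if "finite C" "C \<subseteq> G" for C
    using that
  proof (induction C rule: finite_induct)
    case empty
    show ?case by (intro exI[of _ 1]) auto
  next
    case (insert y C)
    then obtain q r where qr: "q \<noteq> 0" "\<And>y. y \<in> C \<Longrightarrow> poly_op q A y = 0" "r \<noteq> 0" "poly_op r A y = 0"
      using one[of y] by auto
    have zero: "poly_op p A 0 = 0" for p
      by (simp add: poly_op_def clinear_simps[OF clinear_funpow[OF assms(1)]])
    have "poly_op (r * q) A x = 0" if "x \<in> C" for x
      by (simp only: poly_op_mult[OF assms(1)] qr(2)[OF that] zero)
    moreover have "poly_op (r * q) A y = 0"
      by (simp only: mult.commute[of r] poly_op_mult[OF assms(1)] qr(4) zero)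
    ultimately show ?case using qr(1,3) by (intro exI[of _ "r * q"]) auto
  qed
  obtain q where q: "q \<noteq> 0" "\<forall>y\<in>B. poly_op q A y = 0"
    using all[OF \<open>finite B\<close> B(1)] by (elim exE conjE)
  have "poly_op q A y = 0" if "y \<in> G" for y
    by (rule complex_vector_pair.linear_eq_0_on_span[OF clinear_poly_op[OF assms(1)], of B])
      (use q(2) B(3) that in auto)
  then show ?thesis using q(1) by (intro exI[of _ q]) simp
qed

section \<open>The submodule generated by finitely many vectors\<close>

lemma op_eval_eq:
  assumes "degree q \<le> n"
  shows "op_eval q S T x = (\<Sum>i\<le>n. poly_op (coeff q i) S ((T ^^ i) x))"
proof -
  have "op_eval q S T x = (\<Sum>i\<le>degree q. poly_op (coeff q i) S ((T ^^ i) x))"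
    by (simp add: op_eval_def poly_op_def)
  also have "\<dots> = (\<Sum>i\<le>n. poly_op (coeff q i) S ((T ^^ i) x))"
    using assms by (intro sum.mono_neutral_left) (auto simp: coeff_eq_0)
  finally show ?thesis .
qed

lemma op_eval_add: "op_eval (p + q) S T x = op_eval p S T x + op_eval q S T x"
  by (simp add: op_eval_eq[of _ "max (degree p) (degree q)"] degree_add_le_max poly_op_add
      sum.distrib)

lemma op_eval_smult: "op_eval (smult [:c:] q) S T x = c *\<^sub>C op_eval q S T x"
  by (simp add: op_eval_eq[of _ "degree q"] degree_smult_le poly_op_smult
      complex_vector.scale_sum_right)

lemma poly_op_monom: "poly_op (monom 1 j) A x = (A ^^ j) x"
proof -
  have "poly_op (monom 1 j) A x = (\<Sum>i\<le>j. if i = j then (A ^^ j) x else 0)"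
    unfolding poly_op_eq[OF degree_monom_le] by (intro sum.cong) (auto simp: scaleC_one)
  then show ?thesis by simp
qed

lemma op_eval_monom: "op_eval (monom (monom 1 j) i) S T x = (S ^^ j) ((T ^^ i) x)"
proof -
  have "op_eval (monom (monom 1 j) i) S T x = (\<Sum>l\<le>i. if l = i then (S ^^ j) ((T ^^ i) x) else 0)"
    unfolding op_eval_eq[OF degree_monom_le] by (intro sum.cong) (auto simp: poly_op_monom)
  then show ?thesis by simp
qed

lemma op_eval_0 [simp]: "op_eval 0 S T x = 0"
  by (simp add: op_eval_def)

definition monomials ::
    "('a::chilbert_space \<Rightarrow> 'a) \<Rightarrow> ('a \<Rightarrow> 'a) \<Rightarrow> 'a set \<Rightarrow> 'a set" where
  "monomials S T X = {(S ^^ j) ((T ^^ i) x) | i j x. x \<in> X}"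

lemma monomialsI: "x \<in> X \<Longrightarrow> (S ^^ j) ((T ^^ i) x) \<in> monomials S T X"
  unfolding monomials_def by blast

text \<open>
  Only the span of the monomials matters for cyclicity; in this form invariance under \<open>S\<close> and
  \<open>T\<close> is inherited from the generators.
\<close>

lemma poly_combs_eq: "poly_combs S T k f = cspan (monomials S T (f ` {1..k}))"
proof (rule equalityI)
  show "poly_combs S T k f \<subseteq> cspan (monomials S T (f ` {1..k}))"
  proof
    fix z assume "z \<in> poly_combs S T k f"
    then obtain q where z: "z = (\<Sum>j=1..k. op_eval (q j) S T (f j))" by (auto simp: poly_combs_def)
    show "z \<in> cspan (monomials S T (f ` {1..k}))"
      unfolding z op_eval_def
      by (intro complex_vector.span_sum complex_vector.span_scale complex_vector.span_base
        monomialsI imageI)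
  qed
  have "csubspace (poly_combs S T k f)"
  proof (rule complex_vector.subspaceI)
    show "0 \<in> poly_combs S T k f"
      unfolding poly_combs_def by (intro image_eqI[of _ _ "\<lambda>_. 0"]) auto
    show "x + y \<in> poly_combs S T k f" if "x \<in> poly_combs S T k f" "y \<in> poly_combs S T k f" for x y
    proof -
      from that obtain q r where "x = (\<Sum>j=1..k. op_eval (q j) S T (f j))"
        "y = (\<Sum>j=1..k. op_eval (r j) S T (f j))" by (auto simp: poly_combs_def)
      then have "x + y = (\<Sum>j=1..k. op_eval (q j + r j) S T (f j))"
        by (simp add: op_eval_add sum.distrib)
      then show ?thesis
        unfolding poly_combs_def by (intro image_eqI[of _ _ "\<lambda>j. q j + r j"]) auto
    qed
    show "c *\<^sub>C x \<in> poly_combs S T k f" if "x \<in> poly_combs S T k f" for c x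
    proof -
      from that obtain q where "x = (\<Sum>j=1..k. op_eval (q j) S T (f j))"
        by (auto simp: poly_combs_def)
      then have "c *\<^sub>C x = (\<Sum>j=1..k. op_eval (smult [:c:] (q j)) S T (f j))"
        by (simp only: op_eval_smult complex_vector.scale_sum_right)
      then show ?thesis
        unfolding poly_combs_def by (intro image_eqI[of _ _ "\<lambda>j. smult [:c:] (q j)"]) auto
    qed
  qed
  moreover have "monomials S T (f ` {1..k}) \<subseteq> poly_combs S T k f"
  proof
    fix z assume "z \<in> monomials S T (f ` {1..k})"
    then obtain i j l where z: "l \<in> {1..k}" "z = (S ^^ j) ((T ^^ i) (f l))"
      by (auto simp: monomials_def)
    define q where "q = (\<lambda>n. if n = l then monom (monom (1::complex) j) i else 0)"
    have "(\<Sum>n=1..k. op_eval (q n) S T (f n)) = (\<Sum>n\<in>{l}. op_eval (q n) S T (f n))"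
      using z(1) by (intro sum.mono_neutral_right) (auto simp: q_def)
    then have "z = (\<Sum>n=1..k. op_eval (q n) S T (f n))"
      by (simp add: z(2) q_def op_eval_monom)
    then show "z \<in> poly_combs S T k f" unfolding poly_combs_def by blast
  qed
  ultimately show "cspan (monomials S T (f ` {1..k})) \<subseteq> poly_combs S T k f"
    by (intro complex_vector.span_minimal)
qed

section \<open>Isometries and their adjoints\<close>

lemma closed_csubspace_isometric_image:
  assumes K: "closed_csubspace K" and U: "clinear_on K U" "\<And>x. x \<in> K \<Longrightarrow> norm (U x) = norm x"
  shows "closed_csubspace (U ` K)"
proof -
  have sub: "csubspace K" and "closed K" using K by (auto simp: closed_csubspace_def)
  have add: "U (x + y) = U x + U y" and scale: "U (c *\<^sub>C x) = c *\<^sub>C U x" if "x \<in> K" "y \<in> K" for c x y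
    using U(1) that by (auto simp: clinear_on_def)
  have diff: "U (x - y) = U x - U y" if "x \<in> K" "y \<in> K" for x y
    using add[of "x - y" y] that complex_vector.subspace_diff[OF sub] by auto
  have "csubspace (U ` K)"
  proof (rule complex_vector.subspaceI)
    have "U 0 = 0" using scale[of 0 0 0] complex_vector.subspace_0[OF sub] by simp
    then show "0 \<in> U ` K" using complex_vector.subspace_0[OF sub] by (intro image_eqI[of _ _ 0]) auto
    show "u + v \<in> U ` K" if uv: "u \<in> U ` K" "v \<in> U ` K" for u v
    proof -
      obtain x y where "x \<in> K" "y \<in> K" "u = U x" "v = U y" using uv by blast
      then show ?thesis using complex_vector.subspace_add[OF sub] by (intro image_eqI[of _ _ "x + y"]) (simp_all add: add)
    qed
    show "c *\<^sub>C u \<in> U ` K" if u: "u \<in> U ` K" for c u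
    proof -
      obtain x where "x \<in> K" "u = U x" using u by blast
      then show ?thesis using complex_vector.subspace_scale[OF sub] by (intro image_eqI[of _ _ "c *\<^sub>C x"]) (simp_all add: scale)
    qed
  qed
  moreover have "closed (U ` K)"
  proof (rule closed_sequential_limits[THEN iffD2], intro allI impI)
    fix f y assume f: "(\<forall>n. f n \<in> U ` K) \<and> f \<longlonglongrightarrow> y"
    then have lim: "f \<longlonglongrightarrow> y" by blast
    define g where "g n = (SOME x. x \<in> K \<and> f n = U x)" for n
    have "g n \<in> K \<and> f n = U (g n)" for n
      unfolding g_def by (rule someI_ex) (use f in blast)
    then have g: "\<And>n. g n \<in> K" "\<And>n. f n = U (g n)" by blast+
    have "Cauchy g"
    proof (rule CauchyI)
      fix e :: real assume "0 < e"
      then obtain M where "\<forall>m\<ge>M. \<forall>n\<ge>M. norm (f m - f n) < e"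
        using LIMSEQ_imp_Cauchy[OF lim] CauchyD by blast
      moreover have "norm (f m - f n) = norm (g m - g n)" for m n
        using g diff[of "g m" "g n"] U(2)[of "g m - g n"] complex_vector.subspace_diff[OF sub] by simp
      ultimately show "\<exists>M. \<forall>m\<ge>M. \<forall>n\<ge>M. norm (g m - g n) < e" by auto
    qed
    then obtain x where x: "g \<longlonglongrightarrow> x" using Cauchy_convergent convergent_def by blast
    then have "x \<in> K" using closed_sequentially[OF \<open>closed K\<close>] g(1) by auto
    have "norm (f n - U x) = norm (g n - x)" for n
      using g \<open>x \<in> K\<close> diff[of "g n" x] U(2)[of "g n - x"] complex_vector.subspace_diff[OF sub] by simp
    then have "f \<longlonglongrightarrow> U x" using x by (simp add: LIMSEQ_iff)
    then show "y \<in> U ` K" using lim \<open>x \<in> K\<close> LIMSEQ_unique by blast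
  qed
  ultimately show ?thesis by (simp add: closed_csubspace_def)
qed

locale isometry =
  fixes H :: "'a::chilbert_space set" and S :: "'a \<Rightarrow> 'a"
  assumes closed_H: "closed_csubspace H" and lin: "clinear S"
    and S_in: "\<And>x. x \<in> H \<Longrightarrow> S x \<in> H" and norm_S: "\<And>x. x \<in> H \<Longrightarrow> norm (S x) = norm x"
begin

abbreviation adj :: "'a \<Rightarrow> 'a" where "adj \<equiv> adjoint_on H S"

lemma sub_H: "csubspace H"
  using closed_H by (simp add: closed_csubspace_def)

lemmas H_simps [simp] = complex_vector.subspace_0[OF sub_H] complex_vector.subspace_add[OF sub_H]
  complex_vector.subspace_diff[OF sub_H] complex_vector.subspace_scale[OF sub_H] S_in

lemmas S_simps = clinear_simps[OF lin]

lemma cinner_S: assumes "x \<in> H" "y \<in> H" shows "cinner (S x) (S y) = cinner x y"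
proof -
  have "inner (S u) (S v) = inner u v" if "u \<in> H" "v \<in> H" for u v
    using that norm_S[of "u + v"] norm_S[of u] norm_S[of v] by (simp add: dot_norm S_simps)
  from this[OF assms] this[OF assms(1), of "\<i> *\<^sub>C y"] show ?thesis
    using assms by (simp add: cinner_eq_inner S_simps)
qed

text \<open>
  As the range of an isometry is closed, the adjoint at \<open>y\<close> is the preimage of the projection of
  \<open>y\<close> to the range.
\<close>

lemma adj_ex: "\<exists>z. z \<in> H \<and> (\<forall>x\<in>H. cinner (S x) y = cinner x z)"
proof -
  have SH: "closed_csubspace (S ` H)"
    by (rule closed_csubspace_isometric_image[OF closed_H])
      (auto simp: clinear_on_def S_simps norm_S)
  have "proj (S ` H) y \<in> S ` H" by (rule proj_in[OF SH])
  then obtain z where z: "z \<in> H" "proj (S ` H) y = S z" by blast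
  have "cinner (S x) y = cinner x z" if "x \<in> H" for x
  proof -
    have "cinner y (S x) = cinner (S z) (S x)"
      using cinner_proj[OF SH, of "S x" y] that z by simp
    then show ?thesis using cinner_S[OF that z(1)] by (metis cinner_commute)
  qed
  then show ?thesis using z by blast
qed

lemma adj_eqI:
  assumes "z \<in> H" "\<And>x. x \<in> H \<Longrightarrow> cinner (S x) y = cinner x z"
  shows "adj y = z"
  unfolding adjoint_on_def
proof (rule the_equality)
  fix z' assume z': "z' \<in> H \<and> (\<forall>x\<in>H. cinner (S x) y = cinner x z')"
  then have "cinner (z' - z) (z' - z) = 0" using assms by (simp add: cinner_diff_right)
  then show "z' = z" by simp
qed (use assms in auto)

lemma
  shows adj_in [simp]: "adj y \<in> H"
    and cinner_adj: "x \<in> H \<Longrightarrow> cinner (S x) y = cinner x (adj y)"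
proof -
  obtain z where "z \<in> H" "\<And>x. x \<in> H \<Longrightarrow> cinner (S x) y = cinner x z" using adj_ex by blast
  then show "adj y \<in> H" "x \<in> H \<Longrightarrow> cinner (S x) y = cinner x (adj y)" using adj_eqI by auto
qed

lemma cinner_adj': "x \<in> H \<Longrightarrow> cinner (adj y) x = cinner y (S x)"
  by (metis cinner_adj cinner_commute)

lemma clinear_adj: "clinear adj"
  by (intro clinearI adj_eqI)
    (auto simp: cinner_add_right cinner_scaleC_right cinner_adj)

lemmas adj_simps = clinear_simps[OF clinear_adj]

lemma adj_S [simp]: "x \<in> H \<Longrightarrow> adj (S x) = x"
  by (rule adj_eqI) (auto simp: cinner_S)

lemma funpow_in [simp]: "x \<in> H \<Longrightarrow> (S ^^ k) x \<in> H"
  by (induction k) auto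

lemma adj_funpow_in [simp]: "x \<in> H \<Longrightarrow> (adj ^^ k) x \<in> H"
  by (induction k) auto

lemma cinner_adj_funpow:
  assumes "x \<in> H" shows "cinner ((S ^^ k) x) y = cinner x ((adj ^^ k) y)"
proof (induction k arbitrary: y)
  case (Suc k)
  have "cinner ((S ^^ Suc k) x) y = cinner ((S ^^ k) x) (adj y)"
    using assms by (simp add: cinner_adj)
  then show ?case by (simp add: Suc funpow_swap1)
qed simp

lemma adj_funpow_S:
  assumes "x \<in> H" shows "(adj ^^ k) ((S ^^ k) x) = x"
proof (induction k)
  case (Suc k)
  have "(adj ^^ Suc k) ((S ^^ Suc k) x) = (adj ^^ k) (adj (S ((S ^^ k) x)))"
    by (simp add: funpow_swap1)
  then show ?case using assms Suc by simp
qed simp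

lemma ker_adjoint_shift:
  "ker_adjoint H (\<lambda>x. S x - l *\<^sub>C x) = {y \<in> H. adj y = cnj l *\<^sub>C y}"
proof -
  have "adjoint_on H (\<lambda>x. S x - l *\<^sub>C x) y = adj y - cnj l *\<^sub>C y" if "y \<in> H" for y
    unfolding adjoint_on_def[of H "\<lambda>x. S x - l *\<^sub>C x"]
  proof (rule the_equality)
    show "adj y - cnj l *\<^sub>C y \<in> H \<and>
      (\<forall>x\<in>H. cinner (S x - l *\<^sub>C x) y = cinner x (adj y - cnj l *\<^sub>C y))"
      using that by (simp add: cinner_diff_left cinner_diff_right cinner_scaleC_left
          cinner_scaleC_right cinner_adj)
    fix z assume z: "z \<in> H \<and> (\<forall>x\<in>H. cinner (S x - l *\<^sub>C x) y = cinner x z)"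
    define d where "d = z - (adj y - cnj l *\<^sub>C y)"
    have "d \<in> H" using z that by (simp add: d_def)
    have "cinner x d = 0" if "x \<in> H" for x
    proof -
      have "cinner (S x - l *\<^sub>C x) y = cinner x z" using z that by blast
      then show ?thesis
        using that by (simp add: d_def cinner_diff_left cinner_diff_right cinner_scaleC_left
            cinner_scaleC_right cinner_adj)
    qed
    then have "cinner d d = 0" using \<open>d \<in> H\<close> by blast
    then show "z = adj y - cnj l *\<^sub>C y" by (simp add: d_def)
  qed
  then show ?thesis by (auto simp: ker_adjoint_def)
qed

lemma ker_adjoint_eq: "ker_adjoint H S = {y \<in> H. adj y = 0}"
  by (simp add: ker_adjoint_def)

text \<open>
  The eigenspaces of the adjoint. The eigenvalue \<open>r = cnj l\<close> belongs to the point \<open>l\<close>: the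
  space is the orthogonal complement of the range of \<open>S - l\<close>.
\<close>

definition eigenspace :: "complex \<Rightarrow> 'a set" where
  "eigenspace r = {y \<in> H. adj y = r *\<^sub>C y}"

lemma csubspace_eigenspace: "csubspace (eigenspace r)"
  by (rule complex_vector.subspaceI)
    (auto simp: eigenspace_def adj_simps complex_vector.scale_right_distrib scaleC_scaleC mult.commute)

lemma cinner_eigenspace:
  "y \<in> eigenspace r \<Longrightarrow> x \<in> H \<Longrightarrow> cinner (S x) y = cnj r * cinner x y"
  by (simp add: eigenspace_def cinner_adj cinner_scaleC_right)

lemma cinner_funpow_eigenspace:
  "y \<in> eigenspace r \<Longrightarrow> x \<in> H \<Longrightarrow> cinner ((S ^^ k) x) y = cnj r ^ k * cinner x y"
  by (induction k) (auto simp: cinner_eigenspace mult.assoc)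

lemma shift_injective:
  assumes "norm l < 1" "x \<in> H" "S x = l *\<^sub>C x" shows "x = 0"
proof (rule ccontr)
  assume "x \<noteq> 0"
  have "norm x = norm l * norm x" using norm_S[OF assms(2)] assms(3) by (simp add: norm_scaleC)
  then show False using \<open>x \<noteq> 0\<close> assms(1) by simp
qed

text \<open>
  \<open>x = y + c S x\<close> is a fixed point equation for a contraction.
\<close>

lemma resolvent:
  assumes "norm c < 1" "y \<in> H"
  shows "\<exists>!x. x \<in> H \<and> x - c *\<^sub>C S x = y"
proof -
  have "\<exists>!x. x \<in> H \<and> y + c *\<^sub>C S x = x"
  proof (rule Banach_fix[where c = "norm c"])
    show "complete H" using closed_H by (simp add: closed_csubspace_def complete_eq_closed)
    show "dist (y + c *\<^sub>C S x) (y + c *\<^sub>C S x') \<le> norm c * dist x x'" if "x \<in> H" "x' \<in> H" for x x'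
    proof -
      have "norm (S x - S x') = norm (x - x')"
        using that norm_S[of "x - x'"] by (simp add: S_simps)
      then show ?thesis
        by (simp add: dist_norm complex_vector.scale_right_diff_distrib[symmetric] norm_scaleC)
    qed
    show "H \<noteq> {}" using H_simps(1) by blast
  qed (use assms in auto)
  moreover have "y + c *\<^sub>C S x = x \<longleftrightarrow> x - c *\<^sub>C S x = y" for x
    by (auto simp: algebra_simps)
  ultimately show ?thesis by simp
qed

text \<open>
  \<open>1 - r S\<close> identifies the eigenspace of the adjoint for any \<open>r\<close> in the disc with the one for
  \<open>0\<close>; in the function model this is division by the Szego kernel.
\<close>

lemma eigenspace_to_kernel:
  "y \<in> eigenspace r \<Longrightarrow> y - r *\<^sub>C S y \<in> eigenspace 0"
  by (simp add: eigenspace_def adj_simps)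

lemma kernel_to_eigenspace:
  assumes "norm r < 1" "e \<in> eigenspace 0"
  shows "\<exists>y\<in>eigenspace r. y - r *\<^sub>C S y = e"
proof -
  obtain y where y: "y \<in> H" "y - r *\<^sub>C S y = e"
    using resolvent[OF assms(1), of e] assms(2) by (auto simp: eigenspace_def)
  have "adj (y - r *\<^sub>C S y) = 0" using assms(2) y(2) by (simp add: eigenspace_def)
  then have "adj y = r *\<^sub>C y" using y(1) by (simp add: adj_simps)
  then show ?thesis using y by (auto simp: eigenspace_def)
qed

lemma clinear_resolvent: "clinear (\<lambda>x. x - c *\<^sub>C S x)"
  by (rule clinearI)
    (simp_all add: S_simps complex_vector.scale_right_distrib
      complex_vector.scale_right_diff_distrib scaleC_scaleC mult.commute)

lemma cinner_kernel_resolvent: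
  assumes "e \<in> eigenspace 0" "y \<in> H"
  shows "cinner e (y - c *\<^sub>C S y) = cinner e y"
  using cinner_adj'[OF assms(2), of e] assms(1)
  by (simp add: eigenspace_def cinner_diff_right cinner_scaleC_right)

lemma inj_on_resolvent: "norm c < 1 \<Longrightarrow> inj_on (\<lambda>x. x - c *\<^sub>C S x) H"
proof (rule inj_onI)
  fix x y assume c: "norm c < 1" and "x \<in> H" "y \<in> H" "x - c *\<^sub>C S x = y - c *\<^sub>C S y"
  then show "x = y" using resolvent[OF c, of "y - c *\<^sub>C S y"] by auto
qed

text \<open>
  In the function model these are the polynomials of degree less than \<open>k\<close> with coefficients in the
  kernel of the adjoint.
\<close>

definition kernel :: "nat \<Rightarrow> 'a set" where
  "kernel k = {y \<in> H. (adj ^^ k) y = 0}"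

lemma csubspace_kernel: "csubspace (kernel k)"
  by (rule complex_vector.subspaceI)
    (auto simp: kernel_def clinear_simps[OF clinear_funpow[OF clinear_adj]])

lemma kernel_mono: "k \<le> m \<Longrightarrow> kernel k \<subseteq> kernel m"
proof -
  assume "k \<le> m"
  then have "(adj ^^ m) y = (adj ^^ (m - k)) ((adj ^^ k) y)" for y
    by (metis comp_apply funpow_add le_add_diff_inverse2)
  then show ?thesis by (auto simp: kernel_def clinear_simps[OF clinear_funpow[OF clinear_adj]])
qed

lemma S_kernel: "x \<in> kernel k \<Longrightarrow> S x \<in> kernel (Suc k)"
  by (auto simp: kernel_def funpow_Suc_right simp del: funpow.simps(2))

text \<open>
  Split \<open>y = (y - S S\<^sup>* y) + S (S\<^sup>* y)\<close>: the constant term lies in the kernel of the adjoint,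
  and \<open>S\<^sup>* y\<close> has smaller degree.
\<close>

lemma kernel_spanned:
  assumes "finite B" "eigenspace 0 \<subseteq> cspan B"
  shows "\<exists>F. finite F \<and> card F \<le> k * card B \<and> kernel k \<subseteq> cspan F"
proof (induction k)
  case 0
  show ?case by (intro exI[of _ "{}"]) (auto simp: kernel_def)
next
  case (Suc k)
  then obtain F where F: "finite F" "card F \<le> k * card B" "kernel k \<subseteq> cspan F" by auto
  have "y \<in> cspan (B \<union> S ` F)" if "y \<in> kernel (Suc k)" for y
  proof -
    have y: "y \<in> H" "(adj ^^ k) (adj y) = 0"
      using that by (auto simp: kernel_def funpow_Suc_right simp del: funpow.simps(2))
    then have "adj y \<in> cspan F" using F(3) by (auto simp: kernel_def)
    then have "S (adj y) \<in> cspan (S ` F)" by (simp add: complex_vector_pair.linear_span_image[OF lin])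
    moreover have "y - S (adj y) \<in> cspan B"
      using y assms(2) by (auto simp: eigenspace_def adj_simps)
    ultimately have "(y - S (adj y)) + S (adj y) \<in> cspan (B \<union> S ` F)"
      using complex_vector.span_mono[of B "B \<union> S ` F"] complex_vector.span_mono[of "S ` F" "B \<union> S ` F"]
      by (intro complex_vector.span_add) auto
    then show ?thesis by simp
  qed
  moreover have "card (B \<union> S ` F) \<le> Suc k * card B"
    using card_Un_le[of B "S ` F"] card_image_le[OF F(1), of S] F(2) by simp
  ultimately show ?case using assms(1) F(1) by (intro exI[of _ "B \<union> S ` F"]) auto
qed

text \<open>
  The product of the factors \<open>1 - r S\<close>: the reversed polynomial of the product of the factors
  \<open>S - cnj r\<close>.
\<close>

definition backshift_prod :: "complex list \<Rightarrow> 'a \<Rightarrow> 'a" where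
  "backshift_prod rs = foldr (\<lambda>r f x. f x - r *\<^sub>C S (f x)) rs (\<lambda>x. x)"

lemma backshift_prod_Nil [simp]: "backshift_prod [] x = x"
  and backshift_prod_Cons:
    "backshift_prod (r # rs) x = backshift_prod rs x - r *\<^sub>C S (backshift_prod rs x)"
  by (simp_all add: backshift_prod_def)

lemma backshift_prod_in [simp]: "x \<in> H \<Longrightarrow> backshift_prod rs x \<in> H"
  by (induction rs) (auto simp: backshift_prod_Cons)

text \<open>
  Each factor \<open>1 - r S\<close> uses up one power of the adjoint, since \<open>S\<^sup>* (1 - r S) = S\<^sup>* - r\<close>.
\<close>

lemma adj_backshift_prod:
  "x \<in> H \<Longrightarrow> (adj ^^ length rs) (backshift_prod rs x) = shift_prod adj rs x"
proof (induction rs)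
  case (Cons r rs)
  define z where "z = backshift_prod rs x"
  have "z \<in> H" using Cons.prems by (simp add: z_def)
  have "(adj ^^ length (r # rs)) (backshift_prod (r # rs) x) =
      (adj ^^ length rs) (adj (z - r *\<^sub>C S z))"
    by (simp add: backshift_prod_Cons funpow_swap1 flip: z_def)
  also have "\<dots> = (adj ^^ length rs) (adj z) - r *\<^sub>C (adj ^^ length rs) z"
    using \<open>z \<in> H\<close> by (simp add: adj_simps clinear_simps[OF clinear_funpow[OF clinear_adj]])
  also have "\<dots> = shift_prod adj (r # rs) x"
    using Cons.IH[OF Cons.prems] funpow_swap1[of adj "length rs" z]
    by (simp add: shift_prod_Cons flip: z_def)
  finally show ?case .
qed simp

lemma cinner_backshift_prod:
  assumes "y \<in> eigenspace r" "x \<in> H"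
  shows "cinner (backshift_prod rs x) y = (\<Prod>t\<leftarrow>rs. 1 - t * cnj r) * cinner x y"
  by (induction rs)
    (simp_all add: backshift_prod_Cons cinner_diff_left cinner_scaleC_left assms
      cinner_eigenspace[OF assms(1)] left_diff_distrib)

end

section \<open>Pure isometries\<close>

locale pure_iso = isometry +
  assumes pure: "(\<Inter>j\<in>{1..}. (S ^^ j) ` H) = {0}"
begin

lemma pureD: "(\<And>j. x \<in> (S ^^ j) ` H) \<Longrightarrow> x = 0"
  using pure by blast

text \<open>
  Expanding the square of the norm of \<open>y - r S y\<close> shows that it is at most \<open>0\<close>. So \<open>y = r S y\<close>,
  and \<open>y\<close> lies in every \<open>S\<^sup>j H\<close>.
\<close>

lemma adj_eigenvalue:
  assumes "y \<in> H" "adj y = r *\<^sub>C y" "1 \<le> norm r"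
  shows "y = 0"
proof (rule pureD)
  have "cinner y (S y) = r * cinner y y"
    using cinner_adj'[OF assms(1), of y] assms(2) by (simp add: cinner_scaleC_left)
  moreover have "cinner (S y) y = cnj r * cinner y y"
    using cinner_adj[OF assms(1), of y] assms(2) by (simp add: cinner_scaleC_right)
  ultimately have "cinner (y - r *\<^sub>C S y) (y - r *\<^sub>C S y) = (1 - r * cnj r) * cinner y y"
    using assms(1)
    by (simp add: cinner_diff_left cinner_diff_right cinner_scaleC_left cinner_scaleC_right cinner_S
        algebra_simps)
  then have "complex_of_real ((norm (y - r *\<^sub>C S y))\<^sup>2) =
      complex_of_real ((1 - (norm r)\<^sup>2) * (norm y)\<^sup>2)"
    by (simp only: cinner_self complex_norm_square[symmetric] of_real_mult of_real_diff of_real_1)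
  then have "(norm (y - r *\<^sub>C S y))\<^sup>2 = (1 - (norm r)\<^sup>2) * (norm y)\<^sup>2" by (simp only: of_real_eq_iff)
  also have "\<dots> \<le> 0" using assms(3) by (intro mult_nonpos_nonneg) (auto simp: one_le_power)
  finally have eq: "y = r *\<^sub>C S y" by simp
  fix j show "y \<in> (S ^^ j) ` H"
  proof (induction j)
    case (Suc j)
    then obtain x where "x \<in> H" "y = (S ^^ j) x" by auto
    then have "y = (S ^^ Suc j) (r *\<^sub>C x)"
      using eq by (simp add: clinear_simps[OF clinear_funpow[OF lin]] S_simps)
    then show ?case by (rule image_eqI) (use \<open>x \<in> H\<close> in simp)
  qed (use assms(1) in auto)
qed

lemma shift_prod_adj_filter:
  assumes "y \<in> H" "shift_prod adj rs y = 0"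
  shows "shift_prod adj (filter (\<lambda>r. norm r < 1) rs) y = 0"
  using assms
proof (induction rs arbitrary: y)
  case (Cons r rs)
  define fs where "fs = filter (\<lambda>r. norm r < 1) rs"
  have "shift_prod adj fs (adj y - r *\<^sub>C y) = 0"
    unfolding fs_def using Cons.prems
    by (intro Cons.IH) (auto simp: shift_prod_Cons'[OF clinear_adj])
  then have 0: "shift_prod adj (r # fs) y = 0" by (simp add: shift_prod_Cons'[OF clinear_adj])
  show ?case
  proof (cases "norm r < 1")
    case True
    then show ?thesis using 0 by (simp add: fs_def)
  next
    case False
    have "shift_prod adj fs y = 0"
      using 0 False Cons.prems(1) shift_prod_in[OF sub_H, of adj y fs]
      by (intro adj_eigenvalue[of _ r]) (auto simp: shift_prod_Cons)
    then show ?thesis using False by (simp add: fs_def)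
  qed
qed simp

text \<open>
  Among the linear factors of an annihilating polynomial, those with root outside the open disc are
  injective by purity and can be dropped.
\<close>

lemma finite_dim_adj_invariant:
  assumes "csubspace G" "G \<subseteq> H" "\<And>y. y \<in> G \<Longrightarrow> adj y \<in> G" "finite_dim G"
  shows "\<exists>rs. (\<forall>r\<in>set rs. norm r < 1) \<and> (\<forall>y\<in>G. shift_prod adj rs y = 0)"
proof -
  obtain q where q: "q \<noteq> 0" "\<forall>y\<in>G. poly_op q adj y = 0"
    using annihilating_polynomial[OF clinear_adj assms(1,3,4)] by blast
  obtain rs where rs: "q = smult (lead_coeff q) (\<Prod>r\<leftarrow>rs. [:- r, 1:])"
    using complex_poly_split[OF q(1)] by blast
  have "shift_prod adj rs y = 0" if "y \<in> G" for y
  proof -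
    have "lead_coeff q *\<^sub>C shift_prod adj rs y = poly_op q adj y"
      by (subst (2) rs) (simp only: poly_op_smult poly_op_prod_list[OF clinear_adj])
    then show ?thesis using q that by simp
  qed
  then show ?thesis
    using shift_prod_adj_filter assms(2) by (intro exI[of _ "filter (\<lambda>r. norm r < 1) rs"]) auto
qed

text \<open>
  A vector \<open>u\<close> orthogonal to all these kernels satisfies \<open>u = S\<^sup>k (S\<^sup>*)\<^sup>k u\<close> for every
  \<open>k\<close>, because the difference lies in the \<open>k\<close>-th kernel; so \<open>u = 0\<close> by purity.
\<close>

lemma kernel_dense: "H \<subseteq> closure (\<Union>k. kernel k)"
proof
  fix x assume "x \<in> H"
  have "csubspace (\<Union>k. kernel k)"
  proof (rule complex_vector.subspaceI)
    show "x + y \<in> (\<Union>k. kernel k)" if "x \<in> (\<Union>k. kernel k)" "y \<in> (\<Union>k. kernel k)" for x y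
    proof -
      from that obtain m n where "x \<in> kernel m" "y \<in> kernel n" by auto
      then have "x \<in> kernel (max m n)" "y \<in> kernel (max m n)"
        using kernel_mono[of m "max m n"] kernel_mono[of n "max m n"] by auto
      then show ?thesis using complex_vector.subspace_add[OF csubspace_kernel] by blast
    qed
    show "0 \<in> (\<Union>k. kernel k)" using complex_vector.subspace_0[OF csubspace_kernel] by blast
    show "c *\<^sub>C x \<in> (\<Union>k. kernel k)" if "x \<in> (\<Union>k. kernel k)" for c x
      using that complex_vector.subspace_scale[OF csubspace_kernel] by blast
  qed
  then have K: "closed_csubspace (closure (\<Union>k. kernel k))"
    by (simp add: closed_csubspace_def csubspace_closure)
  have KH: "closure (\<Union>k. kernel k) \<subseteq> H"
    using closed_H by (intro closure_minimal) (auto simp: kernel_def closed_csubspace_def)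
  define u where "u = x - proj (closure (\<Union>k. kernel k)) x"
  have "u \<in> H" using \<open>x \<in> H\<close> proj_in[OF K, of x] KH by (auto simp: u_def)
  have orth: "cinner u v = 0" if "v \<in> kernel k" for v k
    unfolding u_def by (rule proj_orthogonal[OF K], rule subsetD[OF closure_subset], use that in auto)
  have "u = 0"
  proof (rule pureD)
    fix k
    define v where "v = u - (S ^^ k) ((adj ^^ k) u)"
    have "v \<in> kernel k"
      using \<open>u \<in> H\<close>
      by (simp add: kernel_def v_def clinear_simps[OF clinear_funpow[OF clinear_adj]] adj_funpow_S)
    have "cinner ((S ^^ k) ((adj ^^ k) u)) v = 0"
      using \<open>v \<in> kernel k\<close> \<open>u \<in> H\<close> by (simp add: cinner_adj_funpow kernel_def)
    then have "cinner v v = 0"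
      using orth[OF \<open>v \<in> kernel k\<close>] by (subst v_def) (simp add: cinner_diff_left)
    then show "u \<in> (S ^^ k) ` H" using \<open>u \<in> H\<close> by (auto simp: v_def)
  qed
  then show "x \<in> closure (\<Union>k. kernel k)" using proj_in[OF K, of x] by (simp add: u_def)
qed

end

section \<open>Counting dimensions along a filtration\<close>

lemma cindependent_imageD:
  assumes "clinear f" "inj_on f B" "cindependent (f ` B)"
  shows "cindependent B"
proof
  assume "complex_vector.dependent B"
  then obtain a where a: "a \<in> B" "a \<in> cspan (B - {a})"
    by (auto simp: complex_vector.dependent_def)
  have "f ` (B - {a}) = f ` B - {f a}" using assms(2) a(1) by (auto simp: inj_on_def)
  moreover have "f a \<in> cspan (f ` (B - {a}))"
    using a(2) by (simp add: complex_vector_pair.linear_span_image[OF assms(1)])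
  ultimately have "complex_vector.dependent (f ` B)"
    using a(1) by (auto simp: complex_vector.dependent_def)
  then show False using assms(3) by simp
qed

text \<open>
  If \<open>L k\<close> has dimension at most \<open>k M\<close> while \<open>N\<close> meets \<open>L (k + m)\<close> in dimension at least
  \<open>k M\<close>, then at most \<open>m M\<close> vectors of the union are independent modulo \<open>N\<close>, whatever \<open>k\<close> is.
\<close>

lemma filtration_codimension:
  fixes L :: "nat \<Rightarrow> 'a::chilbert_space set"
  assumes mono: "\<And>k m. k \<le> m \<Longrightarrow> L k \<subseteq> L m"
    and upper: "\<And>k. \<exists>F. finite F \<and> card F \<le> k * M \<and> L k \<subseteq> cspan F"
    and lower: "\<And>k. \<exists>B. B \<subseteq> N \<and> B \<subseteq> L (k + m) \<and> finite B \<and> cindependent B \<and> k * M \<le> card B"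
  shows "\<exists>F. finite F \<and> F \<subseteq> (\<Union>k. L k) \<and> (\<Union>k. L k) \<subseteq> cspan (N \<union> F)"
proof (rule ccontr)
  assume none: "\<not> ?thesis"
  have large: "\<exists>F. finite F \<and> F \<subseteq> (\<Union>k. L k) \<and> card F = r \<and>
    (\<forall>B\<subseteq>N. cindependent B \<longrightarrow> cindependent (B \<union> F) \<and> B \<inter> F = {})" for r
  proof (induction r)
    case 0
    show ?case by (intro exI[of _ "{}"]) auto
  next
    case (Suc r)
    then obtain F where F: "finite F" "F \<subseteq> (\<Union>k. L k)" "card F = r"
      "\<And>B. B \<subseteq> N \<Longrightarrow> cindependent B \<Longrightarrow> cindependent (B \<union> F) \<and> B \<inter> F = {}"
      by blast
    then have "\<not> (\<Union>k. L k) \<subseteq> cspan (N \<union> F)" using none by blast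
    then obtain x where x: "x \<in> (\<Union>k. L k)" "x \<notin> cspan (N \<union> F)" by blast
    have xNF: "x \<notin> N \<union> F" using x(2) complex_vector.span_base by blast
    have "cindependent (B \<union> insert x F) \<and> B \<inter> insert x F = {}" if B: "B \<subseteq> N" "cindependent B" for B
    proof -
      have "x \<notin> cspan (B \<union> F)"
        using x(2) complex_vector.span_mono[of "B \<union> F" "N \<union> F"] B(1) by blast
      then have "cindependent (insert x (B \<union> F))"
        using F(4)[OF B] by (intro complex_vector.independent_insertI) auto
      then show ?thesis using F(4)[OF B] xNF B(1) by auto
    qed
    moreover have "card (insert x F) = Suc r" using F(1,3) xNF by simp
    ultimately show ?case using F(1,2) x(1) by (intro exI[of _ "insert x F"]) auto
  qed
  \<comment> \<open>one vector more than the filtration leaves room for\<close>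
  obtain F where F: "finite F" "F \<subseteq> (\<Union>k. L k)" "card F = Suc (m * M)"
    "\<forall>B\<subseteq>N. cindependent B \<longrightarrow> cindependent (B \<union> F) \<and> B \<inter> F = {}"
    using large[of "Suc (m * M)"] by (elim exE conjE)
  have "\<exists>k. F \<subseteq> L k"
    using F(1,2)
  proof (induction F rule: finite_induct)
    case (insert x F)
    then obtain k l where "F \<subseteq> L k" "x \<in> L l" by auto
    then have "insert x F \<subseteq> L (max k l)" using mono[of k "max k l"] mono[of l "max k l"] by auto
    then show ?case by blast
  qed auto
  then obtain k where k: "F \<subseteq> L k" by blast
  obtain B where B: "B \<subseteq> N" "B \<subseteq> L (k + m)" "finite B" "cindependent B" "k * M \<le> card B"
    using lower by blast
  obtain C where C: "finite C" "card C \<le> (k + m) * M" "L (k + m) \<subseteq> cspan C"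
    using upper by blast
  have BF: "cindependent (B \<union> F)" "B \<inter> F = {}" using F(4) B(1,4) by blast+
  have "B \<union> F \<subseteq> cspan C" using B(2) k C(3) mono[of k "k + m"] by auto
  then have "card (B \<union> F) \<le> card C"
    using complex_vector.independent_span_bound[OF C(1) BF(1)] by blast
  moreover have "card (B \<union> F) = card B + card F"
    by (rule card_Un_disjoint[OF B(3) F(1) BF(2)])
  ultimately show False using C(2) F(3) B(5) by (simp add: add_mult_distrib)
qed

section \<open>Fibres of an isometry\<close>

context isometry
begin

lemma cinner_shift_prod:
  "x \<in> H \<Longrightarrow> y \<in> H \<Longrightarrow> cinner (shift_prod S rs x) y = cinner x (shift_prod adj (map cnj rs) y)"
proof (induction rs arbitrary: y)
  case (Cons r rs)
  define z where "z = shift_prod S rs x"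
  have z: "z \<in> H" using shift_prod_in[OF sub_H, of S] Cons.prems by (simp add: z_def)
  have "cinner (shift_prod S (r # rs) x) y = cinner z (adj y - cnj r *\<^sub>C y)"
    using z by (simp add: shift_prod_Cons cinner_diff_left cinner_diff_right cinner_scaleC_left
        cinner_scaleC_right cinner_adj flip: z_def)
  also have "\<dots> = cinner x (shift_prod adj (map cnj rs) (adj y - cnj r *\<^sub>C y))"
    unfolding z_def using Cons.prems by (intro Cons.IH) auto
  finally show ?case by (simp add: shift_prod_Cons'[OF clinear_adj])
qed simp

lemma cinner_poly_op_eigenspace:
  assumes "y \<in> eigenspace (cnj l)" "x \<in> H"
  shows "cinner (poly_op q S x) y = poly q l * cinner x y"
  by (simp add: poly_op_def cinner_sum_left cinner_scaleC_left poly_altdef sum_distrib_right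
      cinner_funpow_eigenspace[OF assms] mult.assoc)

lemma eigenspace_subset: "eigenspace r \<subseteq> H"
  by (auto simp: eigenspace_def)

lemma inj_on_resolvent_eigenspace:
  assumes "norm r < 1" "C \<subseteq> eigenspace r"
  shows "inj_on (\<lambda>x. x - r *\<^sub>C S x) (cspan C)"
proof -
  have "cspan C \<subseteq> H"
    using complex_vector.span_minimal[OF assms(2) csubspace_eigenspace] eigenspace_subset by blast
  then show ?thesis by (rule inj_on_subset[OF inj_on_resolvent[OF assms(1)]])
qed

lemma cindependent_in_kernel:
  assumes "norm r < 1" "C \<subseteq> eigenspace r" "cindependent C"
  shows "cindependent ((\<lambda>x. x - r *\<^sub>C S x) ` C)"
  by (rule complex_vector_pair.linear_independent_injective_image[OF clinear_resolvent assms(3)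
        inj_on_resolvent_eigenspace[OF assms(1,2)]])

lemma eigenspace_finite_dim:
  assumes "finite_dim (eigenspace 0)" "norm r < 1"
  shows "\<exists>C. finite C \<and> cindependent C \<and> C \<subseteq> eigenspace r \<and> eigenspace r = cspan C"
proof -
  obtain C where C: "C \<subseteq> eigenspace r" "cindependent C" "eigenspace r \<subseteq> cspan C"
    by (rule complex_vector.basis_exists)
  obtain F where F: "finite F" "eigenspace 0 \<subseteq> cspan F" using assms(1) by (auto simp: finite_dim_def)
  have "(\<lambda>x. x - r *\<^sub>C S x) ` C \<subseteq> cspan F" using C(1) F(2) eigenspace_to_kernel by blast
  then have "finite ((\<lambda>x. x - r *\<^sub>C S x) ` C)"
    using complex_vector.independent_span_bound[OF F(1) cindependent_in_kernel[OF assms(2) C(1,2)]]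
    by blast
  moreover have "inj_on (\<lambda>x. x - r *\<^sub>C S x) C"
    using inj_on_resolvent_eigenspace[OF assms(2) C(1)] complex_vector.span_superset
    by (rule inj_on_subset)
  ultimately have "finite C" by (rule finite_imageD)
  moreover have "eigenspace r = cspan C"
    using C(3) complex_vector.span_minimal[OF C(1) csubspace_eigenspace] by blast
  ultimately show ?thesis using C by blast
qed

lemma eigenspace_independent_copy:
  assumes "B \<subseteq> eigenspace 0" "cindependent B" "norm r < 1"
  shows "\<exists>C. C \<subseteq> eigenspace r \<and> cindependent C \<and> card C = card B"
proof -
  define R where "R x = x - r *\<^sub>C S x" for x
  have "B \<subseteq> R ` eigenspace r"
  proof
    fix e assume "e \<in> B"
    then obtain y where "y \<in> eigenspace r" "y - r *\<^sub>C S y = e"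
      using kernel_to_eigenspace[OF assms(3)] assms(1) by blast
    then show "e \<in> R ` eigenspace r" by (auto simp: R_def)
  qed
  then obtain C where C: "C \<subseteq> eigenspace r" "inj_on R C" "B = R ` C"
    by (meson subset_image_inj)
  have "clinear R" unfolding R_def by (rule clinear_resolvent)
  then have "cindependent C" using cindependent_imageD[OF _ C(2)] assms(2) C(3) by simp
  then show ?thesis using C card_image[OF C(2)] by auto
qed

text \<open>
  If the values of the vectors in \<open>G\<close> at \<open>l\<close> are independent, the module that they generate over
  the polynomials in \<open>S\<close> is free: evaluating a relation at \<open>l\<close> kills its constant term, and
  \<open>S - l\<close> is injective. The basis \<open>(S - l)\<^sup>j\<close> is adapted to this induction.
\<close>

lemma cindependent_shifts:
  assumes l: "norm l < 1" and E: "closed_csubspace (eigenspace (cnj l))"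
    and G: "finite G" "G \<subseteq> H" "inj_on (proj (eigenspace (cnj l))) G"
      "cindependent (proj (eigenspace (cnj l)) ` G)"
  shows "\<exists>X. finite X \<and> cindependent X \<and> card X = k * card G \<and>
    X \<subseteq> (\<Union>j<k. (\<lambda>g. shift_prod S (replicate j l) g) ` G)"
proof (induction k)
  case 0
  show ?case by (intro exI[of _ "{}"]) (auto simp: complex_vector.independent_empty)
next
  case (Suc k)
  define P where "P = proj (eigenspace (cnj l))"
  define D where "D x = S x - l *\<^sub>C x" for x
  obtain X where X: "finite X" "cindependent X" "card X = k * card G"
    "X \<subseteq> (\<Union>j<k. (\<lambda>g. shift_prod S (replicate j l) g) ` G)" using Suc by blast
  have P: "clinear P" unfolding P_def by (rule clinear_proj[OF E])
  have D: "clinear D"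
    unfolding D_def
    by (rule clinearI) (simp_all add: S_simps complex_vector.scale_right_distrib
        complex_vector.scale_right_diff_distrib scaleC_scaleC mult.commute)
  have XH: "X \<subseteq> H"
    using X(4) G(2) shift_prod_in[OF sub_H, of S] by fastforce
  have spanH: "cspan X \<subseteq> H" using complex_vector.span_minimal[OF XH sub_H] .
  have PD: "P (D x) = 0" if "x \<in> H" for x
    unfolding P_def
  proof (rule proj_eqI[OF E])
    show "0 \<in> eigenspace (cnj l)" by (rule complex_vector.subspace_0[OF csubspace_eigenspace])
    show "cinner (D x - 0) y = 0" if "y \<in> eigenspace (cnj l)" for y
      using cinner_eigenspace[OF that \<open>x \<in> H\<close>]
      by (simp add: D_def cinner_diff_left cinner_scaleC_left)
  qed
  have injD: "inj_on D (cspan X)"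
    unfolding complex_vector_pair.linear_inj_on_iff_eq_0[OF D complex_vector.subspace_span]
    using shift_injective[OF l] spanH by (auto simp: D_def)
  have indD: "cindependent (D ` X)"
    by (rule complex_vector_pair.linear_independent_injective_image[OF D X(2) injD])
  have injP: "inj_on P (cspan G)"
    by (rule complex_vector_pair.linear_inj_on_span_independent_image[OF P])
      (use G in \<open>auto simp: P_def\<close>)
  have indG: "cindependent G"
    by (rule cindependent_imageD[OF P]) (use G in \<open>auto simp: P_def\<close>)
  have "cspan (D ` X) \<inter> cspan G \<subseteq> {0}"
  proof
    fix z assume z: "z \<in> cspan (D ` X) \<inter> cspan G"
    then obtain x where "x \<in> cspan X" "z = D x"
      by (auto simp: complex_vector_pair.linear_span_image[OF D])
    then have "P z = 0" using PD spanH by auto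
    then have "z = 0"
      using injP z unfolding complex_vector_pair.linear_inj_on_iff_eq_0[OF P complex_vector.subspace_span]
      by auto
    then show "z \<in> {0}" by simp
  qed
  then have ind: "cindependent (D ` X \<union> G)" using cindependent_Un[OF indD indG] X(1) by auto
  have "D ` X \<inter> G = {}"
  proof (rule ccontr)
    assume "D ` X \<inter> G \<noteq> {}"
    then obtain z where "z \<in> D ` X" "z \<in> G" by blast
    then have "z = 0"
      using \<open>cspan (D ` X) \<inter> cspan G \<subseteq> {0}\<close> complex_vector.span_base by blast
    then show False using indG \<open>z \<in> G\<close> complex_vector.dependent_zero by blast
  qed
  then have "card (D ` X \<union> G) = card (D ` X) + card G" using X(1) G(1) by (intro card_Un_disjoint) auto
  also have "card (D ` X) = card X"
    using inj_on_subset[OF injD complex_vector.span_superset] by (rule card_image)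
  finally have card: "card (D ` X \<union> G) = Suc k * card G" using X(3) by simp
  have "D ` X \<union> G \<subseteq> (\<Union>j<Suc k. (\<lambda>g. shift_prod S (replicate j l) g) ` G)"
  proof
    fix z assume "z \<in> D ` X \<union> G"
    then consider x where "x \<in> X" "z = D x" | "z \<in> G" by blast
    then show "z \<in> (\<Union>j<Suc k. (\<lambda>g. shift_prod S (replicate j l) g) ` G)"
    proof cases
      case 1
      then obtain j g where "j < k" "g \<in> G" "x = shift_prod S (replicate j l) g" using X(4) by blast
      then have "z = shift_prod S (replicate (Suc j) l) g" using 1 by (simp add: D_def shift_prod_Cons)
      then show ?thesis using \<open>j < k\<close> \<open>g \<in> G\<close> by blast
    next
      case 2
      then have "z = shift_prod S (replicate 0 l) z" by simp
      then show ?thesis using 2 by blast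
    qed
  qed
  then show ?case using ind card X(1) G(1) by (intro exI[of _ "D ` X \<union> G"]) auto
qed

end

section \<open>Commuting isometries\<close>

locale commuting_isometries =
  S: pure_iso H S + T: isometry H T for H :: "'a::chilbert_space set" and S T +
  assumes commute: "\<And>x. x \<in> H \<Longrightarrow> S (T x) = T (S x)"
begin

lemma adj_commute: "S.adj (T.adj y) = T.adj (S.adj y)"
  by (rule S.adj_eqI) (auto simp: T.cinner_adj[symmetric] S.cinner_adj[symmetric] commute)

lemma adj_funpow_commute: "(S.adj ^^ k) (T.adj y) = T.adj ((S.adj ^^ k) y)"
  by (induction k) (auto simp: adj_commute)

text \<open>
  The conjugates make this the intersection of the kernels of \<open>(S - l)\<^sup>*\<close> and \<open>(T - m)\<^sup>*\<close>.
\<close>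

definition joint_eigenspace :: "complex \<Rightarrow> complex \<Rightarrow> 'a set" where
  "joint_eigenspace l m = S.eigenspace (cnj l) \<inter> T.eigenspace (cnj m)"

lemma csubspace_joint_eigenspace: "csubspace (joint_eigenspace l m)"
  unfolding joint_eigenspace_def
  by (rule complex_vector.subspace_inter[OF S.csubspace_eigenspace T.csubspace_eigenspace])

lemma eigenspace_T_adj: "y \<in> S.eigenspace r \<Longrightarrow> T.adj y \<in> S.eigenspace r"
  by (auto simp: S.eigenspace_def adj_commute T.adj_simps)

lemma cinner_op_eval_eigenspace:
  assumes "y \<in> S.eigenspace (cnj l)" "x \<in> H"
  shows "cinner (op_eval q S T x) y = cinner (poly_op (slice q l) T x) y"
proof -
  have deg: "degree (slice q l) \<le> degree q" by (rule degree_le) (simp add: coeff_slice coeff_eq_0)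
  show ?thesis
    by (simp add: op_eval_eq[OF order_refl] poly_op_eq[OF deg] cinner_sum_left cinner_scaleC_left
        S.cinner_poly_op_eigenspace[OF assms(1)] assms(2) coeff_slice)
qed

text \<open>
  Pairing \<open>p(S, T) x = 0\<close> with the fibre over \<open>l\<close> replaces \<open>S\<close> by \<open>l\<close>, so the adjoint of
  \<open>T\<close> on the fibre is annihilated by a polynomial with simple roots. Subspaces \<open>V\<close> of the fibre are
  needed later, to test whether the values of given vectors span it.
\<close>

lemma eigenspace_decomposition:
  assumes ann: "annihilates p H S T" and sf: "rsquarefree (slice p l)"
    and V: "csubspace V" "V \<subseteq> S.eigenspace (cnj l)" "\<And>y. y \<in> V \<Longrightarrow> T.adj y \<in> V"
  shows "V \<subseteq> cspan (\<Union>m\<in>{m. eval2 p l m = 0}. V \<inter> joint_eigenspace l m)"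
proof
  fix y assume y: "y \<in> V"
  obtain rs where rs: "distinct rs" "set rs = {m. poly (slice p l) m = 0}"
    "slice p l = smult (lead_coeff (slice p l)) (\<Prod>r\<leftarrow>rs. [:- r, 1:])"
    using complex_poly_split_rsquarefree[OF sf] by blast
  have nz: "lead_coeff (slice p l) \<noteq> 0" using sf by (simp add: rsquarefree_def)
  have VH: "V \<subseteq> H" using V(2) S.eigenspace_subset by blast
  define z where "z = shift_prod T.adj (map cnj rs) y"
  have "z \<in> H" unfolding z_def using VH y by (intro shift_prod_in[OF S.sub_H]) auto
  have "cinner (shift_prod T rs x) y = 0" if "x \<in> H" for x
  proof -
    have "0 = cinner (op_eval p S T x) y" using ann that by (simp add: annihilates_def)
    also have "\<dots> = cinner (poly_op (slice p l) T x) y"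
      using cinner_op_eval_eigenspace V(2) y that by blast
    also have "\<dots> = lead_coeff (slice p l) * cinner (shift_prod T rs x) y"
      by (subst rs(3)) (simp only: poly_op_smult poly_op_prod_list[OF T.lin] cinner_scaleC_left)
    finally show ?thesis using nz by simp
  qed
  then have "cinner z z = 0"
    using T.cinner_shift_prod[OF \<open>z \<in> H\<close>, of y rs] VH y \<open>z \<in> H\<close> by (auto simp: z_def)
  then have "shift_prod T.adj (map cnj rs) y = 0" by (simp add: z_def)
  then have "y \<in> cspan (\<Union>r\<in>set (map cnj rs). {x \<in> V. T.adj x = r *\<^sub>C x})"
    using rs(1) y by (intro shift_prod_eigenspaces[OF T.clinear_adj V(1,3)])
      (auto simp: distinct_map inj_on_def)
  also have "\<dots> \<subseteq> cspan (\<Union>m\<in>{m. eval2 p l m = 0}. V \<inter> joint_eigenspace l m)"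
    using V(2) VH rs(2)
    by (intro complex_vector.span_mono) (auto simp: joint_eigenspace_def T.eigenspace_def poly_slice)
  finally show "y \<in> cspan (\<Union>m\<in>{m. eval2 p l m = 0}. V \<inter> joint_eigenspace l m)" .
qed

end

context commuting_isometries
begin

lemma cspan_monomials_invariant:
  assumes X: "X \<subseteq> H" and x: "x \<in> cspan (monomials S T X)"
  shows "S x \<in> cspan (monomials S T X)" "T x \<in> cspan (monomials S T X)"
proof -
  have "S ` monomials S T X \<subseteq> monomials S T X"
  proof
    fix z assume "z \<in> S ` monomials S T X"
    then obtain i j x where "x \<in> X" "z = (S ^^ Suc j) ((T ^^ i) x)" by (auto simp: monomials_def)
    then show "z \<in> monomials S T X" using monomialsI by metis
  qed
  then have "cspan (S ` monomials S T X) \<subseteq> cspan (monomials S T X)"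
    by (rule complex_vector.span_mono)
  then show "S x \<in> cspan (monomials S T X)"
    using x by (auto simp: complex_vector_pair.linear_span_image[OF S.lin])
  have comm: "T ((S ^^ j) x) = (S ^^ j) (T x)" if "x \<in> H" for j x
    by (induction j) (auto simp: that commute[symmetric])
  have "T ` monomials S T X \<subseteq> monomials S T X"
  proof
    fix z assume "z \<in> T ` monomials S T X"
    then obtain i j x where z: "x \<in> X" "z = T ((S ^^ j) ((T ^^ i) x))" by (auto simp: monomials_def)
    then have "z = (S ^^ j) ((T ^^ Suc i) x)" using comm X by auto
    then show "z \<in> monomials S T X" using monomialsI z(1) by metis
  qed
  then have "cspan (T ` monomials S T X) \<subseteq> cspan (monomials S T X)"
    by (rule complex_vector.span_mono)
  then show "T x \<in> cspan (monomials S T X)"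
    using x by (auto simp: complex_vector_pair.linear_span_image[OF T.lin])
qed

lemma monomials_subset: "X \<subseteq> H \<Longrightarrow> monomials S T X \<subseteq> H"
  by (auto simp: monomials_def)

section \<open>Too few generators\<close>

text \<open>
  Each joint eigenspace in question contains a nonzero vector orthogonal to \<open>X\<close>, and therefore to
  the closed submodule generated by \<open>X\<close>. Eigenvectors of the adjoint of \<open>S\<close> for distinct
  eigenvalues are independent, so the orthogonal complement has infinite dimension.
\<close>

lemma few_generators_infinite_codimension:
  assumes inf: "infinite \<Lambda>"
    and J: "\<And>l. l \<in> \<Lambda> \<Longrightarrow> \<exists>m. card X < complex_vector.dim (joint_eigenspace l m)"
    and X: "finite X" "X \<subseteq> H"
  shows "\<not> finite_codim_in H (closure (cspan (monomials S T X)))"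
proof
  define C where "C = closure (cspan (monomials S T X))"
  assume "finite_codim_in H (closure (cspan (monomials S T X)))"
  then obtain F where F: "finite F" "H = cspan (C \<union> F)"
    unfolding finite_codim_in_def C_def by blast
  have "\<exists>y. y \<in> S.eigenspace (cnj l) \<and> y \<noteq> 0 \<and> (\<forall>x\<in>C. cinner x y = 0)" if l: "l \<in> \<Lambda>" for l
  proof -
    obtain m where m: "card X < complex_vector.dim (joint_eigenspace l m)" using J[OF l] by blast
    obtain B where B: "B \<subseteq> joint_eigenspace l m" "cindependent B"
      "card B = complex_vector.dim (joint_eigenspace l m)"
      by (rule complex_vector.basis_exists)
    obtain y where y: "y \<in> cspan B" "y \<noteq> 0" "\<forall>x\<in>X. cinner x y = 0"
      using nonzero_orthogonal_to_few[OF B(2) X(1)] m B(3) by auto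
    have "y \<in> joint_eigenspace l m"
      using complex_vector.span_minimal[OF B(1) csubspace_joint_eigenspace] y(1) by blast
    then have yS: "y \<in> S.eigenspace (cnj l)" and yT: "y \<in> T.eigenspace (cnj m)"
      by (auto simp: joint_eigenspace_def)
    have mon: "cinner z y = 0" if "z \<in> monomials S T X" for z
    proof -
      obtain i j x where "x \<in> X" "z = (S ^^ j) ((T ^^ i) x)"
        using \<open>z \<in> monomials S T X\<close> by (auto simp: monomials_def)
      then show ?thesis
        using X(2) y(3) S.cinner_funpow_eigenspace[OF yS] T.cinner_funpow_eigenspace[OF yT] by auto
    qed
    have "cinner x y = 0" if "x \<in> C" for x
      using that unfolding C_def by (rule cinner_eq_0_closure) (rule cinner_eq_0_cspan[OF _ mon])
    then show ?thesis using yS y(2) by blast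
  qed
  then obtain y where y: "\<And>l. l \<in> \<Lambda> \<Longrightarrow> y l \<in> S.eigenspace (cnj l)" "\<And>l. l \<in> \<Lambda> \<Longrightarrow> y l \<noteq> 0"
    "\<And>l x. l \<in> \<Lambda> \<Longrightarrow> x \<in> C \<Longrightarrow> cinner x (y l) = 0"
    by metis
  obtain L where L: "L \<subseteq> \<Lambda>" "finite L" "card L = Suc (card F)"
    using infinite_arbitrarily_large[OF inf] by blast
  have "cindependent (\<Union>r\<in>cnj ` L. {y (cnj r)})"
    by (rule cindependent_eigenvectors[OF S.clinear_adj])
      (use L y(1,2) in \<open>auto simp: S.eigenspace_def subset_eq complex_vector.dependent_single\<close>)
  moreover have "(\<Union>r\<in>cnj ` L. {y (cnj r)}) = y ` L" by auto
  ultimately have ind: "cindependent (y ` L)" by simp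
  have "inj_on y L"
  proof (rule inj_onI)
    fix l k assume lk: "l \<in> L" "k \<in> L" "y l = y k"
    then have "y l \<in> S.eigenspace (cnj l)" "y l \<in> S.eigenspace (cnj k)" "y l \<noteq> 0"
      using y(1)[of l] y(1)[of k] y(2)[of l] L(1) by auto
    then have "S.adj (y l) = cnj l *\<^sub>C y l" "S.adj (y l) = cnj k *\<^sub>C y l" "y l \<noteq> 0"
      unfolding S.eigenspace_def by blast+
    from this(1,2) have "cnj l *\<^sub>C y l = cnj k *\<^sub>C y l" by (rule trans[OF sym])
    then show "l = k"
      using \<open>y l \<noteq> 0\<close> by (simp only: complex_vector.scale_cancel_right complex_cnj_cancel_iff simp_thms)
  qed
  then have "card F < card (y ` L)" using L(3) by (simp add: card_image)
  then obtain u where u: "u \<in> cspan (y ` L)" "u \<noteq> 0" "\<forall>x\<in>F. cinner x u = 0"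
    using nonzero_orthogonal_to_few[OF ind F(1)] by blast
  have Corth: "cinner x u = 0" if x: "x \<in> C" for x
  proof -
    have "cinner u x = 0"
      by (rule cinner_eq_0_cspan[OF u(1)])
        (use y(3)[OF subsetD[OF L(1)] x] cinner_eq_0_commute in blast)
    then show ?thesis using cinner_eq_0_commute by blast
  qed
  have orth: "cinner x u = 0" if x: "x \<in> H" for x
  proof -
    have "x \<in> cspan (C \<union> F)" by (rule subsetD[OF equalityD1[OF F(2)] x])
    then show ?thesis by (rule cinner_eq_0_cspan) (use Corth u(3) in blast)
  qed
  have "y ` L \<subseteq> H" using y(1) L(1) S.eigenspace_subset by blast
  then have "u \<in> H" using complex_vector.span_minimal[OF _ S.sub_H] u(1) by blast
  then show False using orth[of u] u(2) by simp
qed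

section \<open>Enough generators\<close>

text \<open>
  Bases of the finitely many joint eigenspaces over \<open>l\<close> form together an independent subset of the
  fibre, which \<open>1 - cnj l S\<close> carries to the kernel of the adjoint. Vectors of this kernel can
  take arbitrary values there. So one vector \<open>f i\<close> can serve as the \<open>i\<close>-th dual basis vector of all
  joint eigenspaces simultaneously.
\<close>

lemma separating_vectors:
  assumes fd: "finite_dim (S.eigenspace 0)" and l: "norm l < 1" and Z: "finite Z"
    and dim: "\<And>m. m \<in> Z \<Longrightarrow> complex_vector.dim (joint_eigenspace l m) \<le> b"
  shows "\<exists>f. (\<forall>i. f i \<in> S.eigenspace 0) \<and>
    (\<forall>m\<in>Z. \<forall>y\<in>joint_eigenspace l m. (\<forall>i\<in>{1..b}. cinner (f i) y = 0) \<longrightarrow> y = 0)"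
proof -
  define R where "R x = x - cnj l *\<^sub>C S x" for x
  have l': "norm (cnj l) < 1" using l by simp
  have R: "clinear R" unfolding R_def by (rule S.clinear_resolvent)
  obtain C where C: "finite C" "S.eigenspace (cnj l) = cspan C"
    using S.eigenspace_finite_dim[OF fd l'] by blast
  have "\<exists>B. B \<subseteq> joint_eigenspace l m \<and> cindependent B \<and> joint_eigenspace l m \<subseteq> cspan B \<and>
      card B = complex_vector.dim (joint_eigenspace l m)" for m
    by (rule complex_vector.basis_exists[of "joint_eigenspace l m"]) blast
  then obtain B where B: "\<And>m. B m \<subseteq> joint_eigenspace l m" "\<And>m. cindependent (B m)"
    "\<And>m. joint_eigenspace l m \<subseteq> cspan (B m)"
    "\<And>m. card (B m) = complex_vector.dim (joint_eigenspace l m)"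
    by metis
  have finB: "finite (B m)" for m
  proof -
    have "B m \<subseteq> cspan C" using B(1)[of m] C(2) by (auto simp: joint_eigenspace_def)
    then show ?thesis using complex_vector.independent_span_bound[OF C(1) B(2)] by blast
  qed
  have "\<exists>h. inj_on h (B m) \<and> h ` B m \<subseteq> {1..b}" if "m \<in> Z" for m
    using inj_on_iff_card_le[OF finB, of "{1..b}" m] dim[OF that] B(4)[of m] by simp
  then obtain h where h: "\<And>m. m \<in> Z \<Longrightarrow> inj_on (h m) (B m)" "\<And>m. m \<in> Z \<Longrightarrow> h m ` B m \<subseteq> {1..b}"
    by metis
  define U where "U = (\<Union>m\<in>Z. B m)"
  have UE: "U \<subseteq> S.eigenspace (cnj l)" using B(1) by (auto simp: U_def joint_eigenspace_def)
  have BT: "T.adj x = cnj m *\<^sub>C x" if "x \<in> B m" for m x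
    using B(1)[of m] that by (auto simp: joint_eigenspace_def T.eigenspace_def)
  have "cindependent (\<Union>r\<in>cnj ` Z. B (cnj r))"
    by (rule cindependent_eigenvectors[OF T.clinear_adj]) (use Z finB B(2) BT in auto)
  moreover have "(\<Union>r\<in>cnj ` Z. B (cnj r)) = U" by (auto simp: U_def)
  ultimately have indU: "cindependent U" by simp
  have finU: "finite U" using Z finB by (simp add: U_def)
  have injR: "inj_on R U"
    using S.inj_on_resolvent_eigenspace[OF l' UE] complex_vector.span_superset
    unfolding R_def by (rule inj_on_subset)
  have indR: "cindependent (R ` U)"
    unfolding R_def by (rule S.cindependent_in_kernel[OF l' UE indU])
  \<comment> \<open>\<open>h m\<close> numbers the basis of the joint eigenspace at \<open>m\<close>; \<open>c i\<close> selects the \<open>i\<close>-th vectors\<close>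
  define c where "c i y = (if \<exists>m\<in>Z. y \<in> B m \<and> h m y = i then 1 else 0 :: complex)" for i :: nat and y
  have "\<exists>f\<in>cspan (R ` U). \<forall>y\<in>R ` U. cinner f y = c i (inv_into U R y)" for i
    by (rule interpolating_vector) (use finU indR in auto)
  then obtain f where f: "\<And>i. f i \<in> cspan (R ` U)"
    "\<And>i y. y \<in> R ` U \<Longrightarrow> cinner (f i) y = c i (inv_into U R y)"
    by metis
  have "R ` U \<subseteq> S.eigenspace 0" using UE S.eigenspace_to_kernel by (auto simp: R_def)
  then have fE: "f i \<in> S.eigenspace 0" for i
    using f(1)[of i] complex_vector.span_minimal[OF _ S.csubspace_eigenspace] by blast
  have fc: "cinner (f i) y = c i y" if "y \<in> U" for i y
  proof -
    have "cinner (f i) y = cinner (f i) (R y)"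
      unfolding R_def
      by (rule S.cinner_kernel_resolvent[OF fE, symmetric]) (use that UE S.eigenspace_subset in blast)
    also have "\<dots> = c i y" using f(2)[of "R y"] that inv_into_f_f[OF injR that] by simp
    finally show ?thesis .
  qed
  have "y = 0" if m: "m \<in> Z" and y: "y \<in> joint_eigenspace l m"
    and orth: "\<forall>i\<in>{1..b}. cinner (f i) y = 0" for m y
  proof -
    have ci: "c i x = (if h m x = i then 1 else 0)" if x: "x \<in> B m" for i x
    proof -
      have uniq: "m' = m" if "x \<in> B m'" for m'
      proof -
        have "cnj m' *\<^sub>C x = cnj m *\<^sub>C x" using BT[OF x] BT[OF that] by simp
        moreover have "x \<noteq> 0" using B(2)[of m] x complex_vector.dependent_zero by blast
        ultimately show ?thesis by simp
      qed
      have "(\<exists>m'\<in>Z. x \<in> B m' \<and> h m' x = i) \<longleftrightarrow> h m x = i"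
      proof
        assume "\<exists>m'\<in>Z. x \<in> B m' \<and> h m' x = i"
        then obtain m' where "x \<in> B m'" "h m' x = i" by blast
        then show "h m x = i" using uniq[of m'] by simp
      qed (use m x in blast)
      then show ?thesis unfolding c_def by (simp only:)
    qed
    obtain u where u: "y = (\<Sum>x\<in>B m. u x *\<^sub>C x)"
      using B(3)[of m] y complex_vector.span_finite[OF finB[of m]] by blast
    have BU: "z \<in> U" if "z \<in> B m" for z using that m unfolding U_def by blast
    have "u x = 0" if x: "x \<in> B m" for x
    proof -
      have "cinner (f (h m x)) y = (\<Sum>z\<in>B m. cnj (u z) * (if h m z = h m x then 1 else 0))"
        unfolding u cinner_sum_right cinner_scaleC_right
        by (intro sum.cong refl) (simp add: fc[OF BU] ci)
      also have "\<dots> = (\<Sum>z\<in>B m. if z = x then cnj (u z) else 0)"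
        using h(1)[OF m] x by (intro sum.cong) (auto simp: inj_on_def)
      also have "\<dots> = cnj (u x)" using finB x by simp
      finally show ?thesis using orth h(2)[OF m] x by auto
    qed
    then show ?thesis by (simp add: u)
  qed
  then show ?thesis using fE by blast
qed

text \<open>
  The kernel of \<open>T\<^sup>*\<close> is finite-dimensional and invariant under \<open>S\<^sup>*\<close>, hence annihilated by a
  product of factors \<open>S\<^sup>* - r\<close>. If \<open>(S\<^sup>*)\<^sup>k x = 0\<close>, then \<open>T\<^sup>* (S\<^sup>*)\<^sup>k T x = 0\<close>, so
  this product annihilates \<open>(S\<^sup>*)\<^sup>k T x\<close>; the factors \<open>1 - r S\<close> put in front of \<open>T\<close> convert
  it into further powers of \<open>S\<^sup>*\<close>.
\<close>

lemma polynomial_multiple_of_T: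
  assumes fd: "finite_dim (T.eigenspace 0)"
  shows "\<exists>rs. (\<forall>r\<in>set rs. norm r < 1) \<and>
    (\<forall>k. \<forall>x\<in>S.kernel k. S.backshift_prod rs (T x) \<in> S.kernel (k + length rs))"
proof -
  obtain rs where rs: "\<forall>r\<in>set rs. norm r < 1"
    "\<And>y. y \<in> T.eigenspace 0 \<Longrightarrow> shift_prod S.adj rs y = 0"
    using S.finite_dim_adj_invariant[OF T.csubspace_eigenspace T.eigenspace_subset _ fd]
    by (force simp: T.eigenspace_def adj_commute[symmetric] S.adj_simps)
  have "S.backshift_prod rs (T x) \<in> S.kernel (k + length rs)" if x: "x \<in> S.kernel k" for k x
  proof -
    have xH: "x \<in> H" and x0: "(S.adj ^^ k) x = 0" using x by (auto simp: S.kernel_def)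
    have "T.adj ((S.adj ^^ k) (T x)) = 0"
      using xH x0 by (simp add: adj_funpow_commute[symmetric])
    then have "shift_prod S.adj rs ((S.adj ^^ k) (T x)) = 0"
      using xH by (intro rs(2)) (simp add: T.eigenspace_def)
    moreover have "shift_prod S.adj rs ((S.adj ^^ k) (T x)) = (S.adj ^^ k) (shift_prod S.adj rs (T x))"
      by (rule shift_prod_commute[of UNIV])
        (auto simp: clinear_funpow[OF S.clinear_adj] funpow_swap1)
    moreover have "(S.adj ^^ (k + length rs)) (S.backshift_prod rs (T x)) =
        (S.adj ^^ k) (shift_prod S.adj rs (T x))"
      using xH by (simp add: funpow_add S.adj_backshift_prod)
    ultimately show ?thesis using xH by (simp add: S.kernel_def)
  qed
  then show ?thesis using rs(1) by blast
qed

text \<open>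
  With \<open>W\<close> the product of \<open>T\<close> and the factors \<open>1 - r S\<close>, the vectors \<open>W\<^sup>k f\<^sub>i\<close> are
  polynomial and their values at \<open>l\<close> span the fibre. So there are as many of them independent at
  \<open>l\<close> as the dimension of the fibre, which is the growth rate of the filtration of \<open>H\<close> by degree.
\<close>

lemma nearly_generating_vectors:
  assumes ann: "annihilates p H S T" and sf: "rsquarefree (slice p l)" and l: "norm l < 1"
    and fd: "finite_dim (S.eigenspace 0)" "finite_dim (T.eigenspace 0)"
    and dim: "\<And>m. eval2 p l m = 0 \<Longrightarrow> complex_vector.dim (joint_eigenspace l m) \<le> b"
  shows "\<exists>f. f ` {1..b} \<subseteq> H \<and> finite_codim_in H (closure (cspan (monomials S T (f ` {1..b}))))"
proof -
  define E where "E = S.eigenspace (cnj l)"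
  have l': "norm (cnj l) < 1" using l by simp
  have "finite {m. poly (slice p l) m = 0}"
    using sf by (intro poly_roots_finite) (simp add: rsquarefree_def)
  then have Z: "finite {m. eval2 p l m = 0}" by (simp add: poly_slice)
  have "\<exists>f. (\<forall>i. f i \<in> S.eigenspace 0) \<and> (\<forall>m\<in>{m. eval2 p l m = 0}.
      \<forall>y\<in>joint_eigenspace l m. (\<forall>i\<in>{1..b}. cinner (f i) y = 0) \<longrightarrow> y = 0)"
    by (rule separating_vectors[OF fd(1) l Z]) (use dim in blast)
  then obtain f where fE: "\<And>i. f i \<in> S.eigenspace 0" and
    fsep: "\<And>m y. eval2 p l m = 0 \<Longrightarrow> y \<in> joint_eigenspace l m \<Longrightarrow>
      (\<forall>i\<in>{1..b}. cinner (f i) y = 0) \<Longrightarrow> y = 0"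
    by blast
  obtain rs where rs: "\<forall>r\<in>set rs. norm r < 1"
    "\<And>k x. x \<in> S.kernel k \<Longrightarrow> S.backshift_prod rs (T x) \<in> S.kernel (k + length rs)"
    using polynomial_multiple_of_T[OF fd(2)] by blast
  define W where "W x = S.backshift_prod rs (T x)" for x
  define GG where "GG = {(W ^^ k) (f i) | k i. i \<in> {1..b}}"
  define N where "N = cspan (monomials S T (f ` {1..b}))"
  have fH: "f i \<in> H" for i using fE S.eigenspace_subset by blast
  have WH: "(W ^^ k) x \<in> H" if "x \<in> H" for k x
    by (induction k) (auto simp: that W_def)
  then have GGH: "GG \<subseteq> H" using fH by (auto simp: GG_def)

  have NH: "N \<subseteq> H"
    unfolding N_def using fH
    by (intro complex_vector.span_minimal[OF _ S.sub_H] monomials_subset) auto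
  have Nsub: "csubspace N" by (simp add: N_def)
  have NS: "S x \<in> N" and NT: "T x \<in> N" if "x \<in> N" for x
    using cspan_monomials_invariant[of "f ` {1..b}" x] fH that unfolding N_def by auto
  have Nback: "S.backshift_prod ts x \<in> N" if "x \<in> N" for ts x
    by (induction ts)
      (auto simp: that S.backshift_prod_Cons NS Nsub complex_vector.subspace_diff
        complex_vector.subspace_scale)
  have fN: "f i \<in> N" if "i \<in> {1..b}" for i
  proof -
    have "(S ^^ 0) ((T ^^ 0) (f i)) \<in> monomials S T (f ` {1..b})" by (intro monomialsI imageI that)
    then show ?thesis unfolding N_def by (intro complex_vector.span_base) simp
  qed
  have "(W ^^ k) x \<in> N" if "x \<in> N" for k x
    by (induction k) (auto simp: that W_def NT Nback)
  then have GGN: "GG \<subseteq> N" using fN by (auto simp: GG_def)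

  have GGK: "\<exists>k. g \<in> S.kernel k" if "g \<in> GG" for g
  proof -
    have "\<exists>m. (W ^^ k) (f i) \<in> S.kernel m" for k i
    proof (induction k)
      case 0
      show ?case using fE[of i] by (intro exI[of _ 1]) (auto simp: S.kernel_def S.eigenspace_def)
    next
      case (Suc k)
      then show ?case using rs(2) by (auto simp: W_def)
    qed
    then show ?thesis using that by (auto simp: GG_def)
  qed

  \<comment> \<open>The values at \<open>l\<close> of the vectors \<open>W\<^sup>k f\<^sub>i\<close> span the fibre.\<close>
  have GGsep: "y = 0" if y: "y \<in> E" and orth: "\<And>g. g \<in> GG \<Longrightarrow> cinner g y = 0" for y
  proof -
    \<comment> \<open>\<open>V\<close> is what the values of the \<open>T\<^sup>k f\<^sub>i\<close> miss; if it were nonzero it would contain a joint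
      eigenvector, contrary to the choice of the \<open>f\<^sub>i\<close>.\<close>
    define V where "V = {y \<in> E. \<forall>k. \<forall>i\<in>{1..b}. cinner ((T ^^ k) (f i)) y = 0}"
    \<comment> \<open>the value at \<open>l\<close> of the factor in front of \<open>T\<close>\<close>
    define d where "d = (\<Prod>t\<leftarrow>rs. 1 - t * l)"
    have "1 - t * l \<noteq> 0" if "t \<in> set rs" for t
    proof
      assume "1 - t * l = 0"
      then have "norm t * norm l = 1" by (metis eq_iff_diff_eq_0 norm_mult norm_one)
      moreover have "norm t * norm l < 1 * 1" using rs(1) that l by (intro mult_strict_mono') auto
      ultimately show False by simp
    qed
    then have "d \<noteq> 0" by (auto simp: d_def prod_list_zero_iff)
    have pair: "cinner ((W ^^ k) x) y = d ^ k * cinner ((T ^^ k) x) y" if "x \<in> H" "y \<in> E" for k x y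
      using that(2)
    proof (induction k arbitrary: y)
      case (Suc k)
      have yE: "y \<in> S.eigenspace (cnj l)" using Suc.prems by (simp add: E_def)
      have "cinner ((W ^^ Suc k) x) y = d * cinner (T ((W ^^ k) x)) y"
        using S.cinner_backshift_prod[OF yE] WH[OF that(1)] by (simp add: W_def d_def)
      also have "\<dots> = d * cinner ((W ^^ k) x) (T.adj y)"
        using WH[OF that(1)] by (simp add: T.cinner_adj)
      also have "\<dots> = d * (d ^ k * cinner ((T ^^ k) x) (T.adj y))"
        using Suc.IH[of "T.adj y"] eigenspace_T_adj Suc.prems by (simp add: E_def)
      also have "\<dots> = d ^ Suc k * cinner ((T ^^ Suc k) x) y"
        using that(1) by (simp add: T.cinner_adj)
      finally show ?case .
    qed simp
    have Vsub: "csubspace V"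
      using complex_vector.subspace_0[OF S.csubspace_eigenspace, of "cnj l"]
        complex_vector.subspace_add[OF S.csubspace_eigenspace, of _ "cnj l"]
        complex_vector.subspace_scale[OF S.csubspace_eigenspace, of _ "cnj l"]
      by (intro complex_vector.subspaceI)
        (auto simp: V_def E_def cinner_add_right cinner_scaleC_right)
    have "V \<subseteq> cspan (\<Union>m\<in>{m. eval2 p l m = 0}. V \<inter> joint_eigenspace l m)"
    proof (rule eigenspace_decomposition[OF ann sf Vsub])
      show "V \<subseteq> S.eigenspace (cnj l)" by (auto simp: V_def E_def)
      fix y assume y: "y \<in> V"
      have "cinner ((T ^^ k) (f i)) (T.adj y) = 0" if "i \<in> {1..b}" for k i
      proof -
        have "cinner ((T ^^ k) (f i)) (T.adj y) = cinner ((T ^^ Suc k) (f i)) y"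
          using fH by (simp add: T.cinner_adj)
        also have "\<dots> = 0" using y that unfolding V_def by blast
        finally show ?thesis .
      qed
      then show "T.adj y \<in> V" using y eigenspace_T_adj by (auto simp: V_def E_def)
    qed
    also have "(\<Union>m\<in>{m. eval2 p l m = 0}. V \<inter> joint_eigenspace l m) \<subseteq> {0}"
    proof
      fix x assume "x \<in> (\<Union>m\<in>{m. eval2 p l m = 0}. V \<inter> joint_eigenspace l m)"
      then obtain m where m: "eval2 p l m = 0" "x \<in> joint_eigenspace l m" and "x \<in> V" by blast
      have "\<forall>i\<in>{1..b}. cinner ((T ^^ 0) (f i)) x = 0" using \<open>x \<in> V\<close> unfolding V_def by blast
      then show "x \<in> {0}" using fsep[OF m] by simp
    qed
    then have "cspan (\<Union>m\<in>{m. eval2 p l m = 0}. V \<inter> joint_eigenspace l m) \<subseteq> {0}"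
      by (rule complex_vector.span_minimal) simp
    finally have "V \<subseteq> {0}" .
    moreover have "y \<in> V"
    proof -
      have "cinner ((T ^^ k) (f i)) y = 0" if "i \<in> {1..b}" for k i
        using pair[OF fH[of i] y, of k] orth[of "(W ^^ k) (f i)"] that \<open>d \<noteq> 0\<close>
        by (auto simp: GG_def)
      then show ?thesis using y by (simp add: V_def)
    qed
    ultimately show ?thesis by blast
  qed

  \<comment> \<open>\<open>B0\<close> measures the filtration, its copy \<open>B1\<close> the fibre over \<open>l\<close>, and \<open>G\<close> consists of the vectors
    whose values at \<open>l\<close> form the independent set \<open>B\<close>.\<close>
  obtain C where C: "finite C" "E = cspan C"
    using S.eigenspace_finite_dim[OF fd(1) l'] unfolding E_def by blast
  have Ecl: "closed_csubspace E" unfolding C(2) by (rule closed_csubspace_cspan_finite[OF C(1)])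
  define P where "P = proj E"
  obtain F0 where F0: "finite F0" "S.eigenspace 0 \<subseteq> cspan F0" using fd(1) by (auto simp: finite_dim_def)
  obtain B0 where B0: "B0 \<subseteq> S.eigenspace 0" "cindependent B0" "S.eigenspace 0 \<subseteq> cspan B0"
    by (rule complex_vector.basis_exists)
  have finB0: "finite B0"
    using complex_vector.independent_span_bound[OF F0(1) B0(2)] B0(1) F0(2) by blast
  obtain B1 where B1: "B1 \<subseteq> E" "cindependent B1" "card B1 = card B0"
    using S.eigenspace_independent_copy[OF B0(1,2) l'] unfolding E_def by blast
  obtain B where B: "B \<subseteq> P ` GG" "cindependent B" "P ` GG \<subseteq> cspan B"
    by (rule complex_vector.maximal_independent_subset)
  have PE: "P x \<in> E" for x unfolding P_def by (rule proj_in[OF Ecl])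
  have finB: "finite B"
    using complex_vector.independent_span_bound[OF C(1) B(2)] B(1) PE C(2) by blast
  have cardB: "card B0 \<le> card B"
  proof (rule ccontr)
    assume "\<not> card B0 \<le> card B"
    then obtain y where y: "y \<in> cspan B1" "y \<noteq> 0" "\<forall>x\<in>B. cinner x y = 0"
      using nonzero_orthogonal_to_few[OF B1(2) finB] B1(3) by auto
    have "y \<in> E"
      using complex_vector.span_minimal[OF B1(1)] Ecl y(1) by (auto simp: closed_csubspace_def)
    have "cinner g y = 0" if "g \<in> GG" for g
    proof -
      have "P g \<in> cspan B" using B(3) that by blast
      then have "cinner (P g) y = 0" by (rule cinner_eq_0_cspan) (use y(3) in blast)
      then show ?thesis unfolding P_def using cinner_proj[OF Ecl \<open>y \<in> E\<close>] by simp
    qed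
    then show False using GGsep[OF \<open>y \<in> E\<close>] y(2) by blast
  qed
  obtain G where G: "G \<subseteq> GG" "inj_on P G" "B = P ` G"
    using B(1) unfolding subset_image_inj by blast
  have finG: "finite G" using finB G(2,3) by (simp add: finite_image_iff)
  have cardG: "card B0 \<le> card G" using cardB G(2,3) by (simp add: card_image)
  obtain m where m: "G \<subseteq> S.kernel m"
  proof -
    have "\<exists>m. G' \<subseteq> S.kernel m" if "finite G'" "G' \<subseteq> GG" for G'
      using that
    proof (induction G' rule: finite_induct)
      case (insert g G')
      then obtain i j where "G' \<subseteq> S.kernel i" "g \<in> S.kernel j" using GGK by blast
      then have "insert g G' \<subseteq> S.kernel (max i j)"
        using S.kernel_mono[of i "max i j"] S.kernel_mono[of j "max i j"] by auto
      then show ?case by blast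
    qed auto
    then show ?thesis using that finG G(1) by blast
  qed

  have codim: "\<exists>F. finite F \<and> F \<subseteq> (\<Union>k. S.kernel k) \<and> (\<Union>k. S.kernel k) \<subseteq> cspan (N \<union> F)"
  proof (rule filtration_codimension[where M = "card B0" and m = m])
    show "S.kernel j \<subseteq> S.kernel k" if "j \<le> k" for j k by (rule S.kernel_mono[OF that])
    show "\<exists>F. finite F \<and> card F \<le> k * card B0 \<and> S.kernel k \<subseteq> cspan F" for k
      by (rule S.kernel_spanned[OF finB0 B0(3)])
    fix k
    have "\<exists>X. finite X \<and> cindependent X \<and> card X = k * card G \<and>
        X \<subseteq> (\<Union>j<k. (\<lambda>g. shift_prod S (replicate j l) g) ` G)"
      by (rule S.cindependent_shifts[OF l])
        (use Ecl finG G GGH B(2) in \<open>auto simp: E_def P_def\<close>)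
    then obtain X where X: "finite X" "cindependent X" "card X = k * card G"
      "X \<subseteq> (\<Union>j<k. (\<lambda>g. shift_prod S (replicate j l) g) ` G)" by blast
    have shN: "shift_prod S (replicate j l) g \<in> N" if g: "g \<in> G" for j g
      by (rule shift_prod_in[OF Nsub NS]) (use g GGN G(1) in auto)
    have shK: "shift_prod S (replicate j l) g \<in> S.kernel (j + m)" if g: "g \<in> G" for j g
    proof (induction j)
      case 0
      show ?case using m g by auto
    next
      case (Suc j)
      then have "shift_prod S (replicate j l) g \<in> S.kernel (Suc (j + m))"
        using S.kernel_mono[of "j + m" "Suc (j + m)"] by auto
      moreover have "S (shift_prod S (replicate j l) g) \<in> S.kernel (Suc (j + m))"
        using S.S_kernel[OF Suc] .
      ultimately show ?case
        using S.csubspace_kernel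
        by (simp add: shift_prod_Cons complex_vector.subspace_diff complex_vector.subspace_scale)
    qed
    have "X \<subseteq> N \<inter> S.kernel (k + m)"
    proof
      fix x assume "x \<in> X"
      then obtain j g where "j < k" "g \<in> G" "x = shift_prod S (replicate j l) g"
        using X(4) by blast
      then show "x \<in> N \<inter> S.kernel (k + m)"
        using shN[of g j] shK[of g j] S.kernel_mono[of "j + m" "k + m"] by auto
    qed
    then show "\<exists>B. B \<subseteq> N \<and> B \<subseteq> S.kernel (k + m) \<and> finite B \<and> cindependent B \<and>
        k * card B0 \<le> card B"
      using X(1-3) cardG by (intro exI[of _ X]) auto
  qed
  then obtain F where F: "finite F" "F \<subseteq> (\<Union>k. S.kernel k)" "(\<Union>k. S.kernel k) \<subseteq> cspan (N \<union> F)"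
    by blast
  have NclH: "closure N \<subseteq> H"
    using NH S.closed_H by (intro closure_minimal) (auto simp: closed_csubspace_def)
  have FH: "F \<subseteq> H" using F(2) by (auto simp: S.kernel_def)
  have "closed_csubspace (cspan (closure N \<union> F))"
    by (rule closed_csubspace_Un_finite[OF _ F(1)])
      (simp add: closed_csubspace_def csubspace_closure[OF Nsub])
  moreover have "(\<Union>k. S.kernel k) \<subseteq> cspan (closure N \<union> F)"
    using F(3) complex_vector.span_mono[of "N \<union> F" "closure N \<union> F"] closure_subset[of N] by blast
  ultimately have "closure (\<Union>k. S.kernel k) \<subseteq> cspan (closure N \<union> F)"
    by (intro closure_minimal) (auto simp: closed_csubspace_def)
  then have "H \<subseteq> cspan (closure N \<union> F)" using S.kernel_dense by blast
  moreover have "cspan (closure N \<union> F) \<subseteq> H"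
    using NclH FH by (intro complex_vector.span_minimal[OF _ S.sub_H]) auto
  ultimately have "finite_codim_in H (closure N)"
    using F(1) NclH FH unfolding finite_codim_in_def by blast
  then show ?thesis using fH unfolding N_def by blast
qed

end

section \<open>Invariant subspaces of finite codimension\<close>

lemma finite_codim_in_trans:
  assumes "finite_codim_in H H'" "finite_codim_in H' C"
  shows "finite_codim_in H C"
proof -
  obtain F where F: "H' \<subseteq> H" "finite F" "F \<subseteq> H" "H = cspan (H' \<union> F)"
    using assms(1) by (auto simp: finite_codim_in_def)
  obtain F' where F': "C \<subseteq> H'" "finite F'" "F' \<subseteq> H'" "H' = cspan (C \<union> F')"
    using assms(2) by (auto simp: finite_codim_in_def)
  have "csubspace H" by (subst F(4)) simp
  have "cspan (C \<union> F') \<subseteq> cspan (C \<union> (F \<union> F'))" by (rule complex_vector.span_mono) auto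
  then have "H' \<subseteq> cspan (C \<union> (F \<union> F'))" using F'(4) by simp
  moreover have "F \<subseteq> cspan (C \<union> (F \<union> F'))" by (auto intro: complex_vector.span_base)
  ultimately have "cspan (H' \<union> F) \<subseteq> cspan (C \<union> (F \<union> F'))"
    by (intro complex_vector.span_minimal) auto
  moreover have "cspan (C \<union> (F \<union> F')) \<subseteq> H"
    using F(1,3) F'(1,3) by (intro complex_vector.span_minimal[OF _ \<open>csubspace H\<close>]) auto
  ultimately have "H = cspan (C \<union> (F \<union> F'))" using F(4) by simp
  moreover have "C \<subseteq> H" by (rule order_trans[OF F'(1) F(1)])
  moreover have "finite (F \<union> F')" using F(2) F'(2) by simp
  moreover have "F \<union> F' \<subseteq> H" by (rule Un_least[OF F(3) order_trans[OF F'(3) F(1)]])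
  ultimately show ?thesis unfolding finite_codim_in_def by blast
qed

lemma finite_codim_in_refl: assumes "csubspace H" shows "finite_codim_in H H"
proof -
  have "H = cspan (H \<union> {})"
    unfolding Un_empty_right by (rule complex_vector.span_eq_iff[THEN iffD2, OF assms, symmetric])
  then show ?thesis unfolding finite_codim_in_def by (intro conjI exI[of _ "{}"]) simp_all
qed

context isometry
begin

lemma closure_invariant:
  assumes "N \<subseteq> H" "\<And>x. x \<in> N \<Longrightarrow> S x \<in> N" "x \<in> closure N"
  shows "S x \<in> closure N"
proof -
  have "closure N \<subseteq> H"
    using assms(1) closed_H by (intro closure_minimal) (auto simp: closed_csubspace_def)
  moreover have "dist (S x) (S y) \<le> 1 * dist x y" if "x \<in> H" "y \<in> H" for x y
    using that norm_S[of "x - y"] by (simp add: dist_norm S_simps)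
  then have "continuous_on H S"
    by (intro lipschitz_on_continuous_on[OF lipschitz_onI[of _ _ 1]]) auto
  ultimately have "continuous_on (closure N) S" by (rule continuous_on_subset[rotated])
  then have "S ` closure N \<subseteq> closure N"
    by (rule image_closure_subset) (use assms(2) closure_subset in auto)
  then show ?thesis using assms(3) by auto
qed

end

section \<open>Blaschke products of an isometry\<close>

context commuting_isometries
begin

text \<open>
  The isometric maps on \<open>H\<close> that commute with both isometries; they identify the pair with its
  restriction to their range.
\<close>

definition intertwiner :: "('a \<Rightarrow> 'a) \<Rightarrow> bool" where
  "intertwiner U \<longleftrightarrow> clinear_on H U \<and>
    (\<forall>x\<in>H. U x \<in> H \<and> norm (U x) = norm x \<and> U (S x) = S (U x) \<and> U (T x) = T (U x))"

text \<open>
  The operator \<open>(S - a) (1 - cnj a S)\<^sup>-\<^sup>1\<close>. It is isometric because \<open>S - a\<close> and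
  \<open>1 - cnj a S\<close> have the same norm at every vector when \<open>S\<close> is an isometry.
\<close>

lemma blaschke_factor:
  assumes "norm a < 1"
  shows "\<exists>U. intertwiner U \<and> U ` H = (\<lambda>x. S x - a *\<^sub>C x) ` H"
proof -
  define Q where "Q y = (THE x. x \<in> H \<and> x - cnj a *\<^sub>C S x = y)" for y
  have "norm (cnj a) < 1" using assms by simp
  note ex1 = S.resolvent[OF this]
  have Q: "Q y \<in> H" "Q y - cnj a *\<^sub>C S (Q y) = y" if "y \<in> H" for y
    using theI'[OF ex1[OF that]] by (auto simp: Q_def)
  have Q_eq: "Q y = x" if "x \<in> H" "x - cnj a *\<^sub>C S x = y" for x y
    unfolding Q_def by (rule the1_equality[OF ex1]) (use that in auto)
  have Q_add: "Q (x + y) = Q x + Q y" if "x \<in> H" "y \<in> H" for x y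
  proof (rule Q_eq)
    have "Q x + Q y - cnj a *\<^sub>C S (Q x + Q y) =
        (Q x - cnj a *\<^sub>C S (Q x)) + (Q y - cnj a *\<^sub>C S (Q y))"
      by (simp add: S.S_simps complex_vector.scale_right_distrib)
    then show "Q x + Q y - cnj a *\<^sub>C S (Q x + Q y) = x + y" using Q that by simp
  qed (use Q that in auto)
  have Q_scale: "Q (c *\<^sub>C x) = c *\<^sub>C Q x" if "x \<in> H" for c x
  proof (rule Q_eq)
    have "c *\<^sub>C Q x - cnj a *\<^sub>C S (c *\<^sub>C Q x) = c *\<^sub>C (Q x - cnj a *\<^sub>C S (Q x))"
      by (simp add: S.S_simps complex_vector.scale_right_diff_distrib scaleC_scaleC mult.commute)
    then show "c *\<^sub>C Q x - cnj a *\<^sub>C S (c *\<^sub>C Q x) = c *\<^sub>C x" using Q that by simp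
  qed (use Q that in auto)
  have Q_S: "Q (S x) = S (Q x)" if "x \<in> H" for x
  proof (rule Q_eq)
    have "S (Q x) - cnj a *\<^sub>C S (S (Q x)) = S (Q x - cnj a *\<^sub>C S (Q x))" by (simp add: S.S_simps)
    then show "S (Q x) - cnj a *\<^sub>C S (S (Q x)) = S x" using Q that by simp
  qed (use Q that in auto)
  have Q_T: "Q (T x) = T (Q x)" if "x \<in> H" for x
  proof (rule Q_eq)
    have "T (Q x) - cnj a *\<^sub>C S (T (Q x)) = T (Q x - cnj a *\<^sub>C S (Q x))"
      using Q(1)[OF that] by (simp add: T.S_simps commute)
    then show "T (Q x) - cnj a *\<^sub>C S (T (Q x)) = T x" using Q that by simp
  qed (use Q that in auto)
  define U where "U y = S (Q y) - a *\<^sub>C Q y" for y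
  have norm_U: "norm (U y) = norm y" if "y \<in> H" for y
  proof -
    define x where "x = Q y"
    have x: "x \<in> H" "x - cnj a *\<^sub>C S x = y" using Q that by (auto simp: x_def)
    have "cinner (S x - a *\<^sub>C x) (S x - a *\<^sub>C x) =
        cinner (x - cnj a *\<^sub>C S x) (x - cnj a *\<^sub>C S x)"
      using S.cinner_S[OF x(1) x(1)]
      by (simp add: cinner_diff_left cinner_diff_right cinner_scaleC_left cinner_scaleC_right
          algebra_simps)
    then have "complex_of_real ((norm (U y))\<^sup>2) = complex_of_real ((norm y)\<^sup>2)"
      using x(2) by (simp only: U_def cinner_self x_def)
    then show ?thesis by (simp only: of_real_eq_iff) (simp add: power2_eq_iff_nonneg)
  qed
  have "clinear_on H U"
    by (simp add: clinear_on_def U_def Q_add Q_scale S.S_simps complex_vector.scale_right_distrib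
        complex_vector.scale_right_diff_distrib scaleC_scaleC mult.commute)
  moreover have "U (S x) = S (U x)" "U (T x) = T (U x)" "U x \<in> H" if "x \<in> H" for x
    using Q that by (simp_all add: U_def Q_S Q_T S.S_simps T.S_simps commute)
  ultimately have "intertwiner U" using norm_U by (simp add: intertwiner_def)
  moreover have "Q ` H = H"
  proof
    show "Q ` H \<subseteq> H" using Q by auto
    show "H \<subseteq> Q ` H"
    proof
      fix x assume "x \<in> H"
      then have "x = Q (x - cnj a *\<^sub>C S x)" by (intro Q_eq[symmetric]) auto
      then show "x \<in> Q ` H" by (rule image_eqI) (use \<open>x \<in> H\<close> in simp)
    qed
  qed
  then have "U ` H = (\<lambda>x. S x - a *\<^sub>C x) ` H"
    unfolding U_def by (metis (no_types, lifting) image_cong image_image)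
  ultimately show ?thesis by blast
qed

lemma blaschke_product:
  assumes "\<forall>r\<in>set rs. norm r < 1"
  shows "\<exists>U. intertwiner U \<and> U ` H = shift_prod S rs ` H"
  using assms
proof (induction rs)
  case Nil
  have "intertwiner (\<lambda>x. x)" by (simp add: intertwiner_def clinear_on_def)
  then show ?case by (intro exI[of _ "\<lambda>x. x"]) auto
next
  case (Cons a rs)
  obtain U where U: "intertwiner U" "U ` H = shift_prod S rs ` H"
    using Cons.IH Cons.prems by auto
  obtain V where V: "intertwiner V" "V ` H = (\<lambda>x. S x - a *\<^sub>C x) ` H"
    using blaschke_factor[of a] Cons.prems by auto
  have "intertwiner (\<lambda>x. U (V x))"
    using U(1) V(1) by (simp add: intertwiner_def clinear_on_def)
  moreover have "(\<lambda>x. U (V x)) ` H = shift_prod S (a # rs) ` H"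
  proof -
    have U_diff: "U (S x - a *\<^sub>C x) = S (U x) - a *\<^sub>C U x" if "x \<in> H" for x
    proof -
      have "U (S x + (- a) *\<^sub>C x) = U (S x) + U ((- a) *\<^sub>C x)"
        using U(1) that unfolding intertwiner_def clinear_on_def by (meson S.H_simps(4) S.S_in)
      moreover have "U ((- a) *\<^sub>C x) = (- a) *\<^sub>C U x" "U (S x) = S (U x)"
        using U(1) that unfolding intertwiner_def clinear_on_def by blast+
      ultimately show ?thesis by simp
    qed
    have "(\<lambda>x. U (V x)) ` H = U ` V ` H" by (simp add: image_image)
    also have "\<dots> = (\<lambda>x. U (S x - a *\<^sub>C x)) ` H" by (simp add: V(2) image_image)
    also have "\<dots> = (\<lambda>x. S x - a *\<^sub>C x) ` U ` H"
      using U_diff by (simp add: image_image)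
    also have "\<dots> = shift_prod S (a # rs) ` H" by (simp add: U(2) image_image shift_prod_Cons)
    finally show ?thesis .
  qed
  ultimately show ?case by blast
qed

text \<open>
  The adjoint of \<open>S\<close> acts on the finite-dimensional orthogonal complement \<open>G\<close> of \<open>K\<close> with
  eigenvalues in the disc. A product of factors \<open>S\<^sup>* - r\<close> annihilates \<open>G\<close>, so the product of the
  factors \<open>S - cnj r\<close> maps \<open>H\<close> into \<open>K\<close>; the corresponding Blaschke product has the same range.
\<close>

lemma intertwiner_into_finite_codim:
  assumes K: "closed_csubspace K" and KS: "\<And>x. x \<in> K \<Longrightarrow> S x \<in> K" and fc: "finite_codim_in H K"
  shows "\<exists>U. intertwiner U \<and> U ` H \<subseteq> K"
proof -
  obtain F where F: "K \<subseteq> H" "finite F" "F \<subseteq> H" "H = cspan (K \<union> F)"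
    using fc by (auto simp: finite_codim_in_def)
  define G where "G = {x \<in> H. \<forall>y\<in>K. cinner x y = 0}"
  define Q where "Q x = x - proj K x" for x
  have Q: "clinear Q"
    unfolding Q_def
    by (rule clinearI) (simp_all add: clinear_simps[OF clinear_proj[OF K]]
        complex_vector.scale_right_diff_distrib)
  have Gsub: "csubspace G"
    by (rule complex_vector.subspaceI) (auto simp: G_def cinner_add_left cinner_scaleC_left)
  have QG: "Q x \<in> G" if "x \<in> H" for x
    using proj_orthogonal[OF K, of _ x] proj_in[OF K, of x] F(1) that by (auto simp: G_def Q_def)
  have "G \<subseteq> cspan (insert 0 (Q ` F))"
  proof
    fix x assume x: "x \<in> G"
    then have "proj K x = 0"
      using K by (intro proj_eqI) (auto simp: G_def closed_csubspace_def complex_vector.subspace_0)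
    then have xQ: "Q x = x" by (simp add: Q_def)
    have "x \<in> cspan (K \<union> F)" using x F(4) by (auto simp: G_def)
    then have "Q x \<in> cspan (Q ` (K \<union> F))" by (simp add: complex_vector_pair.linear_span_image[OF Q])
    moreover have "Q ` (K \<union> F) \<subseteq> insert 0 (Q ` F)" by (auto simp: Q_def proj_id[OF K])
    then have "cspan (Q ` (K \<union> F)) \<subseteq> cspan (insert 0 (Q ` F))" by (rule complex_vector.span_mono)
    ultimately show "x \<in> cspan (insert 0 (Q ` F))" unfolding xQ by (rule subsetD[rotated])
  qed
  then have "finite_dim G"
    unfolding finite_dim_def by (intro exI[of _ "insert 0 (Q ` F)"]) (simp add: F(2))
  moreover have "S.adj x \<in> G" if x: "x \<in> G" for x
  proof -
    have "cinner (S.adj x) y = 0" if y: "y \<in> K" for y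
      using S.cinner_adj'[of y x] x KS[OF y] y F(1) by (auto simp: G_def)
    then show ?thesis by (simp add: G_def)
  qed
  moreover have "G \<subseteq> H" by (auto simp: G_def)
  ultimately obtain rs where rs: "\<forall>r\<in>set rs. norm r < 1" "\<forall>y\<in>G. shift_prod S.adj rs y = 0"
    using S.finite_dim_adj_invariant[OF Gsub] by blast
  have into: "shift_prod S (map cnj rs) h \<in> K" if h: "h \<in> H" for h
  proof -
    define z where "z = shift_prod S (map cnj rs) h"
    have "z \<in> H" unfolding z_def by (rule shift_prod_in[OF S.sub_H]) (use h in auto)
    then have "Q z \<in> G" by (rule QG)
    have "cinner z (Q z) = cinner h (shift_prod S.adj rs (Q z))"
      using S.cinner_shift_prod[OF h, of "Q z" "map cnj rs"] \<open>Q z \<in> G\<close> \<open>G \<subseteq> H\<close>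
      by (auto simp: z_def o_def)
    also have "\<dots> = 0" using rs(2) \<open>Q z \<in> G\<close> by simp
    finally have "cinner z (Q z) = 0" .
    moreover have "cinner (proj K z) (Q z) = 0"
      using \<open>Q z \<in> G\<close> proj_in[OF K, of z] cinner_eq_0_commute by (auto simp: G_def)
    ultimately have "cinner (Q z) (Q z) = 0" by (subst Q_def) (simp add: cinner_diff_left)
    then have "z = proj K z" by (simp add: Q_def)
    then show ?thesis using proj_in[OF K, of z] by (simp add: z_def)
  qed
  obtain U where U: "intertwiner U" "U ` H = shift_prod S (map cnj rs) ` H"
    using blaschke_product[of "map cnj rs"] rs(1) by auto
  have "U ` H \<subseteq> K" unfolding U(2) using into by (rule image_subsetI)
  then show ?thesis using U(1) by (intro exI[of _ U] conjI)
qed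

end

section \<open>Extending operators from a subspace\<close>

lemma funpow_cong_on:
  assumes "\<And>x. x \<in> H \<Longrightarrow> A x = S x" "\<And>x. x \<in> H \<Longrightarrow> S x \<in> H" "x \<in> H"
  shows "(A ^^ k) x = (S ^^ k) x \<and> (S ^^ k) x \<in> H"
  by (induction k) (auto simp: assms)

lemma op_eval_cong_on:
  assumes "\<And>x. x \<in> H \<Longrightarrow> A x = S x" "\<And>x. x \<in> H \<Longrightarrow> B x = T x"
    and "\<And>x. x \<in> H \<Longrightarrow> S x \<in> H" "\<And>x. x \<in> H \<Longrightarrow> T x \<in> H" "x \<in> H"
  shows "op_eval q A B x = op_eval q S T x"
proof -
  have "(B ^^ i) x = (T ^^ i) x" "(T ^^ i) x \<in> H" for i
    using funpow_cong_on[OF assms(2,4,5)] by auto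
  moreover have "(A ^^ j) y = (S ^^ j) y" if "y \<in> H" for j y
    using funpow_cong_on[OF assms(1,3) that] by auto
  ultimately show ?thesis unfolding op_eval_def by simp
qed

lemma poly_combs_cong_on:
  assumes "\<And>x. x \<in> H \<Longrightarrow> A x = S x" "\<And>x. x \<in> H \<Longrightarrow> B x = T x"
    and "\<And>x. x \<in> H \<Longrightarrow> S x \<in> H" "\<And>x. x \<in> H \<Longrightarrow> T x \<in> H" "f ` {1..k} \<subseteq> H"
  shows "poly_combs A B k f = poly_combs S T k f"
proof -
  have "(\<Sum>j=1..k. op_eval (q j) A B (f j)) = (\<Sum>j=1..k. op_eval (q j) S T (f j))" for q
    using assms(5) by (intro sum.cong op_eval_cong_on[OF assms(1-4)]) auto
  then show ?thesis unfolding poly_combs_def by simp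
qed

lemma ker_adjoint_cong_on:
  assumes "\<And>x. x \<in> H \<Longrightarrow> A x = S x"
  shows "ker_adjoint H A = ker_adjoint H S"
proof -
  have "adjoint_on H A y = adjoint_on H S y" for y
    unfolding adjoint_on_def using assms by (intro arg_cong[of _ _ The]) auto
  then show ?thesis by (simp add: ker_adjoint_def)
qed

text \<open>
  Composing with the projection onto \<open>H\<close> makes an operator on \<open>H\<close> linear on the whole
  space without changing it on \<open>H\<close>.
\<close>

lemma linear_extension:
  assumes "closed_csubspace H" "isometry_on H S"
  shows "isometry H (\<lambda>x. S (proj H x)) \<and> (\<forall>x\<in>H. S (proj H x) = S x)"
proof -
  have S: "\<And>x. x \<in> H \<Longrightarrow> S x \<in> H" "clinear_on H S" "\<And>x. x \<in> H \<Longrightarrow> norm (S x) = norm x"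
    using assms(2) by (auto simp: isometry_on_def)
  note P = proj_in[OF assms(1)] proj_id[OF assms(1)] clinear_simps[OF clinear_proj[OF assms(1)]]
  have "clinear (\<lambda>x. S (proj H x))"
    using S(2) by (intro clinearI) (auto simp: P clinear_on_def)
  then have "isometry H (\<lambda>x. S (proj H x))"
    by (intro isometry.intro assms(1)) (simp_all add: P S)
  then show ?thesis by (simp add: P)
qed

lemma pure_q_isopair_restrict:
  assumes V: "pure_q_isopair q H S T" and K: "invariant_subspace H S T K"
  shows "pure_q_isopair q K S T"
proof -
  have sub: "K \<subseteq> H" and cl: "closed_csubspace K" and inv: "S ` K \<subseteq> K" "T ` K \<subseteq> K"
    using K by (auto simp: invariant_subspace_def)
  have "pure_isometry K R" if R: "pure_isometry H R" "R ` K \<subseteq> K" for R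
  proof -
    have R_add: "R (x + y) = R x + R y" and R_scale: "R (c *\<^sub>C x) = c *\<^sub>C R x" and R_norm: "norm (R x) = norm x"
      if "x \<in> K" "y \<in> K" for c x y
      using R(1) subsetD[OF sub that(1)] subsetD[OF sub that(2)]
      by (simp_all add: pure_isometry_def isometry_on_def clinear_on_def)
    have "isometry_on K R"
      unfolding isometry_on_def clinear_on_def using R(2) by (simp add: R_add R_scale R_norm)
    moreover have "(\<Inter>j\<in>{1..}. (R ^^ j) ` K) \<subseteq> {0}"
    proof -
      have "(\<Inter>j\<in>{1..}. (R ^^ j) ` K) \<subseteq> (\<Inter>j\<in>{1..}. (R ^^ j) ` H)"
        by (intro INF_mono' image_mono sub)
      then show ?thesis using R(1) by (simp add: pure_isometry_def)
    qed
    moreover have "0 \<in> (R ^^ j) ` K" for j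
    proof -
      have 0: "0 \<in> K" using cl by (simp add: closed_csubspace_def complex_vector.subspace_0)
      have "R 0 = 0" using R_scale[OF 0 0, of 0] by simp
      then have "(R ^^ j) 0 = 0" by (induction j) auto
      then show ?thesis using 0 by (metis imageI)
    qed
    ultimately show ?thesis by (auto simp: pure_isometry_def)
  qed
  moreover have "\<forall>x\<in>K. S (T x) = T (S x)" "annihilates q K S T" "q \<noteq> 0"
    "pure_isometry H S" "pure_isometry H T"
    using V sub by (auto simp: pure_q_isopair_def pure_isopair_def annihilates_def)
  ultimately show ?thesis
    using cl inv by (simp add: pure_q_isopair_def pure_isopair_def)
qed

section \<open>Rank and cyclicity\<close>

theorem corollary5p3:
  fixes H :: "'a::chilbert_space set"
    and S T :: "'a \<Rightarrow> 'a"
    and p :: poly2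
    and s :: nat
    and P :: "nat \<Rightarrow> poly2"
    and \<alpha> :: "nat \<Rightarrow> nat"
    and \<beta> :: nat
  assumes "pure_q_isopair p H S T"
    and "finite_bimultiplicity H S T"
    and "minimal_polynomial p H S T"
    and "1 \<le> s"
    and "p = (\<Prod>j=1..s. P j)"
    and "\<forall>j\<in>{1..s}. irreducible (P j)"
    and "inj_on P {1..s}"
    and "has_rank H S T p s P \<alpha>"
    and "\<beta> = Max (\<alpha> ` {1..s})"
  shows "(\<exists>H'. invariant_subspace H S T H' \<and> finite_codim_in H H' \<and> cyclic H' S T \<beta>) \<and>
         (\<forall>k<\<beta>. \<not> cyclic H S T k) \<and>
         (\<exists>(H' :: 'a set) S' T' K.
            pure_q_isopair p H' S' T' \<and> cyclic H' S' T' \<beta> \<and>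
            invariant_subspace H' S' T' K \<and> is_restriction_to H S T K S' T')"
proof -
  have "p \<noteq> 0" and clH: "closed_csubspace H"
    and isoS: "isometry_on H S" and isoT: "isometry_on H T"
    and pureS: "(\<Inter>j\<in>{1..}. (S ^^ j) ` H) = {0}"
    and comm: "\<And>x. x \<in> H \<Longrightarrow> S (T x) = T (S x)" and ann: "annihilates p H S T"
    using assms(1) by (auto simp: pure_q_isopair_def pure_isopair_def pure_isometry_def)
  have sf: "squarefree p" and toral: "inner_toral p"
    using assms(3) by (auto simp: minimal_polynomial_def)
  have SH: "S x \<in> H" and TH: "T x \<in> H" if "x \<in> H" for x
    using isoS isoT that by (auto simp: isometry_on_def)
  \<comment> \<open>\<open>S\<close> and \<open>T\<close> are linear on \<open>H\<close> only; \<open>A\<close> and \<open>B\<close> agree with them there.\<close>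
  define A where "A x = S (proj H x)" for x
  define B where "B x = T (proj H x)" for x
  have A: "A x = S x" and B: "B x = T x" if "x \<in> H" for x
    using linear_extension[OF clH isoS] linear_extension[OF clH isoT] that
    by (simp_all add: A_def B_def)
  have "(A ^^ j) ` H = (S ^^ j) ` H" for j
    using funpow_cong_on[OF A SH] by (intro image_cong) auto
  then interpret A: pure_iso H A
    using linear_extension[OF clH isoS] pureS
    by (simp add: pure_iso_def pure_iso_axioms_def A_def[abs_def])
  interpret B: isometry H B
    using linear_extension[OF clH isoT] by (simp add: B_def[abs_def])
  interpret commuting_isometries H A B
    by unfold_locales (simp add: A B SH TH comm)
  have combs: "poly_combs S T k f = cspan (monomials A B (f ` {1..k}))" if "f ` {1..k} \<subseteq> H" for k f
    using poly_combs_cong_on[OF A B SH TH that] by (simp add: poly_combs_eq)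
  have annAB: "annihilates p H A B"
    using ann op_eval_cong_on[OF A B SH TH] by (simp add: annihilates_def)
  have fdA: "finite_dim (A.eigenspace 0)" and fdB: "finite_dim (B.eigenspace 0)"
    using assms(2) ker_adjoint_cong_on[of H A S] ker_adjoint_cong_on[of H B T] A B
    by (simp_all add: finite_bimultiplicity_def A.ker_adjoint_eq B.ker_adjoint_eq
        A.eigenspace_def B.eigenspace_def)
  have joint: "ker_adjoint H (\<lambda>x. S x - l *\<^sub>C x) \<inter> ker_adjoint H (\<lambda>x. T x - m *\<^sub>C x) =
      joint_eigenspace l m" for l m
  proof -
    have "ker_adjoint H (\<lambda>x. S x - l *\<^sub>C x) = ker_adjoint H (\<lambda>x. A x - l *\<^sub>C x)"
      "ker_adjoint H (\<lambda>x. T x - m *\<^sub>C x) = ker_adjoint H (\<lambda>x. B x - m *\<^sub>C x)"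
      by (rule ker_adjoint_cong_on; simp add: A B)+
    then show ?thesis
      by (simp add: A.ker_adjoint_shift B.ker_adjoint_shift joint_eigenspace_def A.eigenspace_def
          B.eigenspace_def)
  qed

  obtain r where r: "r \<noteq> 0" "\<And>l. poly r l \<noteq> 0 \<Longrightarrow> rsquarefree (slice p l)"
    using generic_slice_rsquarefree[OF sf \<open>p \<noteq> 0\<close>] by blast
  have dvd: "P j dvd p" if "j \<in> {1..s}" for j
    unfolding assms(5) using that by (intro dvd_prodI) auto
  have zero: "eval2 p l m = 0" if "j \<in> {1..s}" "eval2 (P j) l m = 0" for j l m
    using dvd[OF that(1)] that(2) by (auto elim!: dvdE simp: eval2_mult)
  have rank: "complex_vector.dim (joint_eigenspace l m) = \<alpha> j"
    if j: "j \<in> {1..s}" "eval2 (P j) l m = 0" and l: "norm l < 1" "poly r l \<noteq> 0" for j l m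
  proof -
    have "norm m < 1" using inner_toral_disc[OF toral zero[OF j] l(1)] .
    moreover have "eval2 (pderiv p) l m \<noteq> 0"
      using r(2)[OF l(2)] zero[OF j] by (auto simp: rsquarefree_roots pderiv_slice poly_slice)
    then have "regular_point p l m" using zero[OF j] by (simp add: regular_point_def)
    ultimately show ?thesis
      using assms(8) j l(1) unfolding has_rank_def joint by auto
  qed
  have le_beta: "\<alpha> j \<le> \<beta>" if "j \<in> {1..s}" for j
    using that by (simp add: assms(9))
  have "\<beta> \<in> \<alpha> ` {1..s}" unfolding assms(9) using assms(4) by (intro Max_in) auto
  then obtain j0 where j0: "j0 \<in> {1..s}" "\<alpha> j0 = \<beta>" by auto

  \<comment> \<open>Over almost every point of the disc there is a zero of a factor of maximal rank.\<close>
  define \<Lambda> where "\<Lambda> = {l. norm l < 1 \<and> poly (r * lead_coeff (P j0)) l \<noteq> 0}"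
  have "P j0 \<noteq> 0" using dvd[OF j0(1)] \<open>p \<noteq> 0\<close> by auto
  then have inf: "infinite \<Lambda>"
    unfolding \<Lambda>_def using r(1) by (intro infinite_disc_off_roots) simp
  have Lam: "\<exists>m. complex_vector.dim (joint_eigenspace l m) = \<beta>" if "l \<in> \<Lambda>" for l
  proof -
    have l: "norm l < 1" "poly r l \<noteq> 0" "poly (lead_coeff (P j0)) l \<noteq> 0"
      using that by (auto simp: \<Lambda>_def)
    have "\<not> is_unit (P j0)" using assms(6) j0(1) by (auto simp: irreducible_def)
    then have "0 < degree (P j0)"
      using inner_toral_factor_degree[OF toral dvd[OF j0(1)] _ \<open>p \<noteq> 0\<close>] by blast
    moreover have "degree (P j0) \<le> degree (slice (P j0) l)"
      by (rule le_degree) (simp add: coeff_slice l(3))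
    ultimately obtain m where "poly (slice (P j0) l) m = 0"
      using fundamental_theorem_of_algebra[of "slice (P j0) l"]
        constant_degree[of "slice (P j0) l"] by auto
    then show ?thesis using rank[OF j0(1) _ l(1,2), of m] j0(2) by (auto simp: poly_slice)
  qed

  have few: "\<not> finite_codim_in H (closure (poly_combs S T k f))"
    if f: "f ` {1..k} \<subseteq> H" and card: "card (f ` {1..k}) < \<beta>" for k f
    unfolding combs[OF f]
  proof (rule few_generators_infinite_codimension[OF inf _ _ f])
    show "\<exists>m. card (f ` {1..k}) < complex_vector.dim (joint_eigenspace l m)" if "l \<in> \<Lambda>" for l
      using Lam[OF that] card by metis
  qed simp
  have card_le: "card (f ` {1..k}) \<le> k" for f :: "nat \<Rightarrow> 'a" and k
    using card_image_le[of "{1..k}" f] by simp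

  obtain l where "l \<in> \<Lambda>" using inf infinite_imp_nonempty by blast
  then have l: "norm l < 1" "poly r l \<noteq> 0" by (auto simp: \<Lambda>_def)
  have "complex_vector.dim (joint_eigenspace l m) \<le> \<beta>" if root: "eval2 p l m = 0" for m
  proof -
    have "eval2 p l m = (\<Prod>j=1..s. eval2 (P j) l m)"
      by (simp add: assms(5) eval2_def poly_prod)
    then obtain j where j: "j \<in> {1..s}" "eval2 (P j) l m = 0" using root by auto
    then show ?thesis using rank[OF j l] le_beta[OF j(1)] by simp
  qed
  then obtain f where f: "f ` {1..\<beta>} \<subseteq> H"
    "finite_codim_in H (closure (cspan (monomials A B (f ` {1..\<beta>}))))"
    using nearly_generating_vectors[OF annAB r(2)[OF l(2)] l(1) fdA fdB, of \<beta>] by blast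
  define K where "K = closure (poly_combs S T \<beta> f)"
  have fcK: "finite_codim_in H K" unfolding K_def combs[OF f(1)] by (rule f(2))
  then have KH: "K \<subseteq> H" by (simp add: finite_codim_in_def)
  have clK: "closed_csubspace K"
    unfolding K_def combs[OF f(1)] by (simp add: closed_csubspace_def csubspace_closure)
  define N where "N = cspan (monomials A B (f ` {1..\<beta>}))"
  have NH: "N \<subseteq> H"
    unfolding N_def by (intro complex_vector.span_minimal[OF _ A.sub_H] monomials_subset f(1))
  have NAB: "A x \<in> N" "B x \<in> N" if "x \<in> N" for x
    using cspan_monomials_invariant[OF f(1)] that by (auto simp: N_def)
  have KN: "K = closure N" by (simp add: K_def N_def combs[OF f(1)])
  have KA: "A x \<in> K" and KB: "B x \<in> K" if "x \<in> K" for x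
    using A.closure_invariant[OF NH NAB(1)] B.closure_invariant[OF NH NAB(2)] that by (auto simp: KN)
  have KS: "S x \<in> K" and KT: "T x \<in> K" if "x \<in> K" for x
    using KA[OF that] KB[OF that] A[of x] B[of x] that KH by auto
  have invK: "invariant_subspace H S T K"
    using KH clK KS KT by (auto simp: invariant_subspace_def)

  have "f ` {1..\<beta>} \<subseteq> K"
  proof -
    have "(A ^^ 0) ((B ^^ 0) x) \<in> monomials A B (f ` {1..\<beta>})" if "x \<in> f ` {1..\<beta>}" for x
      using that by (rule monomialsI)
    then have "f ` {1..\<beta>} \<subseteq> N" unfolding N_def by (auto intro: complex_vector.span_base)
    then show ?thesis unfolding KN using closure_subset by blast
  qed
  \<comment> \<open>A repetition would leave fewer than \<open>\<beta>\<close> generators.\<close>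
  moreover have "inj_on f {1..\<beta>}"
  proof (rule ccontr)
    assume "\<not> inj_on f {1..\<beta>}"
    then have "card (f ` {1..\<beta>}) \<noteq> \<beta>" using eq_card_imp_inj_on[of "{1..\<beta>}" f] by auto
    then have "card (f ` {1..\<beta>}) < \<beta>" using card_le[of f \<beta>] by simp
    from few[OF f(1) this] show False using fcK by (simp add: K_def)
  qed
  moreover have "at_least_nearly_cyclic K S T \<beta>"
    unfolding at_least_nearly_cyclic_def
  proof (intro allI impI notI)
    fix k g assume k: "k < \<beta>" "g ` {1..k} \<subseteq> K"
      and "finite_codim_in K (closure (poly_combs S T k g))"
    then have "finite_codim_in H (closure (poly_combs S T k g))"
      using finite_codim_in_trans[OF fcK] by blast
    moreover have "g ` {1..k} \<subseteq> H" using k(2) KH by blast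
    moreover have "card (g ` {1..k}) < \<beta>" using card_le[of g k] k(1) by simp
    ultimately show False using few by blast
  qed
  moreover have "finite_codim_in K K"
    using clK by (intro finite_codim_in_refl) (simp add: closed_csubspace_def)
  ultimately have cyc: "cyclic K S T \<beta>"
    unfolding cyclic_def nearly_cyclic_def at_most_nearly_cyclic_def K_def by blast

  have not_cyclic: "\<not> cyclic H S T k" if "k < \<beta>" for k
  proof
    assume "cyclic H S T k"
    then obtain g where g: "g ` {1..k} \<subseteq> H" "closure (poly_combs S T k g) = H"
      unfolding cyclic_def by blast
    moreover have "card (g ` {1..k}) < \<beta>" using card_le[of g k] that by simp
    ultimately show False using few finite_codim_in_refl[OF A.sub_H] by metis
  qed
  \<comment> \<open>The larger pair is the restriction to \<open>K\<close>, which contains a copy of \<open>H\<close> inside itself.\<close>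
  obtain U where U: "intertwiner U" "U ` H \<subseteq> K"
    using intertwiner_into_finite_codim[OF clK KA fcK] by blast
  have US: "clinear_on H U" "\<And>x. x \<in> H \<Longrightarrow> norm (U x) = norm x" "\<And>x. x \<in> H \<Longrightarrow> U x \<in> H"
    "\<And>x. x \<in> H \<Longrightarrow> U (S x) = S (U x)" "\<And>x. x \<in> H \<Longrightarrow> U (T x) = T (U x)"
    using U(1) A B by (auto simp: intertwiner_def)
  have "closed_csubspace (U ` H)" by (rule closed_csubspace_isometric_image[OF clH US(1,2)])
  moreover have "S ` U ` H \<subseteq> U ` H" "T ` U ` H \<subseteq> U ` H"
    using US(4,5) SH TH by (auto simp: image_subset_iff) (metis imageI)+
  ultimately have "invariant_subspace K S T (U ` H)"
    using U(2) by (simp add: invariant_subspace_def)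
  moreover have "is_restriction_to H S T (U ` H) S T"
    unfolding is_restriction_to_def using US by blast
  moreover have "pure_q_isopair p K S T" by (rule pure_q_isopair_restrict[OF assms(1) invK])
  ultimately have "\<exists>(H' :: 'a set) S' T' K. pure_q_isopair p H' S' T' \<and> cyclic H' S' T' \<beta> \<and>
      invariant_subspace H' S' T' K \<and> is_restriction_to H S T K S' T'"
    using cyc by (intro exI[of _ K] exI[of _ S] exI[of _ T] exI[of _ "U ` H"] conjI)
  moreover have "\<exists>H'. invariant_subspace H S T H' \<and> finite_codim_in H H' \<and> cyclic H' S T \<beta>"
    using invK fcK cyc by (intro exI[of _ K] conjI)
  moreover have "\<forall>k<\<beta>. \<not> cyclic H S T k" using not_cyclic by simp
  ultimately show ?thesis by (intro conjI)
qed

end
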